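(* Assume that for $i=1,2$: $f_i(0)=f_i(K_i)=0$, $0<f_i(s)\le f_i'(0)s$ for all $s\in(0,K_i)$, $f_i'(K_i)<0$, and $f_i<0$ in $(K_i,+\infty)$; assume also $0<K_1\le K_2$. Let $V$ be the unique positive bounded classical stationary solution of (P). Then the solution $u$ of (P) with a nonnegative bounded and continuous initial datum $u_0\not\equiv0$ satisfies $$u(t,x)\to V(x)\ \text{ as }t\to+\infty,\ \text{ locally uniformly in }x\in\mathbb{R}.$$ Furthermore, if $u_0$ is compactly supported, then, with $c_1^*=2\sqrt{d_1f_1'(0)}>0$ and $c_2^*=2\sqrt{d_2f_2'(0)}>0$ (the leftward and rightward asymptotic spreading speeds, respectively), one has $$\lim_{t\to+\infty}\Big(\sup_{x\le-(c_1^*+\varepsilon)t}u(t,x)\Big)=\lim_{t\to+\infty}\Big(\sup_{x\ge(c_2^*+\varepsilon)t}u(t,x)\Big)=0\quad\text{for all }\varepsilon>0,$$ $$\lim_{t\to+\infty}\Big(\sup_{(-c_1^*+\varepsilon)t\le x\le(c_2^*-\varepsilon)t}|u(t,x)-V(x)|\Big)=0\quad\text{for all }0<\varepsilon\le\min(c_1^*,c_2^* ).$$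
   Context: Setting. Let $d_1,d_2,\sigma>0$ and let $f_1,f_2\in C^1(\mathbb{R})$, with constants $K_1,K_2>0$. Put $I_1=(-\infty,0)$ (patch 1), $I_2=(0,+\infty)$ (patch 2). Problem (P) is $$\begin{cases}u_t=d_1u_{xx}+f_1(u),& t>0,\ x<0,\\ u_t=d_2u_{xx}+f_2(u),& t>0,\ x>0,\\ u(t,0^-)=u(t,0^+),& t>0,\\ u_x(t,0^-)=\sigma u_x(t,0^+),& t>0,\end{cases}$$ with initial condition $u(0,\cdot)=u_0$. A classical solution is a continuous $u:[0,+\infty)\times\mathbb{R}\to\mathbb{R}$ with $u(0,\cdot)=u_0$, such that for $i=1,2$ the restriction of $u$ to $(0,+\infty)\times\overline{I_i}$ is $C^1$ in $t$ and $C^2$ in $x$ (up to $x=0$), and all identities in (P) hold pointwise. For every nonnegative bounded continuous $u_0$ there is a unique nonnegative bounded classical solution, called the solution of (P) with initial datum $u_0$. A classical stationary solution of (P) is a continuous $U:\mathbb{R}\to\mathbb{R}$ with $U|_{\overline{I_i}}\in C^2(\overline{I_i})$ satisfying the (time-independent) identities of (P) pointwise, i.e. $d_iU''+f_i(U)=0$ in $I_i$ and $U'(0^-)=\sigma U'(0^+)$. Under the assumptions of the claim, (P) has exactly one positive bounded classical stationary solution, denoted $V$. *)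

theory Defs
  imports "HOL-Analysis.Analysis"
begin

text \<open>
  The classes \<open>C\<^sup>2\<close> and \<open>C\<^sup>1\<^sup>;\<^sup>2\<close> (once in time, twice in space) on a closed half-line \<open>S\<close>.
  Space derivatives are taken within \<open>S\<close>, hence are one-sided at the interface \<open>x = 0\<close>; the
  derivatives of a function on the two sides of the interface need not agree.
\<close>

definition C2_on :: "real set \<Rightarrow> (real \<Rightarrow> real) \<Rightarrow> bool" where
  "C2_on S U \<longleftrightarrow>
    (\<exists>U1 U2.
      (\<forall>x\<in>S. (U has_real_derivative U1 x) (at x within S) \<and>
              (U1 has_real_derivative U2 x) (at x within S)) \<and>
      continuous_on S U2)"

text \<open>The first argument of \<open>u\<close> is time, restricted to \<open>t > 0\<close>; the partial derivatives are
  jointly continuous on \<open>(0, \<infinity>) \<times> S\<close>.\<close>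

definition C12_on :: "real set \<Rightarrow> (real \<Rightarrow> real \<Rightarrow> real) \<Rightarrow> bool" where
  "C12_on S u \<longleftrightarrow>
    (\<exists>ut ux uxx.
      (\<forall>t>0. \<forall>x\<in>S. ((\<lambda>s. u s x) has_real_derivative ut t x) (at t) \<and>
                     (u t has_real_derivative ux t x) (at x within S) \<and>
                     (ux t has_real_derivative uxx t x) (at x within S)) \<and>
      continuous_on ({0<..} \<times> S) (\<lambda>(t, x). ut t x) \<and>
      continuous_on ({0<..} \<times> S) (\<lambda>(t, x). ux t x) \<and>
      continuous_on ({0<..} \<times> S) (\<lambda>(t, x). uxx t x))"

text \<open>\<open>U'(0\<^sup>-) = \<sigma> U'(0\<^sup>+)\<close>, both one-sided derivatives being required to exist.\<close>

definition flux_condition :: "real \<Rightarrow> (real \<Rightarrow> real) \<Rightarrow> bool" where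
  "flux_condition \<sigma> U \<longleftrightarrow>
    (\<exists>D. (U has_real_derivative \<sigma> * D) (at_left 0) \<and> (U has_real_derivative D) (at_right 0))"

text \<open>The matching condition \<open>u(t, 0\<^sup>-) = u(t, 0\<^sup>+)\<close> is part of the continuity of \<open>u\<close>. Only the
  values \<open>u t x\<close> with \<open>t \<ge> 0\<close> are constrained.\<close>

definition classical_solution ::
  "real \<Rightarrow> real \<Rightarrow> real \<Rightarrow> (real \<Rightarrow> real) \<Rightarrow> (real \<Rightarrow> real) \<Rightarrow>
   (real \<Rightarrow> real) \<Rightarrow> (real \<Rightarrow> real \<Rightarrow> real) \<Rightarrow> bool" where
  "classical_solution d1 d2 \<sigma> f1 f2 u0 u \<longleftrightarrow>
    continuous_on ({0..} \<times> UNIV) (\<lambda>(t, x). u t x) \<and>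
    (\<forall>x. u 0 x = u0 x) \<and>
    C12_on {..0} u \<and> C12_on {0..} u \<and>
    (\<forall>t>0. \<forall>x<0. deriv (\<lambda>s. u s x) t = d1 * deriv (deriv (u t)) x + f1 (u t x)) \<and>
    (\<forall>t>0. \<forall>x>0. deriv (\<lambda>s. u s x) t = d2 * deriv (deriv (u t)) x + f2 (u t x)) \<and>
    (\<forall>t>0. flux_condition \<sigma> (u t))"

definition nonneg_bounded_classical_solution ::
  "real \<Rightarrow> real \<Rightarrow> real \<Rightarrow> (real \<Rightarrow> real) \<Rightarrow> (real \<Rightarrow> real) \<Rightarrow>
   (real \<Rightarrow> real) \<Rightarrow> (real \<Rightarrow> real \<Rightarrow> real) \<Rightarrow> bool" where
  "nonneg_bounded_classical_solution d1 d2 \<sigma> f1 f2 u0 u \<longleftrightarrow>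
    classical_solution d1 d2 \<sigma> f1 f2 u0 u \<and>
    (\<forall>t\<ge>0. \<forall>x. 0 \<le> u t x) \<and>
    bounded {u t x | t x. 0 \<le> t}"

definition classical_stationary_solution ::
  "real \<Rightarrow> real \<Rightarrow> real \<Rightarrow> (real \<Rightarrow> real) \<Rightarrow> (real \<Rightarrow> real) \<Rightarrow> (real \<Rightarrow> real) \<Rightarrow> bool" where
  "classical_stationary_solution d1 d2 \<sigma> f1 f2 U \<longleftrightarrow>
    continuous_on UNIV U \<and>
    C2_on {..0} U \<and> C2_on {0..} U \<and>
    (\<forall>x<0. d1 * deriv (deriv U) x + f1 (U x) = 0) \<and>
    (\<forall>x>0. d2 * deriv (deriv U) x + f2 (U x) = 0) \<and>
    flux_condition \<sigma> U"

definition positive_bounded_stationary_solution ::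
  "real \<Rightarrow> real \<Rightarrow> real \<Rightarrow> (real \<Rightarrow> real) \<Rightarrow> (real \<Rightarrow> real) \<Rightarrow> (real \<Rightarrow> real) \<Rightarrow> bool" where
  "positive_bounded_stationary_solution d1 d2 \<sigma> f1 f2 U \<longleftrightarrow>
    classical_stationary_solution d1 d2 \<sigma> f1 f2 U \<and> (\<forall>x. 0 < U x) \<and> bounded (range U)"

definition KPP_reaction :: "real \<Rightarrow> (real \<Rightarrow> real) \<Rightarrow> bool" where
  "KPP_reaction K f \<longleftrightarrow>
    f C1_differentiable_on UNIV \<and>
    f 0 = 0 \<and> f K = 0 \<and>
    (\<forall>s. 0 < s \<and> s < K \<longrightarrow> 0 < f s \<and> f s \<le> deriv f 0 * s) \<and>
    deriv f K < 0 \<and>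
    (\<forall>s>K. f s < 0)"

definition spreading_speed :: "real \<Rightarrow> (real \<Rightarrow> real) \<Rightarrow> real" where
  "spreading_speed d f = 2 * sqrt (d * deriv f 0)"

end

theory Submission
  imports Defs
begin

text \<open>Two facts replace the usual machinery of parabolic regularity and compactness.

The first is a comparison principle (\<open>comparison_sub\<close>,
\<open>comparison_super\<close>) that looks only at a first touching point of the solution and a
strict barrier. At such a point the derivatives of the two functions are ordered, which
contradicts strictness; at the interface the same happens with the two one-sided slopes. Since the
argument is local, a barrier needs to be strict only where it can touch, and all bounds on the
solution come from explicit barriers: a Gaussian that crosses the interface
(\<open>positivity\<close>: the solution becomes positive at once), exponentially weighted cosines
moving at any speed below \<open>2 * sqrt (d * f' 0)\<close> (\<open>left_cone\<close>: a positive
floor on an expanding cone), parabolas with a vertex that moves at constant speed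
(\<open>box_lift\<close>: far from the interface the floor is lifted to the carrying capacity of
the patch, and by reflection the solution is pushed down to it from above), kinked lines
(\<open>interface_lift\<close>: the same on a strip around the interface), and exponentials
(\<open>decay_right\<close>: decay ahead of the cone).

The second is the description of the limit by first order equations. With \<open>\<Phi>1' = -
f1\<close>, \<open>\<Phi>1 K1 = 0\<close> and \<open>\<Phi>2' = - f2\<close>, \<open>\<Phi>2 K2 =
0\<close>, conservation of energy (\<open>left_energy\<close>) turns the stationary equation into
\<open>V' = sqrt (2 * \<Phi>1 V / d1)\<close> on the left and \<open>V' = sqrt (2 * \<Phi>2 V /
d2)\<close> on the right. As a function of the value \<open>w\<close>, the first slope increases
and the second one decreases for \<open>w\<close> between \<open>K1\<close> and \<open>K2\<close>.
Hence a profile that obeys slightly perturbed first order equations on the two sides, and takes a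
value \<open>w > V 0\<close> at the interface, satisfies the flux condition with a strict
inequality, and it is a strict supersolution. The value \<open>w\<close> can therefore be lowered
slowly from a large number to any number above \<open>V 0\<close> while the profile stays above
the solution (\<open>barrier_sweep\<close>). The final profile is close to \<open>V\<close>, by
the same monotonicity of the slopes (\<open>eventually_below\<close>). The reflection \<open>u t x
\<mapsto> K1 + K2 - u t (- x)\<close> exchanges the patches and the two bounds, and gives the
estimate from below. When \<open>K1 = K2\<close> the bounds coming from the first part already
coincide.

The stationary solution is itself a solution of the parabolic problem, so the same bounds give its
limits at infinity and \<open>K1 \<le> V \<le> K2\<close> (\<open>stationary_front\<close>).\<close>

section \<open>Solutions, jets and symmetries\<close>

text \<open>A barrier is compared with the solution at one point at a time, so what matters is the
pair of \<open>u_t\<close> and \<open>u_xx\<close> at that point; the first space derivative has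
to exist nearby only.\<close>

definition has_jet :: "(real \<Rightarrow> real \<Rightarrow> real) \<Rightarrow> real \<Rightarrow> real \<Rightarrow> real \<Rightarrow> real \<Rightarrow> bool" where
  "has_jet u t x a b \<longleftrightarrow>
    ((\<lambda>s. u s x) has_real_derivative a) (at t) \<and>
    (\<exists>v. (\<forall>\<^sub>F y in nhds x. (u t has_real_derivative v y) (at y)) \<and>
         (v has_real_derivative b) (at x))"

lemma has_jetI:
  assumes "((\<lambda>s. u s x) has_real_derivative a) (at t)"
    and "open S" "x \<in> S" "\<And>y. y \<in> S \<Longrightarrow> (u t has_real_derivative v y) (at y)"
    and "(v has_real_derivative b) (at x)"
  shows "has_jet u t x a b"
  unfolding has_jet_def using assms by (metis (mono_tags, lifting) eventually_nhds)

lemma has_jet_diff: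
  assumes "has_jet u t x a b" "has_jet w t x a' b'"
  shows "has_jet (\<lambda>t x. u t x - w t x) t x (a - a') (b - b')"
proof -
  from assms obtain v v' where
    v: "\<forall>\<^sub>F y in nhds x. (u t has_real_derivative v y) (at y)" "(v has_real_derivative b) (at x)" and
    v': "\<forall>\<^sub>F y in nhds x. (w t has_real_derivative v' y) (at y)" "(v' has_real_derivative b') (at x)"
    unfolding has_jet_def by blast
  have "\<forall>\<^sub>F y in nhds x. ((\<lambda>x. u t x - w t x) has_real_derivative v y - v' y) (at y)"
    using v(1) v'(1) by eventually_elim (rule DERIV_diff)
  moreover have "((\<lambda>y. v y - v' y) has_real_derivative b - b') (at x)"
    using v(2) v'(2) by (rule DERIV_diff)
  moreover have "((\<lambda>s. u s x - w s x) has_real_derivative a - a') (at t)"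
    using assms unfolding has_jet_def by (intro DERIV_diff) auto
  ultimately show ?thesis
    unfolding has_jet_def by (intro conjI exI[of _ "\<lambda>y. v y - v' y"])
qed

lemma has_jet_const: "has_jet (\<lambda>t x. C) t x 0 0"
  by (rule has_jetI[where S = UNIV and v = "\<lambda>_. 0"]) auto

lemma has_jet_reflect_value:
  "has_jet u t x a b \<Longrightarrow> has_jet (\<lambda>t x. C - u t x) t x (- a) (- b)"
  using has_jet_diff[OF has_jet_const[of C t x]] by fastforce

lemma has_jet_reflect_space:
  assumes "has_jet u t (- x) a b"
  shows "has_jet (\<lambda>t x. u t (- x)) t x a b"
proof -
  from assms obtain v where
    v: "\<forall>\<^sub>F y in nhds (- x). (u t has_real_derivative v y) (at y)" "(v has_real_derivative b) (at (- x))"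
    and a: "((\<lambda>s. u s (- x)) has_real_derivative a) (at t)"
    unfolding has_jet_def by blast
  have lim: "filterlim uminus (nhds (- x)) (nhds x)"
    by (intro tendsto_intros filterlim_ident)
  have 1: "\<forall>\<^sub>F y in nhds x. (u t has_real_derivative v (- y)) (at (- y))"
    using v(1) lim by (rule eventually_compose_filterlim)
  have 2: "\<forall>\<^sub>F y in nhds x. ((\<lambda>x. u t (- x)) has_real_derivative - v (- y)) (at y)"
    using 1
  proof eventually_elim
    case (elim y)
    have "((\<lambda>x. u t (- x)) has_real_derivative v (- y) * (- 1)) (at y)"
      by (rule DERIV_chain2[where g = uminus, OF elim]) (auto intro!: derivative_eq_intros)
    then show ?case by simp
  qed
  have "((\<lambda>y. - v (- y)) has_real_derivative b) (at x)"
    using DERIV_minus[OF DERIV_chain2[where g = uminus and x = x, OF v(2) DERIV_minus[OF DERIV_ident]]]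
    by simp
  then show ?thesis
    unfolding has_jet_def using 2 a by (intro conjI exI[of _ "\<lambda>y. - v (- y)"])
qed

text \<open>The parabolic derivative tests at a zero that is a minimum in space and was approached
from above in time. Only the past enters, because a first touching time says nothing about later
times.\<close>

lemma has_jet_min:
  assumes jet: "has_jet h t x a b" and z: "h t x = 0"
    and past: "\<forall>\<^sub>F s in at_left t. 0 \<le> h s x"
    and space: "\<forall>\<^sub>F y in nhds x. 0 \<le> h t y"
  shows "a \<le> 0" "0 \<le> b"
proof -
  from jet obtain v where a: "((\<lambda>s. h s x) has_real_derivative a) (at t)" and
    v: "\<forall>\<^sub>F y in nhds x. (h t has_real_derivative v y) (at y)" "(v has_real_derivative b) (at x)"
    unfolding has_jet_def by blast
  show "a \<le> 0"
  proof (rule ccontr)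
    assume "\<not> a \<le> 0"
    then obtain d where d: "d > 0" "\<And>k. 0 < k \<Longrightarrow> k < d \<Longrightarrow> h (t - k) x < h t x"
      using DERIV_pos_inc_left[OF a] by auto
    have "\<forall>\<^sub>F s in at_left t. h s x < 0"
      unfolding eventually_at_left_field
      by (rule exI[of _ "t - d"]) (use d(1) d(2)[of "t - s" for s] z in force)
    with past have "\<forall>\<^sub>F s in at_left t. False" by eventually_elim auto
    then show False by simp
  qed
  show "0 \<le> b"
  proof (rule ccontr)
    assume nb: "\<not> 0 \<le> b"
    obtain S where S: "open S" "x \<in> S" "\<And>y. y \<in> S \<Longrightarrow> (h t has_real_derivative v y) (at y) \<and> 0 \<le> h t y"
      using eventually_conj[OF v(1) space] unfolding eventually_nhds by blast
    obtain e where e: "e > 0" "\<And>y. \<bar>y - x\<bar> < e \<Longrightarrow> y \<in> S"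
      using S(1,2) by (auto simp: open_dist dist_real_def)
    have "v x = 0"
      by (rule DERIV_local_min[of "h t" "v x" x e]) (use S e z in \<open>auto simp: abs_minus_commute\<close>)
    moreover obtain d where d: "d > 0" "\<And>k. 0 < k \<Longrightarrow> k < d \<Longrightarrow> v (x + k) < v x"
      using DERIV_neg_dec_right[OF v(2)] nb by auto
    ultimately have neg: "v y < 0" if "x < y" "y < x + d" for y using that d(2)[of "y - x"] by simp
    define y where "y = x + min d e / 2"
    have y: "x < y" "y < x + d" "y < x + e" using d e by (auto simp: y_def min_def field_simps)
    have "\<exists>z>x. z < y \<and> h t y - h t x = (y - x) * v z"
      by (rule MVT2) (use y e S in auto)
    then obtain z where "x < z" "z < y" "h t y - h t x = (y - x) * v z" by blast
    then have "h t y < 0" using neg[of z] y z by (simp add: mult_pos_neg)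
    then show False using S e(2)[of y] y by force
  qed
qed

text \<open>The equations without the initial condition and with the derivatives packaged as jets.
The reaction terms are arbitrary, so this class is closed under reflections in space and in value,
which turn statements about one patch, or about lower bounds, into statements about the other
patch, or about upper bounds.\<close>

definition two_patch where
  "two_patch d1 d2 \<sigma> f1 f2 u \<longleftrightarrow>
    continuous_on ({0..} \<times> UNIV) (\<lambda>(t, x). u t x) \<and>
    (\<forall>t>0. \<forall>x<0. \<exists>b. has_jet u t x (d1 * b + f1 (u t x)) b) \<and>
    (\<forall>t>0. \<forall>x>0. \<exists>b. has_jet u t x (d2 * b + f2 (u t x)) b) \<and>
    (\<forall>t>0. flux_condition \<sigma> (u t))"

lemma two_patch_reflect_value:
  assumes "two_patch d1 d2 \<sigma> f1 f2 u"
  shows "two_patch d1 d2 \<sigma> (\<lambda>s. - f1 (C - s)) (\<lambda>s. - f2 (C - s)) (\<lambda>t x. C - u t x)"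
  unfolding two_patch_def
proof (intro conjI allI impI)
  show "continuous_on ({0..} \<times> UNIV) (\<lambda>(t, x). C - u t x)"
    using assms unfolding two_patch_def case_prod_unfold by (intro continuous_intros) auto
next
  fix t x :: real assume "t > 0" "x < 0"
  then obtain b where "has_jet u t x (d1 * b + f1 (u t x)) b" using assms unfolding two_patch_def by blast
  from has_jet_reflect_value[OF this, of C]
  show "\<exists>b. has_jet (\<lambda>t x. C - u t x) t x (d1 * b + - f1 (C - (C - u t x))) b"
    by (intro exI[of _ "- b"]) simp
next
  fix t x :: real assume "t > 0" "x > 0"
  then obtain b where "has_jet u t x (d2 * b + f2 (u t x)) b" using assms unfolding two_patch_def by blast
  from has_jet_reflect_value[OF this, of C]
  show "\<exists>b. has_jet (\<lambda>t x. C - u t x) t x (d2 * b + - f2 (C - (C - u t x))) b"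
    by (intro exI[of _ "- b"]) simp
next
  fix t :: real assume "t > 0"
  then obtain D where D: "(u t has_real_derivative \<sigma> * D) (at_left 0)" "(u t has_real_derivative D) (at_right 0)"
    using assms unfolding two_patch_def flux_condition_def by blast
  show "flux_condition \<sigma> (\<lambda>x. C - u t x)"
    unfolding flux_condition_def using D
    by (intro exI[of _ "- D"]) (auto intro!: derivative_eq_intros)
qed

lemma has_derivative_reflect_left:
  assumes "(f has_real_derivative D) (at_right 0)"
  shows "((\<lambda>x. f (- x)) has_real_derivative - D) (at_left (0::real))"
proof -
  have "((f \<circ> uminus) has_real_derivative D * (-1)) (at 0 within {..<0})"
    by (rule DERIV_image_chain) (use assms in \<open>auto intro!: derivative_eq_intros\<close>)
  then show ?thesis by (simp add: o_def)
qed

lemma has_derivative_reflect_right: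
  assumes "(f has_real_derivative D) (at_left 0)"
  shows "((\<lambda>x. f (- x)) has_real_derivative - D) (at_right (0::real))"
proof -
  have "((f \<circ> uminus) has_real_derivative D * (-1)) (at 0 within {0<..})"
    by (rule DERIV_image_chain) (use assms in \<open>auto intro!: derivative_eq_intros\<close>)
  then show ?thesis by (simp add: o_def)
qed

text \<open>The reflected flux condition reads \<open>u'(0+) = \<sigma> * u'(0-)\<close> in terms of
the new sides, hence the factor \<open>1 / \<sigma>\<close>.\<close>

lemma two_patch_reflect_space:
  assumes "two_patch d1 d2 \<sigma> f1 f2 u" "0 < \<sigma>"
  shows "two_patch d2 d1 (1 / \<sigma>) f2 f1 (\<lambda>t x. u t (- x))"
  unfolding two_patch_def
proof (intro conjI allI impI)
  have "continuous_on ({0..} \<times> UNIV) ((\<lambda>(t, x). u t x) \<circ> (\<lambda>(t, x). (t, - x)))"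
    using assms unfolding two_patch_def
    by (intro continuous_on_compose)
       (auto simp: case_prod_unfold intro!: continuous_intros elim!: continuous_on_subset)
  then show "continuous_on ({0..} \<times> UNIV) (\<lambda>(t, x). u t (- x))"
    by (simp add: o_def case_prod_unfold)
next
  fix t x :: real assume "t > 0" "x < 0"
  then obtain b where "has_jet u t (- x) (d2 * b + f2 (u t (- x))) b"
    using assms unfolding two_patch_def by (metis neg_0_less_iff_less)
  from has_jet_reflect_space[OF this]
  show "\<exists>b. has_jet (\<lambda>t x. u t (- x)) t x (d2 * b + f2 (u t (- x))) b" by blast
next
  fix t x :: real assume "t > 0" "x > 0"
  then obtain b where "has_jet u t (- x) (d1 * b + f1 (u t (- x))) b"
    using assms unfolding two_patch_def by (metis neg_less_0_iff_less)
  from has_jet_reflect_space[OF this]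
  show "\<exists>b. has_jet (\<lambda>t x. u t (- x)) t x (d1 * b + f1 (u t (- x))) b" by blast
next
  fix t :: real assume "t > 0"
  then obtain D where D: "(u t has_real_derivative \<sigma> * D) (at_left 0)" "(u t has_real_derivative D) (at_right 0)"
    using assms unfolding two_patch_def flux_condition_def by blast
  show "flux_condition (1 / \<sigma>) (\<lambda>x. u t (- x))"
    unfolding flux_condition_def
    using has_derivative_reflect_left[OF D(2)] has_derivative_reflect_right[OF D(1)] assms(2)
    by (intro exI[of _ "- (\<sigma> * D)"]) auto
qed

section \<open>Comparison with strict barriers\<close>

lemma continuous_on_time_slice:
  assumes "two_patch d1 d2 \<sigma> f1 f2 u" "0 \<le> t"
  shows "continuous_on S (u t)"
proof -
  have "continuous_on S ((\<lambda>(t, x). u t x) \<circ> (\<lambda>x. (t, x)))"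
    using assms unfolding two_patch_def
    by (intro continuous_on_compose) (auto intro!: continuous_intros elim!: continuous_on_subset)
  then show ?thesis by (simp add: o_def)
qed

lemma DERIV_left_nonpos:
  fixes h :: "real \<Rightarrow> real"
  assumes "(h has_real_derivative D) (at_left x)" "h x = 0" "\<forall>\<^sub>F y in at_left x. 0 \<le> h y"
  shows "D \<le> 0"
proof -
  have "((\<lambda>y. (h y - h x) / (y - x)) \<longlongrightarrow> D) (at_left x)"
    using assms(1) by (simp add: has_field_derivative_iff)
  moreover have "\<forall>\<^sub>F y in at_left x. (h y - h x) / (y - x) \<le> 0"
    using assms(3) eventually_at_leftI[of "x - 1" x "\<lambda>y. y < x", simplified]
  proof eventually_elim
    case (elim y) then show ?case using assms(2) by (simp add: divide_nonneg_neg)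
  qed
  ultimately show ?thesis by (rule tendsto_upperbound) simp
qed

lemma DERIV_right_nonneg:
  fixes h :: "real \<Rightarrow> real"
  assumes "(h has_real_derivative D) (at_right x)" "h x = 0" "\<forall>\<^sub>F y in at_right x. 0 \<le> h y"
  shows "0 \<le> D"
proof -
  have "((\<lambda>y. (h y - h x) / (y - x)) \<longlongrightarrow> D) (at_right x)"
    using assms(1) by (simp add: has_field_derivative_iff)
  moreover have "\<forall>\<^sub>F y in at_right x. 0 \<le> (h y - h x) / (y - x)"
    using assms(3) eventually_at_right_less
  proof eventually_elim
    case (elim y) then show ?case using assms(2) by simp
  qed
  ultimately show ?thesis by (rule tendsto_lowerbound) simp
qed

text \<open>Among the points of the closed space-time domain where \<open>h \<le> 0\<close>, one
with the smallest time is chosen. It is neither initial nor lateral, and continuity in time from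
the past gives \<open>h \<ge> 0\<close> on the rest of its time slice. The lateral boundaries may
move, which is needed for travelling barriers.\<close>

lemma first_touching:
  fixes h :: "real \<Rightarrow> real \<Rightarrow> real"
  assumes a: "continuous_on {T0..T1} a" and b: "continuous_on {T0..T1} b"
    and h: "continuous_on ({T0..T1} \<times> UNIV) (\<lambda>(t, x). h t x)"
    and init: "\<And>x. a T0 \<le> x \<Longrightarrow> x \<le> b T0 \<Longrightarrow> 0 < h T0 x"
    and la: "\<And>t. T0 \<le> t \<Longrightarrow> t \<le> T1 \<Longrightarrow> 0 < h t (a t)"
    and lb: "\<And>t. T0 \<le> t \<Longrightarrow> t \<le> T1 \<Longrightarrow> 0 < h t (b t)"
    and neg: "T0 \<le> t1" "t1 \<le> T1" "a t1 \<le> x1" "x1 \<le> b t1" "h t1 x1 \<le> 0"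
  obtains t x where "T0 < t" "t \<le> T1" "a t < x" "x < b t" "h t x = 0"
    "\<forall>y. a t < y \<and> y < b t \<longrightarrow> 0 \<le> h t y" "\<forall>\<^sub>F s in at_left t. 0 \<le> h s x"
proof -
  define Z where "Z = {p \<in> {T0..T1} \<times> UNIV. h (fst p) (snd p) \<le> 0 \<and> a (fst p) \<le> snd p \<and> snd p \<le> b (fst p)}"
  obtain A where A: "\<And>t. t \<in> {T0..T1} \<Longrightarrow> \<bar>a t\<bar> \<le> A"
    using compact_imp_bounded[OF compact_continuous_image[OF a compact_Icc]]
    unfolding bounded_iff by force
  obtain B where B: "\<And>t. t \<in> {T0..T1} \<Longrightarrow> \<bar>b t\<bar> \<le> B"
    using compact_imp_bounded[OF compact_continuous_image[OF b compact_Icc]]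
    unfolding bounded_iff by force
  have cl: "closed ({T0..T1} \<times> (UNIV :: real set))" by (intro closed_Times) auto
  have ca: "continuous_on ({T0..T1} \<times> UNIV) (\<lambda>p::real\<times>real. a (fst p))"
    by (rule continuous_on_compose2[OF a]) (auto intro!: continuous_intros)
  have cb: "continuous_on ({T0..T1} \<times> UNIV) (\<lambda>p::real\<times>real. b (fst p))"
    by (rule continuous_on_compose2[OF b]) (auto intro!: continuous_intros)
  have hh: "continuous_on ({T0..T1} \<times> UNIV) (\<lambda>p. h (fst p) (snd p))"
    using h by (simp add: case_prod_unfold)
  have "closed {p \<in> {T0..T1} \<times> UNIV. h (fst p) (snd p) \<le> 0}"
    by (intro continuous_on_closed_Collect_le hh cl continuous_intros)
  moreover have "closed {p \<in> {T0..T1} \<times> UNIV. a (fst p) \<le> snd p}"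
    by (intro continuous_on_closed_Collect_le ca cl continuous_intros)
  moreover have "closed {p \<in> {T0..T1} \<times> UNIV. snd p \<le> b (fst p)}"
    by (intro continuous_on_closed_Collect_le cb cl continuous_intros)
  ultimately have "closed ({p \<in> {T0..T1} \<times> UNIV. h (fst p) (snd p) \<le> 0} \<inter>
      {p \<in> {T0..T1} \<times> UNIV. a (fst p) \<le> snd p} \<inter> {p \<in> {T0..T1} \<times> UNIV. snd p \<le> b (fst p)})"
    by (intro closed_Int)
  also have "\<dots> = Z" unfolding Z_def by auto
  finally have "closed Z" .
  moreover have "Z \<subseteq> {T0..T1} \<times> {-A..B}"
  proof
    fix p assume "p \<in> Z"
    then have "fst p \<in> {T0..T1}" "a (fst p) \<le> snd p" "snd p \<le> b (fst p)"
      unfolding Z_def by auto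
    then show "p \<in> {T0..T1} \<times> {-A..B}" using A[of "fst p"] B[of "fst p"] by (cases p) auto
  qed
  moreover have "compact ({T0..T1} \<times> {-A..B})" by (intro compact_Times compact_Icc)
  ultimately have "compact Z" by (metis compact_Int_closed inf.absorb_iff2)
  moreover have "Z \<noteq> {}" using neg unfolding Z_def by auto
  ultimately obtain p where p: "p \<in> Z" "\<And>q. q \<in> Z \<Longrightarrow> fst p \<le> fst q"
    using continuous_attains_inf[of Z fst] continuous_on_fst[OF continuous_on_id] by metis
  define t x where "t = fst p" and "x = snd p"
  have tx: "T0 \<le> t" "t \<le> T1" "a t \<le> x" "x \<le> b t" "h t x \<le> 0"
    using p(1) unfolding Z_def t_def x_def by auto
  have before: "0 < h s y" if "T0 \<le> s" "s < t" "a s \<le> y" "y \<le> b s" for s y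
    using p(2)[of "(s, y)"] that tx unfolding Z_def t_def by force
  have T0t: "T0 < t" using tx init[of x] by (cases "t = T0") auto
  have ax: "a t < x" using la[of t] tx by (cases "x = a t") auto
  have xb: "x < b t" using lb[of t] tx by (cases "x = b t") auto
  have ct: "continuous (at_left t) g" if "continuous_on {T0..T1} g" for g :: "real \<Rightarrow> real"
  proof -
    have "continuous (at t within {T0..T1}) g" using that tx by (simp add: continuous_on_eq_continuous_within)
    then have "continuous (at t within {T0..t}) g" by (rule continuous_within_subset) (use tx in auto)
    then show ?thesis using T0t by (simp add: continuous_within at_within_Icc_at_left)
  qed
  have past: "\<forall>\<^sub>F s in at_left t. 0 < h s y" if y: "a t < y" "y < b t" for y
  proof -
    have "\<forall>\<^sub>F s in at_left t. a s < y" "\<forall>\<^sub>F s in at_left t. y < b s"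
      using ct[OF a] ct[OF b] y order_tendstoD unfolding continuous_within by blast+
    moreover have "\<forall>\<^sub>F s in at_left t. T0 < s" "\<forall>\<^sub>F s in at_left t. s < t"
      using T0t by (auto simp: eventually_at_left_field)
    ultimately show ?thesis by eventually_elim (auto intro: before)
  qed
  have nn: "0 \<le> h t y" if y: "a t < y" "y < b t" for y
  proof -
    have "continuous_on {T0..T1} (\<lambda>s. h s y)"
      by (rule continuous_on_compose2[OF hh, of _ "\<lambda>s. (s, y)", simplified])
         (auto intro!: continuous_intros)
    then have "((\<lambda>s. h s y) \<longlongrightarrow> h t y) (at_left t)"
      using ct unfolding continuous_within by blast
    moreover have "\<forall>\<^sub>F s in at_left t. 0 \<le> h s y"
      using past[OF y] by eventually_elim auto
    ultimately show ?thesis by (rule tendsto_lowerbound) simp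
  qed
  show ?thesis
  proof (rule that[OF T0t tx(2) ax xb])
    show "\<forall>y. a t < y \<and> y < b t \<longrightarrow> 0 \<le> h t y" using nn by blast
    show "h t x = 0" using nn[OF ax xb] tx by simp
    show "\<forall>\<^sub>F s in at_left t. 0 \<le> h s x" using past[OF ax xb] by eventually_elim auto
  qed
qed

lemma no_interior_touching:
  assumes d: "0 < d"
    and w: "has_jet w t x \<alpha> \<beta>" "\<alpha> < d * \<beta> + f (w t x)"
    and u: "has_jet u t x (d * \<gamma> + f (u t x)) \<gamma>"
    and touch: "u t x - w t x = 0"
    and past: "\<forall>\<^sub>F s in at_left t. 0 \<le> u s x - w s x"
    and space: "\<forall>\<^sub>F y in nhds x. 0 \<le> u t y - w t y"
  shows False
proof -
  have "d * \<gamma> + f (u t x) - \<alpha> \<le> 0" "0 \<le> \<gamma> - \<beta>"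
    using has_jet_min[OF has_jet_diff[OF u w(1)] touch past space] .
  moreover have "d * \<beta> \<le> d * \<gamma>" using calculation(2) d by simp
  ultimately show False using w(2) touch by simp
qed

text \<open>The strict inequalities are required only where the barrier and the solution coincide.
Hence \<open>w\<close> may be any continuous function away from such points, and properties of the
solution (positivity, bounds already known) may be used to verify that \<open>w\<close> is a
strict subsolution. At the interface, touching from below orders both one-sided slopes, which is
incompatible with \<open>p < \<sigma> * q\<close>.\<close>

lemma comparison_sub:
  assumes u: "two_patch d1 d2 \<sigma> f1 f2 u" and pos: "0 < d1" "0 < d2" "0 < \<sigma>" and T0: "0 \<le> T0"
    and a: "continuous_on {T0..T1} a" and b: "continuous_on {T0..T1} b"
    and w: "continuous_on ({T0..T1} \<times> UNIV) (\<lambda>(t, x). w t x)"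
    and init: "\<And>x. a T0 \<le> x \<Longrightarrow> x \<le> b T0 \<Longrightarrow> w T0 x < u T0 x"
    and la: "\<And>t. T0 \<le> t \<Longrightarrow> t \<le> T1 \<Longrightarrow> w t (a t) < u t (a t)"
    and lb: "\<And>t. T0 \<le> t \<Longrightarrow> t \<le> T1 \<Longrightarrow> w t (b t) < u t (b t)"
    and sub1: "\<And>t x. T0 < t \<Longrightarrow> t \<le> T1 \<Longrightarrow> a t < x \<Longrightarrow> x < b t \<Longrightarrow> x < 0 \<Longrightarrow> w t x = u t x \<Longrightarrow>
       \<exists>\<alpha> \<beta>. has_jet w t x \<alpha> \<beta> \<and> \<alpha> < d1 * \<beta> + f1 (w t x)"
    and sub2: "\<And>t x. T0 < t \<Longrightarrow> t \<le> T1 \<Longrightarrow> a t < x \<Longrightarrow> x < b t \<Longrightarrow> 0 < x \<Longrightarrow> w t x = u t x \<Longrightarrow>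
       \<exists>\<alpha> \<beta>. has_jet w t x \<alpha> \<beta> \<and> \<alpha> < d2 * \<beta> + f2 (w t x)"
    and kink: "\<And>t. T0 < t \<Longrightarrow> t \<le> T1 \<Longrightarrow> a t < 0 \<Longrightarrow> 0 < b t \<Longrightarrow> w t 0 = u t 0 \<Longrightarrow>
       \<exists>p q. (w t has_real_derivative p) (at_left 0) \<and> (w t has_real_derivative q) (at_right 0) \<and> p < \<sigma> * q"
    and tx: "T0 \<le> t" "t \<le> T1" "a t \<le> x" "x \<le> b t"
  shows "w t x < u t x"
proof (rule ccontr)
  assume "\<not> w t x < u t x"
  then have neg: "u t x - w t x \<le> 0" by simp
  have uc: "continuous_on ({T0..T1} \<times> UNIV) (\<lambda>(t, x). u t x)"
    using u T0 unfolding two_patch_def by (auto elim!: continuous_on_subset)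
  have hc: "continuous_on ({T0..T1} \<times> UNIV) (\<lambda>(t, x). u t x - w t x)"
    using continuous_on_diff[OF uc w] by (simp add: case_prod_unfold)
  obtain s y where s: "T0 < s" "s \<le> T1" "a s < y" "y < b s" "u s y - w s y = 0"
    and nn: "\<forall>z. a s < z \<and> z < b s \<longrightarrow> 0 \<le> u s z - w s z"
    and past: "\<forall>\<^sub>F r in at_left s. 0 \<le> u r y - w r y"
    by (rule first_touching[where h = "\<lambda>t x. u t x - w t x", OF a b hc _ _ _ tx neg])
       (use init la lb in auto)
  have space: "\<forall>\<^sub>F z in nhds y. 0 \<le> u s z - w s z"
  proof -
    have "\<forall>\<^sub>F z in nhds y. z \<in> {a s<..<b s}" using s by (intro eventually_nhds_in_open) auto
    then show ?thesis by eventually_elim (use nn in auto)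
  qed
  have s0: "0 < s" using T0 s by simp
  consider "y < 0" | "y = 0" | "y > 0" by linarith
  then show False
  proof cases
    case 1
    obtain \<alpha> \<beta> where w: "has_jet w s y \<alpha> \<beta>" "\<alpha> < d1 * \<beta> + f1 (w s y)"
      using sub1[of s y] s 1 by auto
    obtain \<gamma> where g: "has_jet u s y (d1 * \<gamma> + f1 (u s y)) \<gamma>"
      using u s0 1 unfolding two_patch_def by blast
    show False by (rule no_interior_touching[OF pos(1) w g s(5) past space])
  next
    case 3
    obtain \<alpha> \<beta> where w: "has_jet w s y \<alpha> \<beta>" "\<alpha> < d2 * \<beta> + f2 (w s y)"
      using sub2[of s y] s 3 by auto
    obtain \<gamma> where g: "has_jet u s y (d2 * \<gamma> + f2 (u s y)) \<gamma>"
      using u s0 3 unfolding two_patch_def by blast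
    show False by (rule no_interior_touching[OF pos(2) w g s(5) past space])
  next
    case 2
    obtain p q where pq: "(w s has_real_derivative p) (at_left 0)" "(w s has_real_derivative q) (at_right 0)" "p < \<sigma> * q"
      using kink[of s] s 2 by auto
    obtain D where D: "(u s has_real_derivative \<sigma> * D) (at_left 0)" "(u s has_real_derivative D) (at_right 0)"
      using u s0 unfolding two_patch_def flux_condition_def by blast
    have ev: "\<forall>\<^sub>F z in at 0 within S. 0 \<le> u s z - w s z" for S
      using space unfolding 2 by (metis (mono_tags, lifting) eventually_at_topological eventually_nhds)
    have "\<sigma> * D - p \<le> 0"
      by (rule DERIV_left_nonpos[OF DERIV_diff[OF D(1) pq(1)] _ ev]) (use s 2 in auto)
    moreover have "0 \<le> D - q"
      by (rule DERIV_right_nonneg[OF DERIV_diff[OF D(2) pq(2)] _ ev]) (use s 2 in auto)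
    moreover have "\<sigma> * q \<le> \<sigma> * D" using calculation(2) pos by simp
    ultimately show False using pq(3) by simp
  qed
qed

lemma comparison_super:
  assumes u: "two_patch d1 d2 \<sigma> f1 f2 u" and pos: "0 < d1" "0 < d2" "0 < \<sigma>" and T0: "0 \<le> T0"
    and a: "continuous_on {T0..T1} a" and b: "continuous_on {T0..T1} b"
    and w: "continuous_on ({T0..T1} \<times> UNIV) (\<lambda>(t, x). w t x)"
    and init: "\<And>x. a T0 \<le> x \<Longrightarrow> x \<le> b T0 \<Longrightarrow> u T0 x < w T0 x"
    and la: "\<And>t. T0 \<le> t \<Longrightarrow> t \<le> T1 \<Longrightarrow> u t (a t) < w t (a t)"
    and lb: "\<And>t. T0 \<le> t \<Longrightarrow> t \<le> T1 \<Longrightarrow> u t (b t) < w t (b t)"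
    and sup1: "\<And>t x. T0 < t \<Longrightarrow> t \<le> T1 \<Longrightarrow> a t < x \<Longrightarrow> x < b t \<Longrightarrow> x < 0 \<Longrightarrow> w t x = u t x \<Longrightarrow>
       \<exists>\<alpha> \<beta>. has_jet w t x \<alpha> \<beta> \<and> d1 * \<beta> + f1 (w t x) < \<alpha>"
    and sup2: "\<And>t x. T0 < t \<Longrightarrow> t \<le> T1 \<Longrightarrow> a t < x \<Longrightarrow> x < b t \<Longrightarrow> 0 < x \<Longrightarrow> w t x = u t x \<Longrightarrow>
       \<exists>\<alpha> \<beta>. has_jet w t x \<alpha> \<beta> \<and> d2 * \<beta> + f2 (w t x) < \<alpha>"
    and kink: "\<And>t. T0 < t \<Longrightarrow> t \<le> T1 \<Longrightarrow> a t < 0 \<Longrightarrow> 0 < b t \<Longrightarrow> w t 0 = u t 0 \<Longrightarrow>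
       \<exists>p q. (w t has_real_derivative p) (at_left 0) \<and> (w t has_real_derivative q) (at_right 0) \<and> \<sigma> * q < p"
    and tx: "T0 \<le> t" "t \<le> T1" "a t \<le> x" "x \<le> b t"
  shows "u t x < w t x"
proof -
  have "0 - w t x < 0 - u t x"
  proof (rule comparison_sub[OF two_patch_reflect_value[OF u, of 0] pos T0 a b, where w = "\<lambda>t x. 0 - w t x"])
    show "continuous_on ({T0..T1} \<times> UNIV) (\<lambda>(t, x). 0 - w t x)"
      using w unfolding case_prod_unfold by (intro continuous_intros)
  next
    fix t x assume "T0 < t" "t \<le> T1" "a t < x" "x < b t" "x < 0" "0 - w t x = 0 - u t x"
    with sup1[of t x] obtain \<alpha> \<beta> where "has_jet w t x \<alpha> \<beta>" "d1 * \<beta> + f1 (w t x) < \<alpha>" by auto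
    with has_jet_reflect_value[of w t x \<alpha> \<beta> 0]
    show "\<exists>\<alpha> \<beta>. has_jet (\<lambda>t x. 0 - w t x) t x \<alpha> \<beta> \<and> \<alpha> < d1 * \<beta> + - f1 (0 - (0 - w t x))"
      by (intro exI[of _ "- \<alpha>"] exI[of _ "- \<beta>"]) auto
  next
    fix t x assume "T0 < t" "t \<le> T1" "a t < x" "x < b t" "0 < x" "0 - w t x = 0 - u t x"
    with sup2[of t x] obtain \<alpha> \<beta> where "has_jet w t x \<alpha> \<beta>" "d2 * \<beta> + f2 (w t x) < \<alpha>" by auto
    with has_jet_reflect_value[of w t x \<alpha> \<beta> 0]
    show "\<exists>\<alpha> \<beta>. has_jet (\<lambda>t x. 0 - w t x) t x \<alpha> \<beta> \<and> \<alpha> < d2 * \<beta> + - f2 (0 - (0 - w t x))"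
      by (intro exI[of _ "- \<alpha>"] exI[of _ "- \<beta>"]) auto
  next
    fix t assume "T0 < t" "t \<le> T1" "a t < 0" "0 < b t" "0 - w t 0 = 0 - u t 0"
    with kink[of t] obtain p q where "(w t has_real_derivative p) (at_left 0)"
      "(w t has_real_derivative q) (at_right 0)" "\<sigma> * q < p" by auto
    then show "\<exists>p q. ((\<lambda>x. 0 - w t x) has_real_derivative p) (at_left 0) \<and>
        ((\<lambda>x. 0 - w t x) has_real_derivative q) (at_right 0) \<and> p < \<sigma> * q"
      by (intro exI[of _ "- p"] exI[of _ "- q"]) (auto intro!: derivative_eq_intros)
  qed (use init la lb tx in auto)
  then show ?thesis by simp
qed

section \<open>Lifting lower bounds near the interface and in boxes\<close>

lemma has_jet_transform:
  assumes "has_jet w' t x a b" "open S" "x \<in> S" "\<And>t y. y \<in> S \<Longrightarrow> w t y = w' t y"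
  shows "has_jet w t x a b"
proof -
  from assms(1) obtain v where a: "((\<lambda>s. w' s x) has_real_derivative a) (at t)" and
    v: "\<forall>\<^sub>F y in nhds x. (w' t has_real_derivative v y) (at y)" "(v has_real_derivative b) (at x)"
    unfolding has_jet_def by blast
  have "\<forall>\<^sub>F y in nhds x. y \<in> S" using assms by (intro eventually_nhds_in_open)
  with v(1) have "\<forall>\<^sub>F y in nhds x. (w t has_real_derivative v y) (at y)"
  proof eventually_elim
    case (elim y)
    show ?case by (rule has_field_derivative_transform_within_open[OF elim(1) assms(2) elim(2)])
      (simp add: assms(4))
  qed
  moreover have "(\<lambda>s. w s x) = (\<lambda>s. w' s x)" using assms by auto
  ultimately show ?thesis unfolding has_jet_def using a v(2) by auto
qed

lemma has_derivative_at_leftI: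
  assumes "(g has_real_derivative D) (at 0)" "\<And>x. x \<le> 0 \<Longrightarrow> f x = g x"
  shows "(f has_real_derivative D) (at_left (0::real))"
  by (rule has_field_derivative_subset[OF has_field_derivative_transform_within
      [OF has_field_derivative_at_within[OF assms(1), of "{..0}"], of 1]])
     (use assms(2) in auto)

lemma has_derivative_at_rightI:
  assumes "(g has_real_derivative D) (at 0)" "\<And>x. x \<ge> 0 \<Longrightarrow> f x = g x"
  shows "(f has_real_derivative D) (at_right (0::real))"
  by (rule has_field_derivative_subset[OF has_field_derivative_transform_within
      [OF has_field_derivative_at_within[OF assms(1), of "{0..}"], of 1]])
     (use assms(2) in auto)

lemma kinked_line_jet:
  assumes "x \<noteq> 0"
  shows "has_jet (\<lambda>t x. g + n * t + m * \<bar>x\<bar>) t x n 0"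
proof (cases "x < 0")
  case True
  show ?thesis
  proof (rule has_jet_transform[where S = "{..<0}" and w' = "\<lambda>t x. g + n * t - m * x"])
    show "has_jet (\<lambda>t x. g + n * t - m * x) t x n 0"
      by (rule has_jetI[where S = UNIV and v = "\<lambda>_. - m"]) (auto intro!: derivative_eq_intros)
  qed (use True in auto)
next
  case False
  show ?thesis
  proof (rule has_jet_transform[where S = "{0<..}" and w' = "\<lambda>t x. g + n * t + m * x"])
    show "has_jet (\<lambda>t x. g + n * t + m * x) t x n 0"
      by (rule has_jetI[where S = UNIV and v = "\<lambda>_. m"]) (auto intro!: derivative_eq_intros)
  qed (use False assms in auto)
qed

lemma kinked_line_slopes:
  "((\<lambda>x. g + m * \<bar>x\<bar>) has_real_derivative - m) (at_left (0::real))"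
  "((\<lambda>x. g + m * \<bar>x\<bar>) has_real_derivative m) (at_right (0::real))"
  by (rule has_derivative_at_leftI[where g = "\<lambda>x. g - m * x"]; auto intro!: derivative_eq_intros)
     (rule has_derivative_at_rightI[where g = "\<lambda>x. g + m * x"]; auto intro!: derivative_eq_intros)

text \<open>A kink \<open>m * \<bar>x\<bar>\<close>, however small, makes a function of time alone a
strict subsolution at the interface for every \<open>\<sigma>\<close>, and it costs nothing in the
equations, since its second derivative vanishes.\<close>

lemma kinked_line_comparison:
  assumes u: "two_patch d1 d2 \<sigma> f1 f2 u" and pos: "0 < d1" "0 < d2" "0 < \<sigma>" and T0: "0 \<le> T0"
    and m: "0 < m"
    and init: "\<And>x. a \<le> x \<Longrightarrow> x \<le> b \<Longrightarrow> g + n * T0 + m * \<bar>x\<bar> < u T0 x"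
    and la: "\<And>t. T0 \<le> t \<Longrightarrow> t \<le> T1 \<Longrightarrow> g + n * t + m * \<bar>a\<bar> < u t a"
    and lb: "\<And>t. T0 \<le> t \<Longrightarrow> t \<le> T1 \<Longrightarrow> g + n * t + m * \<bar>b\<bar> < u t b"
    and f: "\<And>t x. T0 < t \<Longrightarrow> t \<le> T1 \<Longrightarrow> a < x \<Longrightarrow> x < b \<Longrightarrow> u t x = g + n * t + m * \<bar>x\<bar> \<Longrightarrow>
       n < f1 (u t x) \<and> n < f2 (u t x)"
    and tx: "T0 \<le> t" "t \<le> T1" "a \<le> x" "x \<le> b"
  shows "g + n * t + m * \<bar>x\<bar> < u t x"
proof (rule comparison_sub[OF u pos T0, where a = "\<lambda>_. a" and b = "\<lambda>_. b" and w = "\<lambda>t x. g + n * t + m * \<bar>x\<bar>"])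
  fix t x assume "T0 < t" "t \<le> T1" "a < x" "x < b" "x < 0" "g + n * t + m * \<bar>x\<bar> = u t x"
  then show "\<exists>\<alpha> \<beta>. has_jet (\<lambda>t x. g + n * t + m * \<bar>x\<bar>) t x \<alpha> \<beta> \<and> \<alpha> < d1 * \<beta> + f1 (g + n * t + m * \<bar>x\<bar>)"
    using f[of t x] by (intro exI[of _ n] exI[of _ 0] conjI kinked_line_jet) auto
next
  fix t x assume "T0 < t" "t \<le> T1" "a < x" "x < b" "0 < x" "g + n * t + m * \<bar>x\<bar> = u t x"
  then show "\<exists>\<alpha> \<beta>. has_jet (\<lambda>t x. g + n * t + m * \<bar>x\<bar>) t x \<alpha> \<beta> \<and> \<alpha> < d2 * \<beta> + f2 (g + n * t + m * \<bar>x\<bar>)"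
    using f[of t x] by (intro exI[of _ n] exI[of _ 0] conjI kinked_line_jet) auto
next
  fix t
  have "- m < \<sigma> * m" using m pos by (meson less_trans mult_pos_pos neg_less_0_iff_less)
  then show "\<exists>p q. ((\<lambda>x. g + n * t + m * \<bar>x\<bar>) has_real_derivative p) (at_left 0) \<and>
      ((\<lambda>x. g + n * t + m * \<bar>x\<bar>) has_real_derivative q) (at_right 0) \<and> p < \<sigma> * q"
    using kinked_line_slopes by blast
qed (use init la lb tx in \<open>auto intro!: continuous_intros simp: case_prod_unfold\<close>)

text \<open>The bound \<open>k0\<close> inside the strip is raised to the bound \<open>k\<close> on
its sides: the reaction is at least \<open>\<mu>\<close> on the values that occur, so a kinked
line may rise at speed \<open>\<mu> / 2\<close>. The comparison is started anew before each time
\<open>t\<close>, so that the conclusion holds for all large times.\<close>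

lemma interface_lift:
  assumes u: "two_patch d1 d2 \<sigma> f1 f2 u" and pos: "0 < d1" "0 < d2" "0 < \<sigma>" and T: "0 \<le> T"
    and R: "0 < R" and k: "k0 \<le> k" and mu: "0 < \<mu>"
    and f: "\<And>s. k0 \<le> s \<Longrightarrow> s \<le> k \<Longrightarrow> \<mu> \<le> f1 s \<and> \<mu> \<le> f2 s"
    and low: "\<And>t x. T \<le> t \<Longrightarrow> \<bar>x\<bar> \<le> R \<Longrightarrow> k0 \<le> u t x"
    and lat: "\<And>t. T \<le> t \<Longrightarrow> k < u t (- R) \<and> k < u t R"
    and eta: "0 < \<eta>"
  shows "\<exists>T'\<ge>T. \<forall>t\<ge>T'. \<forall>x. \<bar>x\<bar> \<le> R \<longrightarrow> k - \<eta> < u t x"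
proof (intro exI conjI allI impI)
  define L where "L = (k - k0) / (\<mu> / 2)"
  have L: "0 \<le> L" "\<mu> / 2 * L = k - k0" using k mu by (auto simp: L_def)
  show "T \<le> T + L" using L by simp
  fix t x assume t: "T + L \<le> t" and x: "\<bar>x\<bar> \<le> R"
  define g where "g = k0 - \<eta> - \<mu> / 2 * (t - L)"
  have s: "0 \<le> \<eta> / (2 * R) * \<bar>y\<bar> \<and> \<eta> / (2 * R) * \<bar>y\<bar> \<le> \<eta> / 2" if "\<bar>y\<bar> \<le> R" for y
  proof -
    have "\<eta> / (2 * R) * \<bar>y\<bar> \<le> \<eta> / (2 * R) * R"
      by (rule mult_left_mono) (use that R eta in auto)
    then show ?thesis using R eta by simp
  qed
  have tm: "\<mu> / 2 * r \<le> \<mu> / 2 * (t - L) + (k - k0)" if "r \<le> t" for r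
  proof -
    have "\<mu> / 2 * r \<le> \<mu> / 2 * t" using that mu by simp
    moreover have "\<mu> / 2 * (t - L) = \<mu> / 2 * t - \<mu> / 2 * L" by (rule right_diff_distrib)
    ultimately show ?thesis using L(2) by linarith
  qed
  have "g + \<mu> / 2 * t + \<eta> / (2 * R) * \<bar>x\<bar> < u t x"
  proof (rule kinked_line_comparison[OF u pos _ _, where ?T0.0 = "t - L" and ?T1.0 = t and a = "- R" and b = R])
    fix y assume "- R \<le> y" "y \<le> R"
    then have yR: "\<bar>y\<bar> \<le> R" by auto
    have "g + \<mu> / 2 * (t - L) = k0 - \<eta>" by (simp add: g_def)
    then show "g + \<mu> / 2 * (t - L) + \<eta> / (2 * R) * \<bar>y\<bar> < u (t - L) y"
      using s[OF yR] low[OF _ yR, of "t - L"] t eta by linarith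
  next
    fix r assume "t - L \<le> r" "r \<le> t"
    then show "g + \<mu> / 2 * r + \<eta> / (2 * R) * \<bar>- R\<bar> < u r (- R)"
      using s[of R] lat[of r] t eta tm[of r] R by (auto simp: g_def)
  next
    fix r assume "t - L \<le> r" "r \<le> t"
    then show "g + \<mu> / 2 * r + \<eta> / (2 * R) * \<bar>R\<bar> < u r R"
      using s[of R] lat[of r] t eta tm[of r] R by (auto simp: g_def)
  next
    fix r y assume a: "t - L < r" "r \<le> t" "- R < y" "y < R" "u r y = g + \<mu> / 2 * r + \<eta> / (2 * R) * \<bar>y\<bar>"
    then have "k0 \<le> u r y" using low[of r y] t by auto
    moreover have "\<bar>y\<bar> \<le> R" using a by auto
    then have "u r y \<le> k" using s[of y] tm[of r] a eta unfolding g_def by linarith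
    ultimately show "\<mu> / 2 < f1 (u r y) \<and> \<mu> / 2 < f2 (u r y)" using f[of "u r y"] mu by auto
  qed (use t T L R eta x in auto)
  moreover have "g + \<mu> / 2 * t = k - \<eta>"
    using L(2) right_diff_distrib[of "\<mu> / 2" t L] unfolding g_def by linarith
  ultimately show "k - \<eta> < u t x" using s[OF x] by auto
qed

text \<open>A time independent kinked line with values in a range where both reactions are positive
is a barrier for ever. Hence a lower bound that holds in the strip at time \<open>T\<close>, and
on its sides from then on, persists inside.\<close>

lemma interface_floor:
  assumes u: "two_patch d1 d2 \<sigma> f1 f2 u" and pos: "0 < d1" "0 < d2" "0 < \<sigma>" and T: "0 \<le> T"
    and ab: "a < 0" "0 < b" and m: "0 < m"
    and f: "\<And>s. m / 2 \<le> s \<Longrightarrow> s \<le> m \<Longrightarrow> 0 < f1 s \<and> 0 < f2 s"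
    and init: "\<And>x. a \<le> x \<Longrightarrow> x \<le> b \<Longrightarrow> m < u T x"
    and lat: "\<And>t. T \<le> t \<Longrightarrow> m < u t a \<and> m < u t b"
    and tx: "T \<le> t" "a \<le> x" "x \<le> b"
  shows "m / 2 < u t x"
proof -
  define s where "s = m / (2 * (b - a))"
  have s0: "s > 0" using ab m by (simp add: s_def)
  have s: "0 \<le> s * \<bar>y\<bar> \<and> s * \<bar>y\<bar> \<le> m / 2" if "a \<le> y" "y \<le> b" for y
  proof -
    have "s * \<bar>y\<bar> \<le> s * (b - a)" by (rule mult_left_mono) (use that ab s0 in auto)
    also have "s * (b - a) = m / 2" using ab by (simp add: s_def field_simps)
    finally show ?thesis using s0 by simp
  qed
  have "m / 2 + 0 * t + s * \<bar>x\<bar> < u t x"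
  proof (rule kinked_line_comparison[OF u pos T s0, where ?T1.0 = t and a = a and b = b])
    fix r y assume a: "T < r" "r \<le> t" "a < y" "y < b" "u r y = m / 2 + 0 * r + s * \<bar>y\<bar>"
    then show "0 < f1 (u r y) \<and> 0 < f2 (u r y)"
      by (intro f) (use s[of y] in auto)
  next
    fix y assume "a \<le> y" "y \<le> b"
    then show "m / 2 + 0 * T + s * \<bar>y\<bar> < u T y" using s[of y] init[of y] by auto
  next
    fix r assume "T \<le> r" "r \<le> t"
    then show "m / 2 + 0 * r + s * \<bar>a\<bar> < u r a" using s[of a] ab lat[of r] by auto
  next
    fix r assume "T \<le> r" "r \<le> t"
    then show "m / 2 + 0 * r + s * \<bar>b\<bar> < u r b" using s[of b] ab lat[of r] by auto
  qed (use tx in auto)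
  then show ?thesis using s[of x] tx by auto
qed

text \<open>The barrier is a concave parabola whose vertex rises at speed \<open>\<mu> / 3\<close>.
In a wide box the curvature costs only another \<open>\<mu> / 3\<close>, while the parabola falls
below \<open>k0\<close> on the sides. The size of the box and the waiting time do not depend on
the position of the box, which is what makes the far field bounds uniform.\<close>

lemma box_lift:
  assumes u: "two_patch d1 d2 \<sigma> f1 f2 u" and pos: "0 < d1" "0 < d2" "0 < \<sigma>"
    and k: "k0 \<le> k" and mu: "0 < \<mu>"
    and f: "\<And>s. k0 \<le> s \<Longrightarrow> s \<le> k \<Longrightarrow> \<mu> \<le> f1 s"
  shows "\<exists>R>0. \<exists>L\<ge>0. \<forall>T\<ge>0. \<forall>x0\<le>-R.
    (\<forall>t x. T \<le> t \<and> t \<le> T + L \<and> \<bar>x - x0\<bar> \<le> R \<longrightarrow> k0 \<le> u t x) \<longrightarrow> k \<le> u (T + L) x0"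
proof -
  define C where "C = k - k0"
  define R where "R = sqrt (6 * d1 * (C + 1) / \<mu>)"
  define L where "L = C / (\<mu> / 3)"
  have C: "0 \<le> C" using k by (simp add: C_def)
  have R: "0 < R" "R\<^sup>2 = 6 * d1 * (C + 1) / \<mu>" using C pos mu by (auto simp: R_def)
  have L: "0 \<le> L" "\<mu> / 3 * L = C" using C mu by (auto simp: L_def)
  define q where "q = C / R\<^sup>2"
  have curv: "d1 * (2 * q) \<le> \<mu> / 3"
  proof -
    have "d1 * (2 * q) = \<mu> / 3 * (C / (C + 1))" unfolding q_def R(2) using pos mu C by (simp add: divide_simps)
    also have "\<dots> \<le> \<mu> / 3 * 1" by (rule mult_left_mono) (use C mu in auto)
    finally show ?thesis by simp
  qed
  have "k \<le> u (T + L) x0" if T: "0 \<le> T" and x0: "x0 \<le> - R"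
    and low: "\<And>t x. T \<le> t \<Longrightarrow> t \<le> T + L \<Longrightarrow> \<bar>x - x0\<bar> \<le> R \<Longrightarrow> k0 \<le> u t x" for T x0
  proof (rule field_le_epsilon)
    fix \<eta> :: real assume eta: "0 < \<eta>"
    define w where "w = (\<lambda>t x. k0 - \<eta> + \<mu> / 3 * (t - T) - q * (x - x0)\<^sup>2)"
    have tm: "\<mu> / 3 * (t - T) \<le> C" if "t \<le> T + L" for t
    proof -
      have "\<mu> / 3 * (t - T) \<le> \<mu> / 3 * L" using that mu by simp
      then show ?thesis using L(2) by simp
    qed
    have q: "0 \<le> q * (x - x0)\<^sup>2" for x using C by (simp add: q_def)
    have qR: "q * R\<^sup>2 = C" using R(1) by (simp add: q_def)
    have jet: "has_jet w t x (\<mu> / 3) (- (2 * q))" for t x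
      unfolding w_def
      by (rule has_jetI[where S = UNIV and v = "\<lambda>x. - (q * (2 * (x - x0)))"])
         (auto intro!: derivative_eq_intros)
    have "w (T + L) x0 < u (T + L) x0"
    proof (rule comparison_sub[OF u pos T, where a = "\<lambda>_. x0 - R" and b = "\<lambda>_. x0 + R" and w = w])
      fix t x assume a: "T < t" "t \<le> T + L" "x0 - R < x" "x < x0 + R" "w t x = u t x"
      then have "k0 \<le> w t x" using low[of t x] by auto
      moreover have "w t x \<le> k" using tm[of t] q[of x] a eta by (auto simp: w_def C_def)
      ultimately have "\<mu> \<le> f1 (w t x)" by (rule f)
      then show "\<exists>\<alpha> \<beta>. has_jet w t x \<alpha> \<beta> \<and> \<alpha> < d1 * \<beta> + f1 (w t x)"
        using jet[of t x] curv mu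
        by (intro exI[of _ "\<mu> / 3"] exI[of _ "- (2 * q)"]) auto
    next
      fix x assume "x0 - R \<le> x" "x \<le> x0 + R"
      then have "\<bar>x - x0\<bar> \<le> R" by auto
      then show "w T x < u T x" using low[of T x] L q[of x] eta by (auto simp: w_def)
    next
      fix t assume "T \<le> t" "t \<le> T + L"
      then show "w t (x0 - R) < u t (x0 - R)" using low[of t "x0 - R"] tm[of t] R(1) qR eta by (auto simp: w_def)
    next
      fix t assume "T \<le> t" "t \<le> T + L"
      then show "w t (x0 + R) < u t (x0 + R)" using low[of t "x0 + R"] tm[of t] R(1) qR eta by (auto simp: w_def)
    next
      show "continuous_on ({T..T + L} \<times> UNIV) (\<lambda>(t, x). w t x)"
        unfolding w_def case_prod_unfold by (intro continuous_intros)
    qed (use x0 R L in auto)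
    moreover have "w (T + L) x0 = k0 - \<eta> + \<mu> / 3 * L" by (simp add: w_def)
    moreover note L(2) C_def
    ultimately show "k \<le> u (T + L) x0 + \<eta>" by linarith
  qed
  note main = this
  show ?thesis
  proof (rule exI[of _ R], rule conjI[OF R(1)], rule exI[of _ L], rule conjI[OF L(1)], intro allI impI)
    fix T x0 assume "0 \<le> T" "x0 \<le> - R"
      "\<forall>t x. T \<le> t \<and> t \<le> T + L \<and> \<bar>x - x0\<bar> \<le> R \<longrightarrow> k0 \<le> u t x"
    then show "k \<le> u (T + L) x0" by (intro main) auto
  qed
qed

section \<open>Instantaneous positivity\<close>

lemma gaussian_space_derivative:
  fixes \<kappa> b j x0 s \<theta> y :: real
  shows "((\<lambda>x. \<kappa> * (exp (b - (j * x - x0)\<^sup>2 / s) - \<theta>)) has_real_derivative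
    - \<kappa> * exp (b - (j * y - x0)\<^sup>2 / s) * (2 * j * (j * y - x0) / s)) (at y)"
  unfolding divide_inverse by (auto intro!: derivative_eq_intros simp: algebra_simps)

lemma gaussian_jet:
  fixes s0 D N c j x0 \<kappa> \<theta> t x :: real
  assumes s: "0 < s0" "0 < D" "0 \<le> t"
  defines "E \<equiv> \<lambda>t z. exp (- N * ln ((s0 + 4 * D * t) / s0) - c * t - z\<^sup>2 / (s0 + 4 * D * t))"
  shows "has_jet (\<lambda>t x. \<kappa> * (E t (j * x - x0) - \<theta>)) t x
    (\<kappa> * E t (j * x - x0) * (4 * D * (j * x - x0)\<^sup>2 / (s0 + 4 * D * t)\<^sup>2 - N * (4 * D) / (s0 + 4 * D * t) - c))
    (\<kappa> * E t (j * x - x0) * (4 * j\<^sup>2 * (j * x - x0)\<^sup>2 / (s0 + 4 * D * t)\<^sup>2 - 2 * j\<^sup>2 / (s0 + 4 * D * t)))"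
proof (rule has_jetI[where S = UNIV and v = "\<lambda>x. - \<kappa> * E t (j * x - x0) * (2 * j * (j * x - x0) / (s0 + 4 * D * t))"])
  have p: "0 < s0 + 4 * D * t" using s by (simp add: add_pos_nonneg)
  have "((\<lambda>t. ln ((s0 + 4 * D * t) / s0)) has_real_derivative (4 * D / s0) / ((s0 + 4 * D * t) / s0)) (at t)"
    using p s by (auto intro!: derivative_eq_intros)
  moreover have "(4 * D / s0) / ((s0 + 4 * D * t) / s0) = 4 * D / (s0 + 4 * D * t)" using p s by simp
  ultimately have L: "((\<lambda>t. ln ((s0 + 4 * D * t) / s0)) has_real_derivative 4 * D / (s0 + 4 * D * t)) (at t)"
    by (simp only:)
  have Q: "((\<lambda>t. z / (s0 + 4 * D * t)) has_real_derivative - (4 * D * z / (s0 + 4 * D * t)\<^sup>2)) (at t)" for z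
    using p by (auto intro!: derivative_eq_intros simp: power2_eq_square)
  have "((\<lambda>t. - N * ln ((s0 + 4 * D * t) / s0) - c * t - z / (s0 + 4 * D * t)) has_real_derivative
      - N * (4 * D / (s0 + 4 * D * t)) - c * 1 - (- (4 * D * z / (s0 + 4 * D * t)\<^sup>2))) (at t)" for z
    by (intro DERIV_diff DERIV_cmult L Q DERIV_ident)
  from DERIV_cmult[OF DERIV_diff[OF DERIV_fun_exp[OF this] DERIV_const[of \<theta>]], of \<kappa> "(j * x - x0)\<^sup>2"]
  show "((\<lambda>t. \<kappa> * (E t (j * x - x0) - \<theta>)) has_real_derivative
      (\<kappa> * E t (j * x - x0) * (4 * D * (j * x - x0)\<^sup>2 / (s0 + 4 * D * t)\<^sup>2 - N * (4 * D) / (s0 + 4 * D * t) - c))) (at t)"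
    unfolding E_def by (simp add: algebra_simps)
next
  define r where "r = inverse (s0 + 4 * D * t)"
  define b where "b = - N * ln ((s0 + 4 * D * t) / s0) - c * t"
  have E: "E t z = exp (b - z\<^sup>2 * r)" for z by (simp add: E_def b_def r_def divide_inverse)
  show "((\<lambda>x. \<kappa> * (E t (j * x - x0) - \<theta>)) has_real_derivative
      - \<kappa> * E t (j * y - x0) * (2 * j * (j * y - x0) / (s0 + 4 * D * t))) (at y)" for y
    unfolding E_def by (rule gaussian_space_derivative)
  have "((\<lambda>x. - \<kappa> * E t (j * x - x0) * (2 * j * (j * x - x0) / (s0 + 4 * D * t))) has_real_derivative
     \<kappa> * E t (j * x - x0) * (4 * j\<^sup>2 * (j * x - x0)\<^sup>2 * r\<^sup>2 - 2 * j\<^sup>2 * r)) (at x)"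
    unfolding E divide_inverse r_def[symmetric]
    by (auto intro!: derivative_eq_intros) (simp add: algebra_simps power2_eq_square)
  then show "((\<lambda>x. - \<kappa> * E t (j * x - x0) * (2 * j * (j * x - x0) / (s0 + 4 * D * t))) has_real_derivative
     \<kappa> * E t (j * x - x0) * (4 * j\<^sup>2 * (j * x - x0)\<^sup>2 / (s0 + 4 * D * t)\<^sup>2 - 2 * j\<^sup>2 / (s0 + 4 * D * t))) (at x)"
    by (simp add: r_def divide_inverse power_inverse)
qed auto

text \<open>Shrinking the initial width \<open>s\<close> of the Gaussian costs a power of
\<open>s\<close> in height at the final time, but makes its initial tail exponentially small in
\<open>1 / s\<close>.\<close>

lemma ex_gaussian_width:
  fixes a N B \<rho> :: real
  assumes "0 < a" "0 < \<rho>" "0 \<le> N"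
  shows "\<exists>s>0. N * ln ((s + a) / s) + B < \<rho> / s"
proof -
  define e where "e = \<rho> / (2 * a * (N + 1))"
  have e: "0 < e" using assms by (simp add: e_def)
  have "\<forall>\<^sub>F z in at_top. ln z / z < e"
    using ln_x_over_x_tendsto_0 e by (rule order_tendstoD)
  then obtain z0 :: real where z0: "\<And>z. z \<ge> z0 \<Longrightarrow> ln z / z < e" unfolding eventually_at_top_linorder by blast
  define z where "z = \<bar>z0\<bar> + \<bar>B\<bar> * 2 * a / \<rho> + 3"
  have z3: "3 + \<bar>B\<bar> * 2 * a / \<rho> \<le> z" by (simp add: z_def)
  moreover have "0 \<le> \<bar>B\<bar> * 2 * a / \<rho>" using assms by simp
  ultimately have z: "z > 2" "z \<ge> z0" by (auto simp: z_def)
  define s where "s = a / (z - 1)"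
  have s: "s > 0" using z assms by (simp add: s_def)
  have sz: "(s + a) / s = z" using z assms by (simp add: s_def field_simps)
  have rs: "\<rho> / s = \<rho> / a * (z - 1)" by (simp add: s_def)
  have "N * ln z \<le> N * (e * z)"
    using z0[OF z(2)] z assms by (intro mult_left_mono) (auto simp: field_simps)
  also have "\<dots> \<le> \<rho> / (2 * a) * z"
  proof -
    have "N * e \<le> (N + 1) * e" using e by simp
    also have "\<dots> = \<rho> / (2 * a)" using assms by (simp add: e_def divide_simps)
    finally have "N * e * z \<le> \<rho> / (2 * a) * z" using z by (intro mult_right_mono) auto
    then show ?thesis by (simp add: mult.assoc)
  qed
  finally have 1: "N * ln z \<le> \<rho> / (2 * a) * z" .
  have "\<bar>B\<bar> = \<rho> / (2 * a) * (\<bar>B\<bar> * 2 * a / \<rho>)" using assms by simp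
  also have "\<dots> \<le> \<rho> / (2 * a) * (z - 3)" by (rule mult_left_mono) (use z3 assms in auto)
  finally have 2: "B \<le> \<rho> / (2 * a) * (z - 3)" by linarith
  define q where "q = \<rho> / (2 * a)"
  have "q > 0" using assms by (simp add: q_def)
  then have "N * ln z + B < q * z + q * (z - 2)"
    using 1 2 unfolding q_def[symmetric] by (simp add: algebra_simps)
  then have "N * ln z + B < \<rho> / (2 * a) * z + \<rho> / (2 * a) * (z - 2)" unfolding q_def .
  also have "\<dots> = \<rho> / s" unfolding rs using assms by (simp add: field_simps)
  finally show ?thesis using s sz by auto
qed

text \<open>Strong maximum principle across the interface. The barrier is a spreading Gaussian,
centred in the left patch, minus a constant that makes it negative where the initial datum might
vanish. To the right of the interface space is stretched by a factor \<open>k < 1 /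
\<sigma>\<close>; as the Gaussian decreases at the interface, this makes the flux inequality
strict. The variance grows at the smaller of the two effective diffusion rates, which suffices far
from the centre; the loss near the centre is paid for by the power \<open>N\<close> of the
variance in the height.\<close>

lemma positivity_from_left:
  assumes u: "two_patch d1 d2 \<sigma> f1 f2 u" and pos: "0 < d1" "0 < d2" "0 < \<sigma>"
    and bnd: "\<And>t x. 0 \<le> t \<Longrightarrow> 0 \<le> u t x \<and> u t x \<le> M"
    and C: "0 \<le> C" and f: "\<And>s. 0 \<le> s \<Longrightarrow> s \<le> M \<Longrightarrow> - C * s \<le> f1 s \<and> - C * s \<le> f2 s"
    and x0: "x0 < 0" "0 < u 0 x0" and tau: "0 < \<tau>"
  shows "0 < u \<tau> y"
proof -
  \<comment> \<open>stretching of the right half-line; a positive number below 1 over sigma\<close>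
  define k where "k = 1 / (2 * \<sigma>)"
  have k: "0 < k" "\<sigma> * k < 1" using pos by (auto simp: k_def)
  define D where "D = min d1 (d2 * k\<^sup>2)"
  have D: "0 < D" "D \<le> d1" "D \<le> d2 * k\<^sup>2" using pos k by (auto simp: D_def)
  \<comment> \<open>power of the variance that absorbs the largest effective diffusion rate\<close>
  define N where "N = max d1 (d2 * k\<^sup>2) / (2 * D)"
  have N: "0 \<le> N" "d1 \<le> 2 * D * N" "d2 * k\<^sup>2 \<le> 2 * D * N" using D pos by (auto simp: N_def)
  define X where "X = (\<lambda>x. if x \<le> 0 then x - x0 else k * x - x0)"
  have "isCont (u 0) x0"
    using continuous_on_time_slice[OF u, of 0 UNIV] by (simp add: continuous_on_eq_continuous_at)
  then have "\<forall>\<^sub>F x in at x0. u 0 x0 / 2 < u 0 x"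
    unfolding isCont_def by (rule order_tendstoD) (use x0 in simp)
  then obtain \<rho>' where r': "0 < \<rho>'" "\<And>x. x \<noteq> x0 \<Longrightarrow> \<bar>x - x0\<bar> < \<rho>' \<Longrightarrow> u 0 x0 / 2 < u 0 x"
    unfolding eventually_at by (auto simp: dist_real_def)
  \<comment> \<open>the interval on which the datum is bounded below has to lie in the left patch\<close>
  define \<rho> where "\<rho> = min \<rho>' (- x0)"
  define \<kappa> where "\<kappa> = u 0 x0 / 2"
  have kp: "0 < \<kappa>" using x0 by (simp add: \<kappa>_def)
  have r: "0 < \<rho>" "\<rho> \<le> - x0" using r' x0 by (auto simp: \<rho>_def)
  have near: "\<kappa> \<le> u 0 x" if "\<bar>X x\<bar> < \<rho>" for x
  proof -
    have "x \<le> 0"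
    proof (rule ccontr)
      assume "\<not> x \<le> 0"
      then have "X x = k * x - x0" "0 < k * x" using k by (auto simp: X_def)
      then show False using that r x0 by auto
    qed
    then show ?thesis using that r'(2)[of x] x0 by (cases "x = x0") (auto simp: X_def \<rho>_def \<kappa>_def)
  qed
  define Y where "Y = (C + 1) * \<tau> + (X y)\<^sup>2 / (4 * D * \<tau>) + ln 2"
  obtain s0 where s0: "0 < s0" "N * ln ((s0 + 4 * D * \<tau>) / s0) + Y < \<rho>\<^sup>2 / s0"
    using ex_gaussian_width[of "4 * D * \<tau>" "\<rho>\<^sup>2" N Y] D tau r N by auto
  define \<theta> where "\<theta> = 2 * exp (- \<rho>\<^sup>2 / s0)"
  have th: "0 < \<theta>" by (simp add: \<theta>_def)
  define E where "E = (\<lambda>t z. exp (- N * ln ((s0 + 4 * D * t) / s0) - (C + 1) * t - z\<^sup>2 / (s0 + 4 * D * t)))"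
  define w where "w = (\<lambda>t x. \<kappa> * (E t (X x) - \<theta>))"
  have sp: "0 < s0 + 4 * D * t" if "0 \<le> t" for t using that s0 D by (simp add: add_pos_nonneg)
  \<comment> \<open>beyond this distance the Gaussian stays below the subtracted constant up to the
    final time\<close>
  define B1 where "B1 = sqrt ((s0 + 4 * D * \<tau>) / \<theta>)"
  have B1: "0 < B1" "B1\<^sup>2 / (s0 + 4 * D * \<tau>) = 1 / \<theta>" using sp[of \<tau>] tau th by (auto simp: B1_def)
  have Elow: "E t z < \<theta>" if "0 \<le> t" "t \<le> \<tau>" "B1 \<le> \<bar>z\<bar>" for t z
  proof -
    have "ln ((s0 + 4 * D * t) / s0) \<ge> 0" using s0 D that by simp
    then have "0 \<le> N * ln ((s0 + 4 * D * t) / s0)" using N by simp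
    moreover have "0 \<le> (C + 1) * t" using C that by simp
    moreover have "B1\<^sup>2 / (s0 + 4 * D * \<tau>) \<le> z\<^sup>2 / (s0 + 4 * D * t)"
    proof (rule frac_le)
      show "B1\<^sup>2 \<le> z\<^sup>2" using that(3) B1 by (simp add: abs_le_square_iff[symmetric])
    qed (use that D sp[of t] in auto)
    ultimately have "E t z \<le> exp (- (1 / \<theta>))" unfolding E_def B1(2) by simp
    also have "exp (- (1 / \<theta>)) < \<theta>"
    proof -
      have "1 / \<theta> < exp (1 / \<theta>)" using exp_ge_add_one_self[of "1 / \<theta>"] by linarith
      then show ?thesis using th by (simp add: exp_minus field_simps)
    qed
    finally show ?thesis .
  qed
  have Xc: "continuous_on UNIV X"
  proof -
    have "X = (\<lambda>x. min x 0 + k * max x 0 - x0)" by (auto simp: X_def)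
    then show ?thesis by (auto intro!: continuous_intros)
  qed
  define A where "A = B1 - x0 + B1 / k + \<bar>y\<bar>"
  have "0 < B1 / k" using B1 k by simp
  then have A: "0 < A" "\<bar>y\<bar> \<le> A" "B1 - x0 \<le> A" "B1 / k \<le> A"
    using B1(1) x0 unfolding A_def by linarith+
  \<comment> \<open>both lateral boundaries lie beyond that distance, measured in the stretched
    variable\<close>
  have XA: "B1 \<le> \<bar>X (- A)\<bar>" "B1 \<le> \<bar>X A\<bar>"
  proof -
    show "B1 \<le> \<bar>X (- A)\<bar>" using A by (auto simp: X_def)
    have "B1 \<le> k * A" using A(4) k by (simp add: field_simps)
    then show "B1 \<le> \<bar>X A\<bar>" using A x0 by (auto simp: X_def)
  qed
  have Ep: "0 < E t z" for t z by (simp add: E_def)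
  have key: "\<alpha> < d * \<beta> + f (w t x)"
    if t: "0 < t" and touch: "w t x = u t x" and fs: "\<And>s. 0 \<le> s \<Longrightarrow> s \<le> M \<Longrightarrow> - C * s \<le> f s"
      and Xj: "X x = j * x - x0" and dj: "D \<le> d * j\<^sup>2" "d * j\<^sup>2 \<le> 2 * D * N"
      and al: "\<alpha> = \<kappa> * E t (j * x - x0) * (4 * D * (j * x - x0)\<^sup>2 / (s0 + 4 * D * t)\<^sup>2 - N * (4 * D) / (s0 + 4 * D * t) - (C + 1))"
      and be: "\<beta> = \<kappa> * E t (j * x - x0) * (4 * j\<^sup>2 * (j * x - x0)\<^sup>2 / (s0 + 4 * D * t)\<^sup>2 - 2 * j\<^sup>2 / (s0 + 4 * D * t))"
    for t x d f j \<alpha> \<beta>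
  proof -
    define s where "s = s0 + 4 * D * t"
    have s: "0 < s" using sp[of t] t by (simp add: s_def)
    define Q where "Q = (j * x - x0)\<^sup>2 / s\<^sup>2"
    have Q: "0 \<le> Q" by (simp add: Q_def)
    define E1 where "E1 = \<kappa> * E t (j * x - x0)"
    have E1: "0 < E1" using kp Ep by (simp add: E1_def)
    have "- C * w t x \<le> f (w t x)" by (rule fs) (use touch bnd[of t x] t in auto)
    moreover have "w t x \<le> E1" unfolding w_def Xj E1_def using kp th by (simp add: algebra_simps)
    then have "- C * E1 \<le> - C * w t x" using C by (simp add: mult_left_mono)
    ultimately have 1: "- C * E1 \<le> f (w t x)" by linarith
    have "4 * D * Q \<le> 4 * (d * j\<^sup>2) * Q" using dj Q by (intro mult_right_mono) auto
    moreover have "2 * (d * j\<^sup>2) / s \<le> N * (4 * D) / s" using dj s by (intro divide_right_mono) auto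
    ultimately have "4 * D * Q - N * (4 * D) / s - (C + 1) < (4 * (d * j\<^sup>2) * Q - 2 * (d * j\<^sup>2) / s) - C"
      by linarith
    then have "E1 * (4 * D * Q - N * (4 * D) / s - (C + 1)) < E1 * ((4 * (d * j\<^sup>2) * Q - 2 * (d * j\<^sup>2) / s) - C)"
      using E1 by simp
    also have "\<dots> = d * (E1 * (4 * j\<^sup>2 * Q - 2 * j\<^sup>2 / s)) + - C * E1"
      by (simp add: algebra_simps)
    also have "\<dots> \<le> d * (E1 * (4 * j\<^sup>2 * Q - 2 * j\<^sup>2 / s)) + f (w t x)" using 1 by simp
    finally show ?thesis unfolding al be Q_def E1_def s_def by (simp only: times_divide_eq_right)
  qed
  have jet: "has_jet (\<lambda>t x. \<kappa> * (E t (j * x - x0) - \<theta>)) t x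
    (\<kappa> * E t (j * x - x0) * (4 * D * (j * x - x0)\<^sup>2 / (s0 + 4 * D * t)\<^sup>2 - N * (4 * D) / (s0 + 4 * D * t) - (C + 1)))
    (\<kappa> * E t (j * x - x0) * (4 * j\<^sup>2 * (j * x - x0)\<^sup>2 / (s0 + 4 * D * t)\<^sup>2 - 2 * j\<^sup>2 / (s0 + 4 * D * t)))"
    if "0 < t" for t x j
    unfolding E_def by (rule gaussian_jet) (use s0 D that in auto)
  have "w \<tau> y < u \<tau> y"
  proof (rule comparison_sub[OF u pos, where ?T0.0 = 0 and ?T1.0 = \<tau> and a = "\<lambda>_. - A" and b = "\<lambda>_. A" and w = w])
    show "continuous_on ({0..\<tau>} \<times> UNIV) (\<lambda>(t, x). w t x)"
    proof -
      have "continuous_on ({0..\<tau>} \<times> UNIV) (\<lambda>p::real\<times>real. X (snd p))"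
        by (rule continuous_on_compose2[OF Xc]) (auto intro!: continuous_intros)
      moreover have "s0 + 4 * D * fst p \<noteq> 0" if "p \<in> {0..\<tau>} \<times> (UNIV::real set)" for p
        using sp[of "fst p"] that by auto
      ultimately show ?thesis
        unfolding w_def E_def case_prod_unfold using s0 by (intro continuous_intros) auto
    qed
  next
    fix x assume "- A \<le> x" "x \<le> A"
    have E0: "E 0 z = exp (- (z\<^sup>2 / s0))" for z using s0 by (simp add: E_def)
    show "w 0 x < u 0 x"
    proof (cases "\<bar>X x\<bar> < \<rho>")
      case True
      have "E 0 (X x) \<le> 1" unfolding E0 using s0 by simp
      then have "w 0 x \<le> \<kappa> * (1 - \<theta>)" unfolding w_def using kp by simp
      also have "\<dots> < \<kappa>" using kp th by simp
      finally show ?thesis using near[OF True] by simp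
    next
      case False
      then have "\<rho>\<^sup>2 / s0 \<le> (X x)\<^sup>2 / s0"
        using r s0 by (intro divide_right_mono) (auto simp: abs_le_square_iff[symmetric])
      then have "E 0 (X x) \<le> exp (- \<rho>\<^sup>2 / s0)" unfolding E0 by simp
      also have "\<dots> < \<theta>" by (simp add: \<theta>_def)
      finally have "w 0 x < 0" unfolding w_def using kp by (simp add: mult_pos_neg)
      then show ?thesis using bnd[of 0 x] by simp
    qed
  next
    fix t assume "0 \<le> t" "t \<le> \<tau>"
    then show "w t (- A) < u t (- A)" "w t A < u t A"
      using Elow[of t "X (- A)"] Elow[of t "X A"] XA bnd[of t "- A"] bnd[of t A] kp
      unfolding w_def using mult_pos_neg[of \<kappa> "E t (X (- A)) - \<theta>"] mult_pos_neg[of \<kappa> "E t (X A) - \<theta>"] by auto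
  next
    fix t x assume a: "0 < t" "t \<le> \<tau>" "- A < x" "x < A" "x < 0" "w t x = u t x"
    have "has_jet w t x
      (\<kappa> * E t (1 * x - x0) * (4 * D * (1 * x - x0)\<^sup>2 / (s0 + 4 * D * t)\<^sup>2 - N * (4 * D) / (s0 + 4 * D * t) - (C + 1)))
      (\<kappa> * E t (1 * x - x0) * (4 * 1\<^sup>2 * (1 * x - x0)\<^sup>2 / (s0 + 4 * D * t)\<^sup>2 - 2 * 1\<^sup>2 / (s0 + 4 * D * t)))"
      by (rule has_jet_transform[OF jet[OF a(1)], of "{..<0}"]) (use a in \<open>auto simp: w_def X_def\<close>)
    then show "\<exists>\<alpha> \<beta>. has_jet w t x \<alpha> \<beta> \<and> \<alpha> < d1 * \<beta> + f1 (w t x)"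
      by (intro exI conjI, assumption) (rule key[where j = 1]; use a f D N in \<open>auto simp: X_def\<close>)
  next
    fix t x assume a: "0 < t" "t \<le> \<tau>" "- A < x" "x < A" "0 < x" "w t x = u t x"
    have "has_jet w t x
      (\<kappa> * E t (k * x - x0) * (4 * D * (k * x - x0)\<^sup>2 / (s0 + 4 * D * t)\<^sup>2 - N * (4 * D) / (s0 + 4 * D * t) - (C + 1)))
      (\<kappa> * E t (k * x - x0) * (4 * k\<^sup>2 * (k * x - x0)\<^sup>2 / (s0 + 4 * D * t)\<^sup>2 - 2 * k\<^sup>2 / (s0 + 4 * D * t)))"
      by (rule has_jet_transform[OF jet[OF a(1)], of "{0<..}"]) (use a in \<open>auto simp: w_def X_def\<close>)
    then show "\<exists>\<alpha> \<beta>. has_jet w t x \<alpha> \<beta> \<and> \<alpha> < d2 * \<beta> + f2 (w t x)"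
      by (intro exI conjI, assumption) (rule key[where j = k]; use a f D N in \<open>auto simp: X_def\<close>)
  next
    fix t assume a: "0 < t" "t \<le> \<tau>"
    have p: "0 < s0 + 4 * D * t" using sp[of t] a by simp
    define q where "q = \<kappa> * E t (- x0) * (2 * x0 / (s0 + 4 * D * t))"
    have slope: "((\<lambda>x. \<kappa> * (E t (j * x - x0) - \<theta>)) has_real_derivative j * q) (at 0)" for j
      unfolding E_def q_def by (rule DERIV_cong[OF gaussian_space_derivative]) simp
    have "q < 0" unfolding q_def using kp Ep p x0 by (intro mult_pos_neg divide_neg_pos) auto
    then have "1 * q < \<sigma> * (k * q)" using k by (metis mult.assoc mult_strict_right_mono_neg)
    moreover have "(w t has_real_derivative 1 * q) (at_left 0)"
      by (rule has_derivative_at_leftI[OF slope]) (auto simp: w_def X_def)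
    moreover have "(w t has_real_derivative k * q) (at_right 0)"
      by (rule has_derivative_at_rightI[OF slope]) (auto simp: w_def X_def)
    ultimately show "\<exists>p q. (w t has_real_derivative p) (at_left 0) \<and>
        (w t has_real_derivative q) (at_right 0) \<and> p < \<sigma> * q" by blast
  qed (use A tau in auto)
  moreover have "0 < w \<tau> y"
  proof -
    have "(X y)\<^sup>2 / (s0 + 4 * D * \<tau>) \<le> (X y)\<^sup>2 / (4 * D * \<tau>)"
      using s0 D tau by (intro divide_left_mono) (auto intro!: mult_pos_pos add_pos_pos)
    then have "ln 2 - \<rho>\<^sup>2 / s0 < - N * ln ((s0 + 4 * D * \<tau>) / s0) - (C + 1) * \<tau> - (X y)\<^sup>2 / (s0 + 4 * D * \<tau>)"
      using s0(2) by (simp add: Y_def)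
    then have "exp (ln 2 - \<rho>\<^sup>2 / s0) < E \<tau> (X y)" unfolding E_def by simp
    moreover have "exp (ln 2 - \<rho>\<^sup>2 / s0) = \<theta>" by (simp add: \<theta>_def exp_diff exp_minus field_simps)
    ultimately show ?thesis unfolding w_def using kp by simp
  qed
  ultimately show ?thesis by simp
qed

lemma positivity:
  assumes u: "two_patch d1 d2 \<sigma> f1 f2 u" and pos: "0 < d1" "0 < d2" "0 < \<sigma>"
    and bnd: "\<And>t x. 0 \<le> t \<Longrightarrow> 0 \<le> u t x \<and> u t x \<le> M"
    and C: "0 \<le> C" and f: "\<And>s. 0 \<le> s \<Longrightarrow> s \<le> M \<Longrightarrow> - C * s \<le> f1 s \<and> - C * s \<le> f2 s"
    and x0: "u 0 x0 \<noteq> 0" and tau: "0 < \<tau>"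
  shows "0 < u \<tau> y"
proof -
  have "isCont (u 0) x0"
    using continuous_on_time_slice[OF u, of 0 UNIV] by (simp add: continuous_on_eq_continuous_at)
  moreover have "0 < u 0 x0" using x0 bnd[of 0 x0] by simp
  ultimately have "\<forall>\<^sub>F x in at x0. 0 < u 0 x"
    unfolding isCont_def by (auto dest: order_tendstoD)
  then obtain \<rho> where r: "0 < \<rho>" "\<And>x. x \<noteq> x0 \<Longrightarrow> \<bar>x - x0\<bar> < \<rho> \<Longrightarrow> 0 < u 0 x"
    unfolding eventually_at by (auto simp: dist_real_def)
  consider "x0 < 0" | "x0 > 0" | "x0 = 0" by linarith
  then consider x1 where "x1 < 0" "0 < u 0 x1" | x1 where "x1 > 0" "0 < u 0 x1"
  proof cases
    case 3
    then show ?thesis using r(2)[of "- \<rho> / 2"] r(1) that(1)[of "- \<rho> / 2"] by auto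
  qed (use \<open>0 < u 0 x0\<close> in blast)+
  then show ?thesis
  proof cases
    case 1
    show ?thesis by (rule positivity_from_left[OF u pos bnd C f 1 tau])
  next
    case 2
    have "0 < (\<lambda>t x. u t (- x)) \<tau> (- y)"
      by (rule positivity_from_left[OF two_patch_reflect_space[OF u pos(3)] pos(2,1), of M C "- x1"])
         (use bnd C f 2 tau pos in auto)
    then show ?thesis by simp
  qed
qed

section \<open>A positive floor on an expanding cone\<close>

lemma exp_trig_derivative:
  fixes \<kappa> \<beta> \<omega> a b z :: real
  shows "((\<lambda>z. \<kappa> * exp (\<beta> * z) * (a * cos (\<omega> * z) + b * sin (\<omega> * z))) has_real_derivative
    \<kappa> * exp (\<beta> * z) * ((\<beta> * a + \<omega> * b) * cos (\<omega> * z) + (\<beta> * b - \<omega> * a) * sin (\<omega> * z))) (at z)"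
  by (rule derivative_eq_intros refl)+ (simp add: algebra_simps)

text \<open>A product of an exponential and a cosine in a moving coordinate. For suitable
\<open>\<beta>\<close> and \<open>\<omega>\<close>, one positive hump of it is the classical
compactly supported subsolution of the linearised equation.\<close>

lemma bump_jet:
  fixes \<kappa> \<beta> \<omega> A c t0 t x :: real
  defines "e \<equiv> \<lambda>t x. \<kappa> * exp (\<beta> * (x + A + c * (t - t0)))"
    and "C \<equiv> \<lambda>t x. cos (\<omega> * (x + A + c * (t - t0)))"
    and "S \<equiv> \<lambda>t x. sin (\<omega> * (x + A + c * (t - t0)))"
  shows "has_jet (\<lambda>t x. e t x * C t x) t x
    (e t x * (c * \<beta> * C t x - c * \<omega> * S t x))
    (e t x * ((\<beta>\<^sup>2 - \<omega>\<^sup>2) * C t x - 2 * \<beta> * \<omega> * S t x))"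
proof (rule has_jetI[where S = UNIV and v = "\<lambda>x. e t x * (\<beta> * C t x - \<omega> * S t x)"])
  note D = DERIV_chain2[OF exp_trig_derivative]
  have z1: "((\<lambda>t. x + A + c * (t - t0)) has_real_derivative c) (at t)"
    by (auto intro!: derivative_eq_intros)
  have z2: "((\<lambda>x. x + A + c * (t - t0)) has_real_derivative 1) (at y)" for y
    by (auto intro!: derivative_eq_intros)
  have alg: "E * ((\<beta> * 1 + \<omega> * 0) * p + (\<beta> * 0 - \<omega> * 1) * q) * c = E * (c * \<beta> * p - c * \<omega> * q)"
    "E * ((\<beta> * 1 + \<omega> * 0) * p + (\<beta> * 0 - \<omega> * 1) * q) * 1 = E * (\<beta> * p - \<omega> * q)"
    "E * ((\<beta> * \<beta> + \<omega> * - \<omega>) * p + (\<beta> * - \<omega> - \<omega> * \<beta>) * q) * 1 =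
      E * ((\<beta>\<^sup>2 - \<omega>\<^sup>2) * p - 2 * \<beta> * \<omega> * q)"
    "E * (1 * p + 0 * q) = E * p" "E * (\<beta> * p + - \<omega> * q) = E * (\<beta> * p - \<omega> * q)" for E p q
    by (simp_all add: algebra_simps power2_eq_square)
  show "((\<lambda>t. e t x * C t x) has_real_derivative e t x * (c * \<beta> * C t x - c * \<omega> * S t x)) (at t)"
    using D[OF z1, of \<kappa> \<beta> 1 \<omega> 0] unfolding e_def C_def S_def alg .
  show "((\<lambda>x. e t x * C t x) has_real_derivative e t y * (\<beta> * C t y - \<omega> * S t y)) (at y)" for y
    using D[OF z2, of \<kappa> \<beta> 1 \<omega> 0] unfolding e_def C_def S_def alg .
  show "((\<lambda>x. e t x * (\<beta> * C t x - \<omega> * S t x)) has_real_derivative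
      e t x * ((\<beta>\<^sup>2 - \<omega>\<^sup>2) * C t x - 2 * \<beta> * \<omega> * S t x)) (at x)"
    using D[OF z2, of \<kappa> \<beta> \<beta> \<omega> "- \<omega>" x] unfolding e_def C_def S_def alg .
qed auto

text \<open>With \<open>\<beta> = c / (2 * d1)\<close> the sine terms cancel, and the bump is a
strict subsolution, where it is positive, exactly when \<open>c\<^sup>2 / (4 * d1) + d1 *
\<omega>\<^sup>2 < \<mu>\<close>. One frequency and one amplitude serve all speeds \<open>0 \<le>
c \<le> cb\<close>, and the centres of the bumps with these speeds sweep the whole cone.\<close>

lemma left_cone:
  assumes u: "two_patch d1 d2 \<sigma> f1 f2 u" and pos: "0 < d1" "0 < d2" "0 < \<sigma>"
    and up: "\<And>t x. 0 < t \<Longrightarrow> 0 < u t x"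
    and c: "0 \<le> cb" "cb\<^sup>2 / (4 * d1) < \<mu>"
    and f: "0 < \<kappa>0" "\<And>s. 0 \<le> s \<Longrightarrow> s \<le> \<kappa>0 \<Longrightarrow> \<mu> * s \<le> f1 s"
  shows "\<exists>\<kappa>>0. \<exists>A>0. \<forall>t\<ge>1. \<forall>x. - A - cb * (t - 1) \<le> x \<and> x \<le> - A \<longrightarrow> \<kappa> < u t x"
proof -
  define \<omega> where "\<omega> = sqrt ((\<mu> - cb\<^sup>2 / (4 * d1)) / (2 * d1))"
  have om: "0 < \<omega>" "d1 * \<omega>\<^sup>2 = (\<mu> - cb\<^sup>2 / (4 * d1)) / 2"
    using c pos by (auto simp: \<omega>_def)
  define l where "l = pi / \<omega>"
  have l: "0 < l" "\<omega> * l = pi" using om by (auto simp: l_def)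
  obtain xm where xm: "xm \<in> {-3*l..-l}" "\<And>x. x \<in> {-3*l..-l} \<Longrightarrow> u 1 xm \<le> u 1 x"
    using continuous_attains_inf[of "{-3*l..-l}" "u 1"] continuous_on_time_slice[OF u, of 1] l by auto
  define m where "m = min \<kappa>0 (u 1 xm)"
  have m: "0 < m" "m \<le> \<kappa>0" "m \<le> u 1 xm" using f up[of 1] by (auto simp: m_def)
  define \<kappa> where "\<kappa> = m / 2 * exp (- (cb / (2 * d1) * l))"
  have kp: "0 < \<kappa>" using m by (simp add: \<kappa>_def)
  have "\<kappa> < u t x" if t: "1 \<le> t" and x: "- (2 * l) - cb * (t - 1) \<le> x" "x \<le> - (2 * l)" for t x
  proof -
    \<comment> \<open>the speed whose bump has its centre at the given point at the given time\<close>
    obtain c where c': "0 \<le> c" "c \<le> cb" "x = - (2 * l) - c * (t - 1)"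
    proof (cases "t = 1")
      case True then show ?thesis using that[of 0] x c by auto
    next
      case False
      then have t1: "0 < t - 1" using t by simp
      define c where "c = (- (2 * l) - x) / (t - 1)"
      have "c * (t - 1) = - (2 * l) - x" using t1 by (simp add: c_def)
      moreover have "0 \<le> c" using x t1 by (simp add: c_def)
      moreover have "c \<le> cb" using x t1 by (simp add: c_def pos_divide_le_eq)
      ultimately show ?thesis using that[of c] by simp
    qed
    define \<beta> where "\<beta> = c / (2 * d1)"
    have be: "0 \<le> \<beta>" "\<beta> \<le> cb / (2 * d1)" "2 * d1 * \<beta> = c"
      using c' pos by (auto simp: \<beta>_def divide_right_mono)
    define e where "e = (\<lambda>t x. \<kappa> * exp (\<beta> * (x + 2 * l + c * (t - 1))))"
    define C where "C = (\<lambda>t x. cos (\<omega> * (x + 2 * l + c * (t - 1))))"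
    define S where "S = (\<lambda>t x. sin (\<omega> * (x + 2 * l + c * (t - 1))))"
    define w where "w = (\<lambda>t x. e t x * C t x)"
    have ep: "0 < e t x" for t x using kp by (simp add: e_def)
    have wle: "w r y < m" if "\<bar>y + 2 * l + c * (r - 1)\<bar> \<le> l" for r y
    proof -
      define z where "z = y + 2 * l + c * (r - 1)"
      have "\<beta> * z \<le> \<beta> * l" by (rule mult_left_mono) (use that be in \<open>auto simp: z_def\<close>)
      also have "\<dots> \<le> cb / (2 * d1) * l" by (rule mult_right_mono) (use be l in auto)
      finally have "e r y \<le> \<kappa> * exp (cb / (2 * d1) * l)" unfolding e_def z_def[symmetric] using kp by simp
      also have "\<dots> = m / 2" by (simp add: \<kappa>_def exp_minus)
      finally have "e r y \<le> m / 2" .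
      moreover have "w r y \<le> e r y * 1" unfolding w_def using ep[of r y]
        by (intro mult_left_mono) (auto simp: C_def)
      ultimately show ?thesis using m by simp
    qed
    have jet: "has_jet w r y (e r y * (c * \<beta> * C r y - c * \<omega> * S r y))
        (e r y * ((\<beta>\<^sup>2 - \<omega>\<^sup>2) * C r y - 2 * \<beta> * \<omega> * S r y))" for r y
      unfolding w_def e_def C_def S_def by (rule bump_jet)
    have cr: "0 \<le> c * (r - 1)" if "1 \<le> r" for r using c' that by simp
    have "w t x < u t x"
    proof (rule comparison_sub[OF u pos, where ?T0.0 = 1 and ?T1.0 = t and w = w and
          a = "\<lambda>r. - (3 * l) - c * (r - 1)" and b = "\<lambda>r. - l - c * (r - 1)"])
      show "continuous_on ({1..t} \<times> UNIV) (\<lambda>(t, x). w t x)"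
        unfolding w_def e_def C_def case_prod_unfold by (intro continuous_intros)
    next
      fix y assume "- (3 * l) - c * (1 - 1) \<le> y" "y \<le> - l - c * (1 - 1)"
      then have "\<bar>y + 2 * l + c * (1 - 1)\<bar> \<le> l" "y \<in> {-3*l..-l}" by auto
      then show "w 1 y < u 1 y" using wle[of y 1] m xm(2)[of y] by linarith
    next
      fix r assume r: "1 \<le> r" "r \<le> t"
      have "C r (- (3 * l) - c * (r - 1)) = -1" "C r (- l - c * (r - 1)) = -1"
        using l by (auto simp: C_def)
      then have "w r (- (3 * l) - c * (r - 1)) < 0" "w r (- l - c * (r - 1)) < 0"
        using ep by (auto simp: w_def)
      then show "w r (- (3 * l) - c * (r - 1)) < u r (- (3 * l) - c * (r - 1))"
        "w r (- l - c * (r - 1)) < u r (- l - c * (r - 1))" using up[of r "- (3 * l) - c * (r - 1)"] up[of r "- l - c * (r - 1)"] r by linarith+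
    next
      fix r y assume r: "1 < r" "r \<le> t" and y: "- (3 * l) - c * (r - 1) < y" "y < - l - c * (r - 1)"
        and "w r y = u r y"
      then have wp: "0 < w r y" using up[of r y] by simp
      then have Cp: "0 < C r y" using ep[of r y] by (simp add: w_def zero_less_mult_iff)
      have "\<bar>y + 2 * l + c * (r - 1)\<bar> \<le> l" using y by auto
      then have "\<mu> * w r y \<le> f1 (w r y)" using wp wle[of y r] m by (intro f) auto
      moreover have "e r y * (c * \<beta> * C r y - c * \<omega> * S r y) <
        d1 * (e r y * ((\<beta>\<^sup>2 - \<omega>\<^sup>2) * C r y - 2 * \<beta> * \<omega> * S r y)) + \<mu> * w r y"
      proof -
        have "c * \<beta> / 2 = c\<^sup>2 / (4 * d1)" by (simp add: \<beta>_def power2_eq_square)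
        also have "\<dots> \<le> cb\<^sup>2 / (4 * d1)" using c' pos by (intro divide_right_mono power_mono) auto
        finally have g: "0 < \<mu> - d1 * \<omega>\<^sup>2 - c * \<beta> / 2" using om c by simp
        have b2: "d1 * \<beta>\<^sup>2 = c * \<beta> / 2" using be(3) by (simp add: power2_eq_square)
        have "d1 * (e r y * ((\<beta>\<^sup>2 - \<omega>\<^sup>2) * C r y - 2 * \<beta> * \<omega> * S r y)) + \<mu> * w r y -
            e r y * (c * \<beta> * C r y - c * \<omega> * S r y)
          = e r y * ((d1 * \<beta>\<^sup>2 - d1 * \<omega>\<^sup>2 + \<mu> - c * \<beta>) * C r y + (c - 2 * d1 * \<beta>) * \<omega> * S r y)"
          unfolding w_def by (simp add: algebra_simps)
        also have "\<dots> = e r y * ((\<mu> - d1 * \<omega>\<^sup>2 - c * \<beta> / 2) * C r y)" unfolding b2 be(3) by (simp add: algebra_simps)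
        also have "\<dots> > 0" using ep g Cp by simp
        finally show ?thesis by simp
      qed
      ultimately show "\<exists>\<alpha> \<beta>. has_jet w r y \<alpha> \<beta> \<and> \<alpha> < d1 * \<beta> + f1 (w r y)"
        using jet[of r y] by - (intro exI conjI, assumption, linarith)
    next
      fix r y assume "1 < r" "y < - l - c * (r - 1)" "0 < y"
      then show "\<exists>\<alpha> \<beta>. has_jet w r y \<alpha> \<beta> \<and> \<alpha> < d2 * \<beta> + f2 (w r y)"
        using cr[of r] l by auto
    next
      fix r assume "1 < r" "0 < - l - c * (r - 1)"
      then show "\<exists>p q. (w r has_real_derivative p) (at_left 0) \<and>
        (w r has_real_derivative q) (at_right 0) \<and> p < \<sigma> * q"
        using cr[of r] l by auto
    qed (use t c' l in \<open>auto intro!: continuous_intros\<close>)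
    moreover have "w t x = \<kappa>" using c' by (simp add: w_def e_def C_def)
    ultimately show ?thesis by simp
  qed
  then show ?thesis using kp l by (intro exI[of _ \<kappa>] exI[of _ "2 * l"] conjI) auto
qed

section \<open>Bounds for monostable reactions\<close>

lemma positive_on_Icc:
  fixes f :: "real \<Rightarrow> real"
  assumes "continuous_on {a..b} f" "\<And>s. a \<le> s \<Longrightarrow> s \<le> b \<Longrightarrow> 0 < f s"
  obtains \<mu> where "0 < \<mu>" "\<And>s. a \<le> s \<Longrightarrow> s \<le> b \<Longrightarrow> \<mu> \<le> f s"
proof (cases "a \<le> b")
  case True
  then obtain x where "x \<in> {a..b}" "\<And>s. s \<in> {a..b} \<Longrightarrow> f x \<le> f s"
    using continuous_attains_inf[of "{a..b}" f] assms(1) by auto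
  then show ?thesis using assms(2) that[of "f x"] by auto
next
  case False
  then show ?thesis using that[of 1] by auto
qed

lemma kpp_differentiable:
  assumes "KPP_reaction K f"
  obtains f' where "\<And>s. (f has_real_derivative f' s) (at s)" "continuous_on UNIV f'" "deriv f = f'"
proof -
  obtain D where D: "\<And>x. (f has_vector_derivative D x) (at x)" "continuous_on UNIV D"
    using assms unfolding KPP_reaction_def C1_differentiable_on_def by auto
  then have "\<And>x. (f has_real_derivative D x) (at x)" by (simp add: has_real_derivative_iff_has_vector_derivative)
  then show ?thesis using that[of D] D(2) by (auto intro!: DERIV_imp_deriv)
qed

lemma kpp_continuous: "KPP_reaction K f \<Longrightarrow> continuous_on S f"
  by (meson DERIV_isCont continuous_at_imp_continuous_on kpp_differentiable)

lemma kpp_pos: "KPP_reaction K f \<Longrightarrow> 0 < s \<Longrightarrow> s < K \<Longrightarrow> 0 < f s"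
  and kpp_neg: "KPP_reaction K f \<Longrightarrow> K < s \<Longrightarrow> f s < 0"
  and kpp_zero: "KPP_reaction K f \<Longrightarrow> f 0 = 0" "KPP_reaction K f \<Longrightarrow> f K = 0"
  unfolding KPP_reaction_def by auto

lemma kpp_rate_pos:
  assumes "KPP_reaction K f" "0 < K" shows "0 < deriv f 0"
proof -
  have "0 < K / 2" "K / 2 < K" using assms(2) by auto
  then have "0 < f (K / 2)" "f (K / 2) \<le> deriv f 0 * (K / 2)"
    using assms(1) unfolding KPP_reaction_def by blast+
  then have "0 < deriv f 0 * (K / 2)" by linarith
  then show ?thesis using assms(2) by (simp add: zero_less_mult_iff)
qed

text \<open>Beyond \<open>K\<close> the reaction is negative, so the linear bound holds for all
nonnegative densities.\<close>

lemma kpp_linear_upper: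
  assumes "KPP_reaction K f" "0 < K" "0 \<le> s" shows "f s \<le> deriv f 0 * s"
proof -
  have "0 \<le> deriv f 0 * s" using kpp_rate_pos[OF assms(1,2)] assms(3) by simp
  moreover have "s = 0 \<or> (0 < s \<and> s < K) \<or> s = K \<or> K < s" using assms(3) by linarith
  ultimately show ?thesis
    using assms kpp_zero[OF assms(1)] kpp_neg[OF assms(1), of s] unfolding KPP_reaction_def by auto
qed

lemma kpp_linear_lower:
  assumes "KPP_reaction K f" "\<mu> < deriv f 0"
  shows "\<exists>\<kappa>>0. \<forall>s. 0 \<le> s \<and> s \<le> \<kappa> \<longrightarrow> \<mu> * s \<le> f s"
proof -
  obtain f' where f': "\<And>s. (f has_real_derivative f' s) (at s)" "deriv f = f'"
    using kpp_differentiable[OF assms(1)] by metis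
  have "((\<lambda>y. (f y - f 0) / (y - 0)) \<longlongrightarrow> deriv f 0) (at 0)"
    using f'(1)[of 0] unfolding f'(2) by (simp add: has_field_derivative_iff)
  then have "\<forall>\<^sub>F y in at 0. \<mu> < (f y - f 0) / (y - 0)" using assms(2) by (rule order_tendstoD)
  then obtain d where d: "0 < d" "\<And>y. y \<noteq> 0 \<Longrightarrow> \<bar>y\<bar> < d \<Longrightarrow> \<mu> < f y / y"
    unfolding eventually_at using kpp_zero[OF assms(1)] by (auto simp: dist_real_def)
  have "\<mu> * s \<le> f s" if "0 \<le> s" "s \<le> d / 2" for s
    using d(2)[of s] d(1) that kpp_zero[OF assms(1)] by (cases "s = 0") (auto simp: field_simps)
  then show ?thesis using d(1) by (intro exI[of _ "d / 2"]) auto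
qed

lemma kpp_lower_bound:
  assumes "KPP_reaction K f"
  shows "\<exists>C\<ge>0. \<forall>s. 0 \<le> s \<and> s \<le> M \<longrightarrow> - C * s \<le> f s"
proof -
  obtain f' where f': "\<And>s. (f has_real_derivative f' s) (at s)" "continuous_on UNIV f'"
    using kpp_differentiable[OF assms] by metis
  have "continuous_on {0..M} f'" using f'(2) by (rule continuous_on_subset) auto
  then have "bounded (f' ` {0..M})" by (intro compact_imp_bounded compact_continuous_image) auto
  then obtain C where C: "\<And>s. s \<in> {0..M} \<Longrightarrow> \<bar>f' s\<bar> \<le> C" unfolding bounded_iff by force
  have "- \<bar>C\<bar> * s \<le> f s" if s: "0 \<le> s" "s \<le> M" for s
  proof (cases "s = 0")
    case False
    have "\<exists>z>0. z < s \<and> f s - f 0 = (s - 0) * f' z"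
      by (rule MVT2) (use f' False s in auto)
    then obtain z where "0 < z" "z < s" "f s = s * f' z" using kpp_zero[OF assms] by auto
    moreover have "- \<bar>C\<bar> \<le> f' z" using C[of z] calculation s by auto
    then have "- \<bar>C\<bar> * s \<le> f' z * s" using s by (intro mult_right_mono) auto
    ultimately show ?thesis by (simp add: mult.commute)
  qed (use kpp_zero[OF assms] in auto)
  then show ?thesis by (intro exI[of _ "\<bar>C\<bar>"]) auto
qed

text \<open>This is the box lemma for \<open>- u\<close>; the boxes may lie anywhere in the left
half-line, as the upper bound \<open>M\<close> holds everywhere.\<close>

lemma far_left_upper:
  assumes u: "two_patch d1 d2 \<sigma> f1 f2 u" and pos: "0 < d1" "0 < d2" "0 < \<sigma>"
    and M: "\<And>t x. 0 \<le> t \<Longrightarrow> u t x \<le> M"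
    and fc: "continuous_on UNIV f1" and f: "\<And>s. k \<le> s \<Longrightarrow> f1 s < 0"
  shows "\<exists>R>0. \<exists>T\<ge>0. \<forall>t\<ge>T. \<forall>x\<le>-R. u t x \<le> k"
proof -
  define k0 where "k0 = - max M k"
  have "continuous_on {k0..-k} (\<lambda>s. - f1 (0 - s))"
    by (intro continuous_intros continuous_on_compose2[OF fc]) auto
  then obtain \<mu> where mu: "0 < \<mu>" "\<And>s. k0 \<le> s \<Longrightarrow> s \<le> - k \<Longrightarrow> \<mu> \<le> - f1 (0 - s)"
    by (rule positive_on_Icc) (use f in auto)
  obtain R L where RL: "0 < R" "0 \<le> L" "\<And>T x0. 0 \<le> T \<Longrightarrow> x0 \<le> - R \<Longrightarrow>
    (\<forall>t x. T \<le> t \<and> t \<le> T + L \<and> \<bar>x - x0\<bar> \<le> R \<longrightarrow> k0 \<le> 0 - u t x) \<Longrightarrow> - k \<le> 0 - u (T + L) x0"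
    using box_lift[OF two_patch_reflect_value[OF u, of 0] pos _ mu] by (metis k0_def max.cobounded2 neg_le_iff_le)
  have "u t x \<le> k" if "t \<ge> L" "x \<le> - R" for t x
  proof -
    have "- k \<le> 0 - u (t - L + L) x"
    proof (rule RL(3))
      show "\<forall>s y. t - L \<le> s \<and> s \<le> t - L + L \<and> \<bar>y - x\<bar> \<le> R \<longrightarrow> k0 \<le> 0 - u s y"
        using M that(1) unfolding k0_def by (smt (verit) max.cobounded1)
    qed (use that in auto)
    then show ?thesis by simp
  qed
  then show ?thesis using RL(1,2) by (intro exI[of _ R] exI[of _ L] conjI) auto
qed

text \<open>The boxes of bounded size and duration below a point of the slower cone \<open>- c * t
\<le> x\<close> stay in the faster cone \<open>- c' * t \<le> x\<close> once \<open>t\<close> is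
large.\<close>

lemma far_left_lower:
  assumes u: "two_patch d1 d2 \<sigma> f1 f2 u" and pos: "0 < d1" "0 < d2" "0 < \<sigma>"
    and cone: "\<And>t x. T \<le> t \<Longrightarrow> - c' * t \<le> x \<Longrightarrow> x \<le> 0 \<Longrightarrow> \<kappa> \<le> u t x"
    and c: "c < c'" "0 \<le> c'" and k: "\<kappa> \<le> k"
    and fc: "continuous_on UNIV f1" and f: "\<And>s. \<kappa> \<le> s \<Longrightarrow> s \<le> k \<Longrightarrow> 0 < f1 s"
  shows "\<exists>R>0. \<exists>T\<ge>0. \<forall>t\<ge>T. \<forall>x. - c * t \<le> x \<and> x \<le> - R \<longrightarrow> k \<le> u t x"
proof -
  obtain \<mu> where mu: "0 < \<mu>" "\<And>s. \<kappa> \<le> s \<Longrightarrow> s \<le> k \<Longrightarrow> \<mu> \<le> f1 s"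
    by (rule positive_on_Icc[OF continuous_on_subset[OF fc]]) (use f in auto)
  obtain R L where RL: "0 < R" "0 \<le> L" "\<And>T x0. 0 \<le> T \<Longrightarrow> x0 \<le> - R \<Longrightarrow>
    (\<forall>t x. T \<le> t \<and> t \<le> T + L \<and> \<bar>x - x0\<bar> \<le> R \<longrightarrow> \<kappa> \<le> u t x) \<Longrightarrow> k \<le> u (T + L) x0"
    using box_lift[OF u pos k mu] by metis
  define T' where "T' = max (\<bar>T\<bar> + L) ((R + c' * L) / (c' - c))"
  have "k \<le> u t x" if t: "t \<ge> T'" and x: "- c * t \<le> x" "x \<le> - R" for t x
  proof -
    have tT: "\<bar>T\<bar> \<le> t - L" and tc: "(R + c' * L) / (c' - c) \<le> t" using t by (auto simp: T'_def)
    have "R + c' * L \<le> (c' - c) * t" using tc c by (simp add: pos_divide_le_eq mult.commute)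
    then have b: "- c' * (t - L) \<le> - c * t - R" by (simp add: algebra_simps)
    have "k \<le> u (t - L + L) x"
    proof (rule RL(3), goal_cases)
      case 3
      show ?case
      proof (intro allI impI cone)
        fix s y assume a: "t - L \<le> s \<and> s \<le> t - L + L \<and> \<bar>y - x\<bar> \<le> R"
        have "c' * (t - L) \<le> c' * s" by (rule mult_left_mono) (use a c in auto)
        then show "- c' * s \<le> y" using b x a by auto
        show "T \<le> s" "y \<le> 0" using a tT x by auto
      qed
    qed (use tT x in auto)
    then show ?thesis by simp
  qed
  moreover have "0 \<le> T'" using RL by (auto simp: T'_def)
  ultimately show ?thesis using RL(1) by blast
qed

lemma left_cone_kpp:
  assumes u: "two_patch d1 d2 \<sigma> f1 f2 u" and pos: "0 < d1" "0 < d2" "0 < \<sigma>"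
    and up: "\<And>t x. 0 < t \<Longrightarrow> 0 < u t x" and kpp: "KPP_reaction K f1" "0 < K"
    and c: "0 \<le> c" "c < spreading_speed d1 f1"
  shows "\<exists>\<kappa>>0. \<exists>A>0. \<forall>t\<ge>1. \<forall>x. - A - c * (t - 1) \<le> x \<and> x \<le> - A \<longrightarrow> \<kappa> < u t x"
proof -
  have r: "0 < deriv f1 0" using kpp by (rule kpp_rate_pos)
  have "c\<^sup>2 < (2 * sqrt (d1 * deriv f1 0))\<^sup>2"
    using c unfolding spreading_speed_def by (intro power_strict_mono) auto
  also have "\<dots> = 4 * d1 * deriv f1 0" using r pos by (simp add: power_mult_distrib)
  finally have "c\<^sup>2 / (4 * d1) < deriv f1 0" using pos by (simp add: pos_divide_less_eq mult_ac)
  then obtain \<mu> where mu: "c\<^sup>2 / (4 * d1) < \<mu>" "\<mu> < deriv f1 0" using dense by blast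
  obtain \<kappa>0 where "0 < \<kappa>0" "\<And>s. 0 \<le> s \<Longrightarrow> s \<le> \<kappa>0 \<Longrightarrow> \<mu> * s \<le> f1 s"
    using kpp_linear_lower[OF kpp(1) mu(2)] by auto
  then show ?thesis using left_cone[OF u pos up c(1) mu(1)] by auto
qed

text \<open>The upper bound \<open>M\<close> is a parameter of the locale because every estimate
starts from it; the point \<open>x0\<close> witnesses that the solution does not vanish
identically at time \<open>0\<close>.\<close>

locale kpp_solution =
  fixes d1 d2 \<sigma> K1 K2 :: real and f1 f2 :: "real \<Rightarrow> real" and u :: "real \<Rightarrow> real \<Rightarrow> real"
    and M x0 :: real
  assumes pos: "0 < d1" "0 < d2" "0 < \<sigma>" and K: "0 < K1" "K1 \<le> K2"
    and kpp1: "KPP_reaction K1 f1" and kpp2: "KPP_reaction K2 f2"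
    and u: "two_patch d1 d2 \<sigma> f1 f2 u"
    and bnd: "\<And>t x. 0 \<le> t \<Longrightarrow> 0 \<le> u t x \<and> u t x \<le> M"
    and nontrivial: "u 0 x0 \<noteq> 0"
begin

lemma K2_pos: "0 < K2" using K by simp

lemma u_pos: "0 < t \<Longrightarrow> 0 < u t x"
proof -
  assume t: "0 < t"
  obtain C1 C2 where C: "C1 \<ge> 0" "\<And>s. 0 \<le> s \<Longrightarrow> s \<le> M \<Longrightarrow> - C1 * s \<le> f1 s"
    "C2 \<ge> 0" "\<And>s. 0 \<le> s \<Longrightarrow> s \<le> M \<Longrightarrow> - C2 * s \<le> f2 s"
    using kpp_lower_bound[OF kpp1] kpp_lower_bound[OF kpp2] by metis
  show ?thesis
  proof (rule positivity[OF u pos bnd, where C = "C1 + C2"])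
    fix s assume s: "0 \<le> s" "s \<le> M"
    have "- (C1 + C2) * s \<le> - C1 * s" "- (C1 + C2) * s \<le> - C2 * s"
      using C s by (auto simp: algebra_simps)
    then show "- (C1 + C2) * s \<le> f1 s \<and> - (C1 + C2) * s \<le> f2 s" using C(2,4)[OF s] by linarith
  qed (use C t nontrivial in auto)
qed

lemma u_upper_left:
  assumes "0 < \<delta>"
  shows "\<exists>R>0. \<exists>T\<ge>0. \<forall>t\<ge>T. \<forall>x\<le>-R. u t x \<le> K1 + \<delta>"
  by (rule far_left_upper[OF u pos _ kpp_continuous[OF kpp1], of M])
     (use bnd kpp_neg[OF kpp1] assms in auto)

lemma u_upper_right:
  assumes "0 < \<delta>"
  shows "\<exists>R>0. \<exists>T\<ge>0. \<forall>t\<ge>T. \<forall>x\<ge>R. u t x \<le> K2 + \<delta>"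
proof -
  obtain R T where RT: "R > 0" "T \<ge> 0" "\<And>t x. t \<ge> T \<Longrightarrow> x \<le> - R \<Longrightarrow> u t (- x) \<le> K2 + \<delta>"
    using far_left_upper[OF two_patch_reflect_space[OF u pos(3)] pos(2,1) _ _ kpp_continuous[OF kpp2], of M "K2 + \<delta>"]
      bnd kpp_neg[OF kpp2] assms pos(3) by (auto simp: divide_simps)
  then show ?thesis by (intro exI[of _ R] exI[of _ T]) (metis minus_minus neg_le_iff_le)
qed

text \<open>On the far field the boxes do not meet the interface; \<open>K1 \<le> K2\<close> makes
both reactions negative above \<open>K2\<close>, so a kinked line brings the solution down in the
remaining strip.\<close>

lemma u_upper:
  assumes d: "0 < \<delta>"
  shows "\<exists>T\<ge>0. \<forall>t\<ge>T. \<forall>x. u t x \<le> K2 + \<delta>"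
proof -
  obtain R1 T1 where 1: "R1 > 0" "T1 \<ge> 0" "\<And>t x. t \<ge> T1 \<Longrightarrow> x \<le> - R1 \<Longrightarrow> u t x \<le> K1 + \<delta> / 2"
    using u_upper_left[of "\<delta> / 2"] d by (metis half_gt_zero)
  obtain R2 T2 where 2: "R2 > 0" "T2 \<ge> 0" "\<And>t x. t \<ge> T2 \<Longrightarrow> x \<ge> R2 \<Longrightarrow> u t x \<le> K2 + \<delta> / 2"
    using u_upper_right[of "\<delta> / 2"] d by (metis half_gt_zero)
  define R where "R = max R1 R2"
  define T where "T = max T1 T2"
  have RT: "0 < R" "0 \<le> T" "R1 \<le> R" "R2 \<le> R" "T1 \<le> T" "T2 \<le> T" using 1 2 by (auto simp: R_def T_def)
  define k where "k = K2 + 3 * \<delta> / 4"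
  have far: "u t x \<le> K2 + \<delta> / 2" if "t \<ge> T" "\<bar>x\<bar> \<ge> R" for t x
    using 1(3)[of t x] 2(3)[of t x] that RT K by (cases "x \<ge> 0") auto
  \<comment> \<open>lower bound of - u; it lies below the target - k by construction\<close>
  define k0 where "k0 = - max M k"
  have fneg: "f1 s < 0" "f2 s < 0" if "k \<le> s" for s
    using that kpp_neg[OF kpp1, of s] kpp_neg[OF kpp2, of s] K d by (auto simp: k_def)
  have "continuous_on {k0..-k} (\<lambda>s. min (- f1 (0 - s)) (- f2 (0 - s)))"
    by (intro continuous_intros continuous_on_compose2[OF kpp_continuous[OF kpp1, of UNIV]]
        continuous_on_compose2[OF kpp_continuous[OF kpp2, of UNIV]]) auto
  then obtain \<mu> where mu: "0 < \<mu>" "\<And>s. k0 \<le> s \<Longrightarrow> s \<le> - k \<Longrightarrow> \<mu> \<le> min (- f1 (0 - s)) (- f2 (0 - s))"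
    by (rule positive_on_Icc) (use fneg in auto)
  have "\<exists>T'\<ge>T. \<forall>t\<ge>T'. \<forall>x. \<bar>x\<bar> \<le> R \<longrightarrow> - k - \<delta> / 4 < 0 - u t x"
  proof (rule interface_lift[OF two_patch_reflect_value[OF u, of 0] pos RT(2,1) _ mu(1)])
    show "k0 \<le> - k" by (simp add: k0_def)
    show "\<mu> \<le> - f1 (0 - s) \<and> \<mu> \<le> - f2 (0 - s)" if "k0 \<le> s" "s \<le> - k" for s using mu(2)[OF that] by simp
    show "k0 \<le> 0 - u t x" if "T \<le> t" "\<bar>x\<bar> \<le> R" for t x using bnd[of t x] that RT by (auto simp: k0_def)
    show "- k < 0 - u t (- R) \<and> - k < 0 - u t R" if "T \<le> t" for t
      using far[OF that, of R] far[OF that, of "- R"] RT d by (auto simp: k_def)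
  qed (use d in auto)
  then obtain T' where T': "T' \<ge> T" "\<And>t x. t \<ge> T' \<Longrightarrow> \<bar>x\<bar> \<le> R \<Longrightarrow> - k - \<delta> / 4 < 0 - u t x" by auto
  have "u t x \<le> K2 + \<delta>" if "t \<ge> T'" for t x
    using T'(2)[OF that, of x] far[of t x] T'(1) that d by (cases "\<bar>x\<bar> \<le> R") (auto simp: k_def)
  then show ?thesis using T' RT by (intro exI[of _ T']) auto
qed

lemma u_cone:
  assumes c1: "0 \<le> c1" "c1 < spreading_speed d1 f1" and c2: "0 \<le> c2" "c2 < spreading_speed d2 f2"
  shows "\<exists>\<kappa>>0. \<exists>T\<ge>0. \<forall>t\<ge>T. \<forall>x. - c1 * t \<le> x \<and> x \<le> c2 * t \<longrightarrow> \<kappa> \<le> u t x"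
proof -
  obtain b1 b2 where b1: "c1 < b1" "b1 < spreading_speed d1 f1" and b2: "c2 < b2" "b2 < spreading_speed d2 f2"
    using dense[OF c1(2)] dense[OF c2(2)] by auto
  have b0: "0 \<le> b1" "0 \<le> b2" using b1 b2 c1 c2 by auto
  obtain k1 A1 where A1: "0 < k1" "0 < A1" "\<And>t x. t \<ge> 1 \<Longrightarrow> - A1 - b1 * (t - 1) \<le> x \<Longrightarrow> x \<le> - A1 \<Longrightarrow> k1 < u t x"
    using left_cone_kpp[OF u pos u_pos kpp1 K(1) b0(1) b1(2)] by metis
  have "\<exists>k>0. \<exists>A>0. \<forall>t\<ge>1. \<forall>x. - A - b2 * (t - 1) \<le> x \<and> x \<le> - A \<longrightarrow> k < u t (- x)"
    by (rule left_cone_kpp[OF two_patch_reflect_space[OF u pos(3)] pos(2,1) _ _ kpp2 K2_pos b0(2) b2(2)])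
       (use pos u_pos in auto)
  then obtain k2 A2 where A2: "0 < k2" "0 < A2" "\<And>t x. t \<ge> 1 \<Longrightarrow> - A2 - b2 * (t - 1) \<le> x \<Longrightarrow> x \<le> - A2 \<Longrightarrow> k2 < u t (- x)"
    by metis
  have A2': "k2 < u t x" if "t \<ge> 1" "A2 \<le> x" "x \<le> A2 + b2 * (t - 1)" for t x
    using A2(3)[of t "- x"] that by auto
  have "{-A1..A2} \<noteq> {}" using A1(2) A2(2) by simp
  then obtain xm where xm: "\<And>x. - A1 \<le> x \<Longrightarrow> x \<le> A2 \<Longrightarrow> u 1 xm \<le> u 1 x"
    using continuous_attains_inf[OF compact_Icc _ continuous_on_time_slice[OF u], of "-A1" A2 1]
    by (metis atLeastAtMost_iff zero_le_one)
  \<comment> \<open>both reactions are positive on the values up to this level, which lies below the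
    solution at time 1 and below its later values at the two ends of the strip\<close>
  define m where "m = min (min k1 k2) (min (K1 / 2) (u 1 xm / 2))"
  have m: "0 < m" "m \<le> k1" "m \<le> k2" "m < K1" "m < u 1 xm"
    using A1 A2 K u_pos[of 1 xm] by (auto simp: m_def min_def)
  have mid: "m / 2 < u t x" if "t \<ge> 1" "- A1 \<le> x" "x \<le> A2" for t x
  proof (rule interface_floor[OF u pos, where T = 1 and a = "- A1" and b = A2])
    show "0 < f1 s \<and> 0 < f2 s" if "m / 2 \<le> s" "s \<le> m" for s
      using kpp_pos[OF kpp1, of s] kpp_pos[OF kpp2, of s] that m K by auto
    show "m < u 1 x" if "- A1 \<le> x" "x \<le> A2" for x using xm[OF that] m by simp
    show "m < u t (- A1) \<and> m < u t A2" if "1 \<le> t" for t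
      using A1(3)[of t "- A1"] A2'[of t A2] that m b0 by auto
  qed (use A1 A2 m that in auto)
  define T where "T = max 1 (max (b1 / (b1 - c1)) (b2 / (b2 - c2)))"
  have "m / 2 \<le> u t x" if t: "t \<ge> T" and x: "- c1 * t \<le> x" "x \<le> c2 * t" for t x
  proof -
    have t1: "t \<ge> 1" "b1 / (b1 - c1) \<le> t" "b2 / (b2 - c2) \<le> t" using t by (auto simp: T_def)
    have "b1 \<le> t * (b1 - c1)" "b2 \<le> t * (b2 - c2)" using t1 b1 b2 by (auto simp: pos_divide_le_eq)
    then have "- A1 - b1 * (t - 1) \<le> x" "x \<le> A2 + b2 * (t - 1)" using x A1 A2 by (auto simp: algebra_simps)
    then show ?thesis using A1(3)[of t x] A2'[of t x] mid[of t x] t1(1) m by (cases "x \<le> - A1"; cases "x \<le> A2") auto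
  qed
  then show ?thesis using m by (intro exI[of _ "m / 2"] exI[of _ T] conjI) (auto simp: T_def)
qed

text \<open>Near the interface only the smaller capacity \<open>K1\<close> can be reached by a
barrier that is constant up to a kink. The far field to the right is bounded by the larger
capacity.\<close>

lemma u_lower:
  assumes c1: "0 < c1" "c1 < spreading_speed d1 f1" and c2: "0 < c2" "c2 < spreading_speed d2 f2"
    and d: "0 < \<delta>"
  shows "\<exists>R>0. \<exists>T\<ge>0. \<forall>t\<ge>T. \<forall>x. - c1 * t \<le> x \<and> x \<le> c2 * t \<longrightarrow>
    K1 - \<delta> \<le> u t x \<and> (R \<le> x \<longrightarrow> K2 - \<delta> \<le> u t x)"
proof -
  define e where "e = min \<delta> (K1 / 2)"
  have e: "0 < e" "e \<le> \<delta>" "e < K1" using d K by (auto simp: e_def)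
  obtain b1 b2 where b1: "c1 < b1" "b1 < spreading_speed d1 f1" and b2: "c2 < b2" "b2 < spreading_speed d2 f2"
    using dense[OF c1(2)] dense[OF c2(2)] by auto
  have b0: "0 \<le> b1" "0 \<le> b2" using b1 b2 c1 c2 by auto
  obtain k T where kT: "0 < k" "0 \<le> T" "\<And>t x. t \<ge> T \<Longrightarrow> - b1 * t \<le> x \<Longrightarrow> x \<le> b2 * t \<Longrightarrow> k \<le> u t x"
    using u_cone[OF b0(1) b1(2) b0(2) b2(2)] by metis
  define \<kappa> where "\<kappa> = min k (K1 - e)"
  have kp: "0 < \<kappa>" "\<kappa> \<le> K1 - e" "\<kappa> \<le> k" using kT e by (auto simp: \<kappa>_def)
  have f1: "0 < f1 s" if "\<kappa> \<le> s" "s \<le> K1 - e / 2" for s using kpp_pos[OF kpp1, of s] that kp e by auto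
  have f2: "0 < f2 s" if "\<kappa> \<le> s" "s \<le> K2 - e / 2" for s using kpp_pos[OF kpp2, of s] that kp e by auto
  have "\<exists>R>0. \<exists>T\<ge>0. \<forall>t\<ge>T. \<forall>x. - c1 * t \<le> x \<and> x \<le> - R \<longrightarrow> K1 - e / 2 \<le> u t x"
  proof (rule far_left_lower[OF u pos _ b1(1) b0(1) _ kpp_continuous[OF kpp1] f1])
    fix t x assume a: "T \<le> t" "- b1 * t \<le> x" "x \<le> 0"
    have "0 \<le> b2 * t" using a b0 kT by simp
    then show "\<kappa> \<le> u t x" using kT(3)[of t x] kp a by auto
  qed (use kp e in auto)
  then obtain R1 T1 where 1: "R1 > 0" "T1 \<ge> 0" "\<And>t x. t \<ge> T1 \<Longrightarrow> - c1 * t \<le> x \<Longrightarrow> x \<le> - R1 \<Longrightarrow> K1 - e / 2 \<le> u t x"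
    by metis
  have "\<exists>R>0. \<exists>T\<ge>0. \<forall>t\<ge>T. \<forall>x. - c2 * t \<le> x \<and> x \<le> - R \<longrightarrow> K2 - e / 2 \<le> u t (- x)"
  proof (rule far_left_lower[OF two_patch_reflect_space[OF u pos(3)] pos(2,1) _ _ b2(1) b0(2) _ kpp_continuous[OF kpp2] f2])
    fix t x assume a: "T \<le> t" "- b2 * t \<le> x" "x \<le> 0"
    have "0 \<le> b1 * t" using a b0 kT by simp
    then show "\<kappa> \<le> u t (- x)" using kT(3)[of t "- x"] kp a by auto
  qed (use kp e K pos in auto)
  then obtain R2 T2 where 2: "R2 > 0" "T2 \<ge> 0" "\<And>t x. t \<ge> T2 \<Longrightarrow> - c2 * t \<le> x \<Longrightarrow> x \<le> - R2 \<Longrightarrow> K2 - e / 2 \<le> u t (- x)"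
    by metis
  have 2: "R2 > 0" "T2 \<ge> 0" "\<And>t x. t \<ge> T2 \<Longrightarrow> x \<le> c2 * t \<Longrightarrow> R2 \<le> x \<Longrightarrow> K2 - e / 2 \<le> u t x"
    using 2(1,2) 2(3)[of _ "- x" for x] by auto
  define R where "R = max R1 R2"
  define T' where "T' = max (max T (max T1 T2)) (max (R / c1) (R / c2))"
  have R: "0 < R" "R1 \<le> R" "R2 \<le> R" using 1 2 by (auto simp: R_def)
  have T': "0 \<le> T'" using kT by (auto simp: T'_def)
  have TR: "T \<le> t" "T1 \<le> t" "T2 \<le> t" "R \<le> c1 * t" "R \<le> c2 * t" if "T' \<le> t" for t
    using that c1 c2 by (auto simp: T'_def pos_divide_le_eq mult.commute)
  have bc: "- b1 * t \<le> - c1 * t" "c2 * t \<le> b2 * t" if "0 \<le> t" for t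
    using b1 b2 that by (auto intro: mult_right_mono)
  have "continuous_on {\<kappa>..K1 - 3 * e / 4} (\<lambda>s. min (f1 s) (f2 s))"
    by (intro continuous_intros kpp_continuous[OF kpp1] kpp_continuous[OF kpp2])
  then obtain \<mu> where mu: "0 < \<mu>" "\<And>s. \<kappa> \<le> s \<Longrightarrow> s \<le> K1 - 3 * e / 4 \<Longrightarrow> \<mu> \<le> min (f1 s) (f2 s)"
    by (rule positive_on_Icc) (use f1 f2 e K in auto)
  have "\<exists>T''\<ge>T'. \<forall>t\<ge>T''. \<forall>x. \<bar>x\<bar> \<le> R \<longrightarrow> K1 - 3 * e / 4 - e / 4 < u t x"
  proof (rule interface_lift[OF u pos T' R(1) _ mu(1)])
    show "\<mu> \<le> f1 s \<and> \<mu> \<le> f2 s" if "\<kappa> \<le> s" "s \<le> K1 - 3 * e / 4" for s using mu(2)[OF that] by simp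
    show "\<kappa> \<le> u t x" if "T' \<le> t" "\<bar>x\<bar> \<le> R" for t x
    proof -
      have "- R \<le> x" "x \<le> R" "0 \<le> t" using that T' by auto
      then have "- b1 * t \<le> x" "x \<le> b2 * t" using TR[OF that(1)] bc[of t] by linarith+
      then show ?thesis using kT(3)[OF TR(1)[OF that(1)]] kp by fastforce
    qed
    show "K1 - 3 * e / 4 < u t (- R) \<and> K1 - 3 * e / 4 < u t R" if "T' \<le> t" for t
      using 1(3)[of t "- R"] 2(3)[of t R] TR[OF that] R e K by auto
  qed (use kp e in auto)
  then obtain T'' where T'': "T'' \<ge> T'" "\<And>t x. t \<ge> T'' \<Longrightarrow> \<bar>x\<bar> \<le> R \<Longrightarrow> K1 - 3 * e / 4 - e / 4 < u t x" by auto
  have "K1 - \<delta> \<le> u t x \<and> (R \<le> x \<longrightarrow> K2 - \<delta> \<le> u t x)" if t: "t \<ge> T''" and x: "- c1 * t \<le> x" "x \<le> c2 * t" for t x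
  proof -
    have "T' \<le> t" using t T'' by simp
    note TR = TR[OF this]
    consider "x \<le> - R" | "\<bar>x\<bar> \<le> R" "x < R" | "R \<le> x" by linarith
    then show ?thesis
    proof cases
      case 1
      then show ?thesis using \<open>\<And>t x. t \<ge> T1 \<Longrightarrow> - c1 * t \<le> x \<Longrightarrow> x \<le> - R1 \<Longrightarrow> K1 - e / 2 \<le> u t x\<close>[of t x] TR R x e by auto
    next
      case 2
      then show ?thesis using T''(2)[of t x] t e by auto
    next
      case 3
      then show ?thesis using 2(3)[of t x] TR R x e K by auto
    qed
  qed
  then show ?thesis using R(1) T''(1) T' by (intro exI[of _ R] exI[of _ T''] conjI) auto
qed

lemma speeds_pos: "0 < spreading_speed d1 f1" "0 < spreading_speed d2 f2"
  using kpp_rate_pos[OF kpp1 K(1)] kpp_rate_pos[OF kpp2 K2_pos] pos by (auto simp: spreading_speed_def)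

lemma eventually_lower:
  assumes "0 < e"
  shows "\<exists>R0. \<forall>X. \<forall>\<^sub>F t in at_top. \<forall>x. \<bar>x\<bar> \<le> X \<longrightarrow> K1 - e < u t x \<and> (R0 \<le> x \<longrightarrow> K2 - e < u t x)"
proof -
  define b1 b2 where "b1 = spreading_speed d1 f1 / 2" and "b2 = spreading_speed d2 f2 / 2"
  have b: "0 < b1" "b1 < spreading_speed d1 f1" "0 < b2" "b2 < spreading_speed d2 f2"
    using speeds_pos by (auto simp: b1_def b2_def)
  obtain R T where R: "R > 0" "T \<ge> 0" "\<And>t x. t \<ge> T \<Longrightarrow> - b1 * t \<le> x \<and> x \<le> b2 * t \<Longrightarrow>
      K1 - e / 2 \<le> u t x \<and> (R \<le> x \<longrightarrow> K2 - e / 2 \<le> u t x)"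
    using u_lower[OF b half_gt_zero[OF assms]] by metis
  have "\<forall>\<^sub>F t in at_top. \<forall>x. \<bar>x\<bar> \<le> X \<longrightarrow> K1 - e < u t x \<and> (R \<le> x \<longrightarrow> K2 - e < u t x)" for X
    using eventually_ge_at_top[of "max T (max (X / b1) (X / b2))"]
  proof eventually_elim
    case (elim t)
    then have "X / b1 \<le> t" "X / b2 \<le> t" "T \<le> t" by auto
    then have "X \<le> b1 * t" "X \<le> b2 * t" using b by (simp_all add: pos_divide_le_eq mult.commute)
    then have "K1 - e / 2 \<le> u t x \<and> (R \<le> x \<longrightarrow> K2 - e / 2 \<le> u t x)" if "\<bar>x\<bar> \<le> X" for x
      using that \<open>T \<le> t\<close> by (intro R(3)) auto
    then show ?case using assms by force
  qed
  then show ?thesis by blast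
qed

lemma eventually_upper:
  assumes "0 < e"
  shows "\<forall>\<^sub>F t in at_top. \<forall>x. u t x < K2 + e"
proof -
  obtain T where T: "\<And>t x. t \<ge> T \<Longrightarrow> u t x \<le> K2 + e / 2" using u_upper[OF half_gt_zero[OF assms]] by auto
  have "u t x < K2 + e" if "T \<le> t" for t x using T[OF that, of x] assms by simp
  then show ?thesis unfolding eventually_at_top_linorder by blast
qed

lemma eventually_upper_left:
  assumes "0 < e"
  shows "\<exists>R0. \<forall>\<^sub>F t in at_top. \<forall>x\<le>-R0. u t x < K1 + e"
proof -
  obtain R T where T: "\<And>t x. t \<ge> T \<Longrightarrow> x \<le> - R \<Longrightarrow> u t x \<le> K1 + e / 2"
    using u_upper_left[OF half_gt_zero[OF assms]] by metis
  have "u t x < K1 + e" if "T \<le> t" "x \<le> - R" for t x using T[OF that] assms by simp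
  then show ?thesis unfolding eventually_at_top_linorder by blast
qed

end

section \<open>Sweeping with stationary supersolutions\<close>

lemma ex_antiderivative:
  fixes h :: "real \<Rightarrow> real"
  assumes "continuous_on UNIV h"
  obtains X where "\<And>v. (X has_real_derivative h v) (at v)"
proof -
  have "\<exists>F. \<forall>x :: real. - \<infinity> < ereal x \<longrightarrow> ereal x < \<infinity> \<longrightarrow> (F has_vector_derivative h x) (at x)"
    by (rule einterval_antiderivative) (use assms in \<open>auto simp: continuous_on_eq_continuous_at\<close>)
  then show ?thesis using that by (auto simp: has_real_derivative_iff_has_vector_derivative)
qed

lemma increment_bounds:
  fixes F :: "real \<Rightarrow> real"
  assumes "\<And>x. (F has_real_derivative F' x) (at x)" "a \<le> b"
    and "\<And>x. a < x \<Longrightarrow> x < b \<Longrightarrow> m \<le> F' x \<and> F' x \<le> m'"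
  shows "m * (b - a) \<le> F b - F a" "F b - F a \<le> m' * (b - a)"
proof -
  have "m * (b - a) \<le> F b - F a \<and> F b - F a \<le> m' * (b - a)"
  proof (cases "a = b")
    case False
    then have "\<exists>z>a. z < b \<and> F b - F a = (b - a) * F' z"
      by (intro MVT2) (use assms in auto)
    then obtain z where z: "a < z" "z < b" "F b - F a = F' z * (b - a)" by (auto simp: mult.commute)
    then show ?thesis using assms(2) assms(3)[of z] by (auto intro!: mult_right_mono)
  qed auto
  then show "m * (b - a) \<le> F b - F a" "F b - F a \<le> m' * (b - a)" by auto
qed

text \<open>The autonomous equation \<open>\<phi>' = g \<phi>\<close> is solved by inverting
\<open>X = \<integral> 1 / g\<close>. The function \<open>X\<close> is kept, because \<open>\<phi>
(x + X w)\<close> is the solution with value \<open>w\<close> at \<open>0\<close>.\<close>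

lemma quadrature:
  fixes g :: "real \<Rightarrow> real"
  assumes g: "continuous_on UNIV g" and m: "0 < m" "\<And>v. m \<le> g v \<and> g v \<le> m'"
  obtains X \<phi> where "\<And>v. (X has_real_derivative 1 / g v) (at v)" "\<And>v. \<phi> (X v) = v"
    "\<And>x. (\<phi> has_real_derivative g (\<phi> x)) (at x)"
proof -
  have gp: "0 < g v" for v using m(1) m(2)[of v] by linarith
  have mm: "m' > 0" using m(1) m(2)[of 0] by linarith
  obtain X where X: "\<And>v. (X has_real_derivative 1 / g v) (at v)"
    by (rule ex_antiderivative[of "\<lambda>v. 1 / g v"]) (use g gp in \<open>auto intro!: continuous_intros simp: less_imp_neq[symmetric]\<close>)
  have inc: "1 / m' * (b - a) \<le> X b - X a" if "a \<le> b" for a b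
    by (rule increment_bounds(1)[OF X that, where m' = "1 / m"]) (use m gp mm in \<open>auto intro!: frac_le\<close>)
  have mono: "X a < X b" if "a < b" for a b
  proof -
    have "0 < 1 / m' * (b - a)" using that mm by simp
    then show ?thesis using inc[of a b] that by linarith
  qed
  have Xc: "isCont X v" for v by (rule DERIV_isCont[OF X])
  have surj: "\<exists>v. X v = x" for x
  proof -
    define r where "r = m' * \<bar>x - X 0\<bar>"
    have r: "0 \<le> r" "1 / m' * r = \<bar>x - X 0\<bar>" using mm by (auto simp: r_def)
    have "X (- r) \<le> x" "x \<le> X r" using inc[of 0 r] inc[of "- r" 0] r by auto
    then show ?thesis using IVT[of X "- r" x r] Xc r by auto
  qed
  define \<phi> where "\<phi> = inv X"
  have "inj X" by (rule linorder_injI) (use mono in force)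
  then have phiX: "\<phi> (X v) = v" for v by (simp add: \<phi>_def)
  have Xphi: "X (\<phi> x) = x" for x unfolding \<phi>_def using surj[of x] by (metis f_inv_into_f rangeI)
  have "isCont \<phi> (X v)" for v
    by (rule isCont_inverse_function[of 1 v]) (auto simp: phiX Xc)
  then have pc: "isCont \<phi> x" for x using Xphi by metis
  have "(\<phi> has_real_derivative inverse (1 / g (\<phi> x))) (at x)" for x
    by (rule DERIV_inverse_function[where f = X and a = "x - 1" and b = "x + 1"])
       (use X Xphi pc gp[of "\<phi> x"] in auto)
  then show ?thesis using that[of X \<phi>] X phiX by auto
qed

lemma moving_profile_jet:
  assumes X: "\<And>v. (X has_real_derivative 1 / g v) (at v)"
    and phi: "\<And>x. (\<phi> has_real_derivative g (\<phi> x)) (at x)"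
    and w: "(w has_real_derivative w') (at s)"
    and D: "(g has_real_derivative D) (at (\<phi> (y + X (w s))))"
  shows "has_jet (\<lambda>s x. \<phi> (x + X (w s))) s y
    (g (\<phi> (y + X (w s))) * (1 / g (w s) * w')) (D * g (\<phi> (y + X (w s))))"
proof (rule has_jetI[where S = UNIV and v = "\<lambda>x. g (\<phi> (x + X (w s)))"])
  have dphi: "((\<lambda>x. \<phi> (x + X (w s))) has_real_derivative g (\<phi> (z + X (w s)))) (at z)" for z
    using phi[of "z + X (w s)"] by (simp add: DERIV_shift)
  then show "((\<lambda>x. \<phi> (x + X (w s))) has_real_derivative g (\<phi> (z + X (w s)))) (at z)" for z .
  show "((\<lambda>x. g (\<phi> (x + X (w s)))) has_real_derivative D * g (\<phi> (y + X (w s)))) (at y)"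
    by (rule DERIV_chain2[OF D dphi])
  have "((\<lambda>s. y + X (w s)) has_real_derivative 0 + 1 / g (w s) * w') (at s)"
    by (rule DERIV_add[OF DERIV_const DERIV_chain2[OF X w]])
  then have "((\<lambda>s. y + X (w s)) has_real_derivative 1 / g (w s) * w') (at s)" by simp
  from DERIV_chain2[OF phi this]
  show "((\<lambda>s. \<phi> (y + X (w s))) has_real_derivative g (\<phi> (y + X (w s))) * (1 / g (w s) * w')) (at s)" .
qed auto

text \<open>The profile with interface value \<open>w\<close> follows \<open>W' = g1 W\<close> to
the left and \<open>W' = g2 W\<close> to the right; its second derivative is \<open>g' *
g\<close>, so the two differential hypotheses say that it is a strict stationary supersolution at
the relevant values, and \<open>\<sigma> * g2 w < g1 w\<close> is the flux inequality. Strictness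
leaves room for moving \<open>w\<close> slowly. It starts so high that the profile exceeds
\<open>B\<close>, and ends at \<open>v\<close>. The smallness of \<open>g1\<close> on the values
between \<open>c\<close> and \<open>c'\<close> guarantees that the profiles stay above
\<open>c\<close> on \<open>{- R..0}\<close>.\<close>

lemma barrier_sweep:
  assumes u: "two_patch d1 d2 \<sigma> f1 f2 u" and pos: "0 < d1" "0 < d2" "0 < \<sigma>"
    and g1: "continuous_on UNIV g1" and g2: "continuous_on UNIV g2"
    and m: "0 < m" "\<And>v. m \<le> g1 v \<and> g1 v \<le> m'" "\<And>v. m \<le> g2 v \<and> g2 v \<le> m'"
    and val: "c < c'" "c' \<le> v" "v < B" and eps: "0 < \<epsilon>"
    and sup1: "\<And>w. c < w \<Longrightarrow> w < B \<Longrightarrow> \<exists>D. (g1 has_real_derivative D) (at w) \<and> d1 * (D * g1 w) + f1 w \<le> - \<epsilon>"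
    and sup2: "\<And>w. v \<le> w \<Longrightarrow> w < B \<Longrightarrow> \<exists>D. (g2 has_real_derivative D) (at w) \<and> d2 * (D * g2 w) + f2 w \<le> - \<epsilon>"
    and kink: "\<And>w. v \<le> w \<Longrightarrow> w < B \<Longrightarrow> \<sigma> * g2 w < g1 w"
    and R: "0 < R" "\<And>w. c \<le> w \<Longrightarrow> w \<le> c' \<Longrightarrow> g1 w \<le> (c' - c) / R"
    and S: "0 < S" "B \<le> v + m * S"
    and left: "\<forall>\<^sub>F t in at_top. u t (- R) < c"
    and high: "\<forall>\<^sub>F t in at_top. \<forall>x. - R \<le> x \<and> x \<le> S \<longrightarrow> u t x < B"
  obtains W where "continuous_on UNIV W" "W 0 = v"
    "\<forall>x<0. (W has_real_derivative g1 (W x)) (at x)"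
    "\<forall>x>0. (W has_real_derivative g2 (W x)) (at x)"
    "\<forall>\<^sub>F t in at_top. \<forall>x. - R \<le> x \<and> x \<le> S \<longrightarrow> u t x < W x"
proof -
  obtain X \<phi> where X: "\<And>v. (X has_real_derivative 1 / g1 v) (at v)" and phiX: "\<And>v. \<phi> (X v) = v"
    and phi: "\<And>x. (\<phi> has_real_derivative g1 (\<phi> x)) (at x)"
    using quadrature[OF g1 m(1,2)] by metis
  obtain Y \<psi> where Y: "\<And>v. (Y has_real_derivative 1 / g2 v) (at v)" and psiY: "\<And>v. \<psi> (Y v) = v"
    and psi: "\<And>x. (\<psi> has_real_derivative g2 (\<psi> x)) (at x)"
    using quadrature[OF g2 m(1,3)] by metis
  have g1p: "0 < g1 w" and g2p: "0 < g2 w" for w using m(1) m(2,3)[of w] by linarith+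
  have m': "0 < m'" using m(1) m(2)[of 0] by linarith
  have phiinc: "m * (b - a) \<le> \<phi> b - \<phi> a" "\<phi> b - \<phi> a \<le> m' * (b - a)" if "a \<le> b" for a b
    using increment_bounds[OF phi that, of m m'] m(2) by auto
  have psiinc: "m * (b - a) \<le> \<psi> b - \<psi> a" "\<psi> b - \<psi> a \<le> m' * (b - a)" if "a \<le> b" for a b
    using increment_bounds[OF psi that, of m m'] m(3) by auto
  have phimono: "\<phi> a \<le> \<phi> b" and psimono: "\<psi> a \<le> \<psi> b" if "a \<le> b" for a b
  proof -
    have "0 \<le> m * (b - a)" using that m by simp
    then show "\<phi> a \<le> \<phi> b" "\<psi> a \<le> \<psi> b" using phiinc(1)[OF that] psiinc(1)[OF that] by linarith+
  qed
  have Xmono: "X a \<le> X b" if "a \<le> b" for a b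
    using increment_bounds(1)[OF X that, of 0 "1 / m"] g1p m by (auto simp: less_imp_le frac_le)
  have Xlen: "X c' - X c \<ge> R"
  proof -
    have r: "0 < (c' - c) / R" using val R by simp
    have "1 / ((c' - c) / R) * (c' - c) \<le> X c' - X c"
      by (rule increment_bounds(1)[OF X, of _ _ _ "1 / m"])
         (use val R(2) m g1p r in \<open>auto intro!: frac_le simp del: divide_divide_eq_right\<close>)
    then show ?thesis using val by simp
  qed
  define W where "W = (\<lambda>w x. if x \<le> 0 then \<phi> (x + X w) else \<psi> (x + Y w))"
  have W0: "W w 0 = w" for w by (simp add: W_def phiX)
  have Wsum: "W w x = \<phi> (min x 0 + X w) + \<psi> (max x 0 + Y w) - w" for w x
    by (auto simp: W_def phiX psiY min_def max_def)
  have phic: "continuous_on UNIV \<phi>" and psic: "continuous_on UNIV \<psi>"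
    and Xc: "continuous_on UNIV X" and Yc: "continuous_on UNIV Y"
    using phi psi X Y by (meson DERIV_isCont continuous_at_imp_continuous_on)+
  have dphi: "((\<lambda>y. \<phi> (y + a)) has_real_derivative g1 (\<phi> (x + a))) (at x)" for x a
    using phi[of "x + a"] by (simp add: DERIV_shift)
  have dpsi: "((\<lambda>y. \<psi> (y + a)) has_real_derivative g2 (\<psi> (x + a))) (at x)" for x a
    using psi[of "x + a"] by (simp add: DERIV_shift)
  \<comment> \<open>with this interface value the profile still exceeds B at distance R to the left,
    its slope being at most m'\<close>
  define B0 where "B0 = B + m' * R"
  \<comment> \<open>the speed of the interface value; the induced time derivative of the profile is at
    most half of the gap\<close>
  define \<rho> where "\<rho> = \<epsilon> * m / (2 * m')"
  have rho: "0 < \<rho>" using eps m m' by (simp add: \<rho>_def)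
  define L where "L = (B0 - v) / \<rho>"
  have BB: "B \<le> B0" using m' R by (simp add: B0_def)
  have L: "0 \<le> L" "\<rho> * L = B0 - v" using rho val BB by (auto simp: L_def)
  obtain T where T: "T \<ge> 0" "\<And>t. t \<ge> T \<Longrightarrow> u t (- R) < c" "\<And>t x. t \<ge> T \<Longrightarrow> - R \<le> x \<Longrightarrow> x \<le> S \<Longrightarrow> u t x < B"
  proof -
    obtain T1 T2 where "\<And>t. t \<ge> T1 \<Longrightarrow> u t (- R) < c" "\<And>t x. t \<ge> T2 \<Longrightarrow> - R \<le> x \<Longrightarrow> x \<le> S \<Longrightarrow> u t x < B"
      using left high unfolding eventually_at_top_linorder by metis
    then show ?thesis using that[of "max 0 (max T1 T2)"] by auto
  qed
  have low: "c \<le> W w (- R)" if "v \<le> w" for w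
  proof -
    have "X c \<le> - R + X w" using Xmono[of c' w] Xlen val that by auto
    then have "\<phi> (X c) \<le> \<phi> (- R + X w)" by (rule phimono)
    then show ?thesis using R by (simp add: W_def phiX)
  qed
  have speed: "- (\<epsilon> / 2) \<le> a * (1 / b * - \<rho>)" if "m \<le> a" "a \<le> m'" "m \<le> b" for a b
  proof -
    have "a / b \<le> m' / m" using that m by (intro frac_le) auto
    then have "\<rho> * (a / b) \<le> \<rho> * (m' / m)" using rho by (intro mult_left_mono) auto
    also have "\<dots> = \<epsilon> / 2" using m m' by (simp add: \<rho>_def)
    finally have "\<rho> * (a / b) \<le> \<epsilon> / 2" .
    moreover have "a * (1 / b * - \<rho>) = - (\<rho> * (a / b))" by simp
    ultimately show ?thesis by linarith
  qed
  have below: "u t x < W v x" if t: "t \<ge> T + L" and x: "- R \<le> x" "x \<le> S" for t x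
  proof -
    \<comment> \<open>the interface value at time s; it reaches v exactly at the time t under
      consideration\<close>
    define w where "w = (\<lambda>s. v + \<rho> * (t - s))"
    have wd: "(w has_real_derivative - \<rho>) (at s)" for s
      unfolding w_def by (auto intro!: derivative_eq_intros)
    have wv: "v \<le> w s" if "s \<le> t" for s using that rho by (simp add: w_def)
    have wt: "w t = v" by (simp add: w_def)
    have w0: "w (t - L) = B0" using L by (simp add: w_def)
    have "u t x < (\<lambda>s x. W (w s) x) t x"
    proof (rule comparison_super[OF u pos, where ?T0.0 = "t - L" and ?T1.0 = t and a = "\<lambda>_. - R" and b = "\<lambda>_. S"
          and w = "\<lambda>s x. W (w s) x"])
      show "continuous_on ({t - L..t} \<times> UNIV) (\<lambda>(s, x). W (w s) x)"
        unfolding Wsum case_prod_unfold w_def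
        by (intro continuous_intros continuous_on_compose2[OF phic] continuous_on_compose2[OF psic]
            continuous_on_compose2[OF Xc] continuous_on_compose2[OF Yc]) auto
    next
      fix y assume y: "- R \<le> y" "y \<le> S"
      have "B \<le> W B0 y"
      proof (cases "y \<le> 0")
        case True
        have "\<phi> (X B0) - \<phi> (y + X B0) \<le> m' * (X B0 - (y + X B0))" using True by (intro phiinc) auto
        also have "\<dots> \<le> m' * R" using y m' by (intro mult_left_mono) auto
        finally show ?thesis using True by (simp add: W_def phiX B0_def)
      next
        case False
        then show ?thesis using psimono[of "Y B0" "y + Y B0"] BB by (simp add: W_def psiY)
      qed
      then show "u (t - L) y < W (w (t - L)) y" using T(3)[of "t - L" y] t y w0 by auto
    next
      fix s assume s: "t - L \<le> s" "s \<le> t"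
      show "u s (- R) < W (w s) (- R)" using low[OF wv[OF s(2)]] T(2)[of s] s t by auto
      have "m * (S + Y (w s) - Y (w s)) \<le> \<psi> (S + Y (w s)) - \<psi> (Y (w s))"
        using S by (intro psiinc) auto
      then have "B \<le> W (w s) S" using S wv[OF s(2)] by (simp add: W_def psiY)
      then show "u s S < W (w s) S" using T(3)[of s S] s t S R by auto
    next
      fix s y assume s: "t - L < s" "s \<le> t" and y: "- R < y" "y < S" "y < 0" and touch: "W (w s) y = u s y"
      define z where "z = \<phi> (y + X (w s))"
      have z: "W (w s) y = z" using y by (simp add: W_def z_def)
      have "z < B" using touch T(3)[of s y] s y t z by auto
      moreover have "c < z"
      proof -
        have "\<phi> (- R + X (w s)) + m * (y + R) \<le> z" unfolding z_def using phiinc(1)[of "- R + X (w s)" "y + X (w s)"] y by simp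
        moreover have "0 < m * (y + R)" using m y by simp
        moreover have "c \<le> \<phi> (- R + X (w s))" using low[OF wv[OF s(2)]] R by (simp add: W_def)
        ultimately show ?thesis by linarith
      qed
      ultimately obtain D where D: "(g1 has_real_derivative D) (at z)" "d1 * (D * g1 z) + f1 z \<le> - \<epsilon>"
        using sup1 by auto
      have "has_jet (\<lambda>s x. \<phi> (x + X (w s))) s y (g1 z * (1 / g1 (w s) * - \<rho>)) (D * g1 z)"
        unfolding z_def by (rule moving_profile_jet[OF X phi wd D(1)[unfolded z_def]])
      then have "has_jet (\<lambda>s x. W (w s) x) s y (g1 z * (1 / g1 (w s) * - \<rho>)) (D * g1 z)"
        by (rule has_jet_transform[where S = "{..<0}"]) (use y in \<open>auto simp: W_def\<close>)
      moreover have "d1 * (D * g1 z) + f1 (W (w s) y) < g1 z * (1 / g1 (w s) * - \<rho>)"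
        using speed[of "g1 z" "g1 (w s)"] D(2) eps z m by fastforce
      ultimately show "\<exists>\<alpha> \<beta>. has_jet (\<lambda>s x. W (w s) x) s y \<alpha> \<beta> \<and> d1 * \<beta> + f1 (W (w s) y) < \<alpha>"
        by blast
    next
      fix s y assume s: "t - L < s" "s \<le> t" and y: "- R < y" "y < S" "0 < y" and touch: "W (w s) y = u s y"
      define z where "z = \<psi> (y + Y (w s))"
      have z: "W (w s) y = z" using y by (simp add: W_def z_def)
      have "z < B" using touch T(3)[of s y] s y t z by auto
      moreover have "v \<le> z"
        using psimono[of "Y (w s)" "y + Y (w s)"] y wv[OF s(2)] by (simp add: psiY z_def)
      ultimately obtain D where D: "(g2 has_real_derivative D) (at z)" "d2 * (D * g2 z) + f2 z \<le> - \<epsilon>"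
        using sup2 by auto
      have "has_jet (\<lambda>s x. \<psi> (x + Y (w s))) s y (g2 z * (1 / g2 (w s) * - \<rho>)) (D * g2 z)"
        unfolding z_def by (rule moving_profile_jet[OF Y psi wd D(1)[unfolded z_def]])
      then have "has_jet (\<lambda>s x. W (w s) x) s y (g2 z * (1 / g2 (w s) * - \<rho>)) (D * g2 z)"
        by (rule has_jet_transform[where S = "{0<..}"]) (use y in \<open>auto simp: W_def\<close>)
      moreover have "d2 * (D * g2 z) + f2 (W (w s) y) < g2 z * (1 / g2 (w s) * - \<rho>)"
        using speed[of "g2 z" "g2 (w s)"] D(2) eps z m by fastforce
      ultimately show "\<exists>\<alpha> \<beta>. has_jet (\<lambda>s x. W (w s) x) s y \<alpha> \<beta> \<and> d2 * \<beta> + f2 (W (w s) y) < \<alpha>"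
        by blast
    next
      fix s assume s: "t - L < s" "s \<le> t" and touch: "W (w s) 0 = u s 0"
      have "w s < B" using touch W0 T(3)[of s 0] s t R S by auto
      then have "\<sigma> * g2 (w s) < g1 (w s)" using kink[of "w s"] wv[OF s(2)] by auto
      moreover have "(W (w s) has_real_derivative g1 (w s)) (at_left 0)"
        by (rule has_derivative_at_leftI[where g = "\<lambda>y. \<phi> (y + X (w s))"])
           (use dphi[of "X (w s)" 0] in \<open>auto simp: W_def phiX\<close>)
      moreover have "(W (w s) has_real_derivative g2 (w s)) (at_right 0)"
        by (rule has_derivative_at_rightI[where g = "\<lambda>y. \<psi> (y + Y (w s))"])
           (use dpsi[of "Y (w s)" 0] in \<open>auto simp: W_def phiX psiY\<close>)
      ultimately show "\<exists>p q. (W (w s) has_real_derivative p) (at_left 0) \<and>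
          (W (w s) has_real_derivative q) (at_right 0) \<and> \<sigma> * q < p" by blast
    qed (use x t T L in auto)
    then show ?thesis by (simp add: wt)
  qed
  show ?thesis
  proof (rule that[of "W v"])
    show "continuous_on UNIV (W v)"
      unfolding Wsum by (intro continuous_intros continuous_on_compose2[OF phic] continuous_on_compose2[OF psic]) auto
    show "W v 0 = v" by (rule W0)
    have "(W v has_real_derivative g1 (W v x)) (at x)" if "x < 0" for x
      by (rule has_field_derivative_transform_within_open[where S = "{..<0}" and f = "\<lambda>y. \<phi> (y + X v)"])
         (use that dphi[of "X v" x] in \<open>auto simp: W_def\<close>)
    then show "\<forall>x<0. (W v has_real_derivative g1 (W v x)) (at x)" by blast
    have "(W v has_real_derivative g2 (W v x)) (at x)" if "0 < x" for x
      by (rule has_field_derivative_transform_within_open[where S = "{0<..}" and f = "\<lambda>y. \<psi> (y + Y v)"])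
         (use that dpsi[of "Y v" x] in \<open>auto simp: W_def\<close>)
    then show "\<forall>x>0. (W v has_real_derivative g2 (W v x)) (at x)" by blast
    show "\<forall>\<^sub>F t in at_top. \<forall>x. - R \<le> x \<and> x \<le> S \<longrightarrow> u t x < W v x"
      unfolding eventually_at_top_linorder using below by (intro exI[of _ "T + L"]) auto
  qed
qed

section \<open>Squeezing towards a front profile\<close>

text \<open>From a point where the bound fails, \<open>h\<close> would not decrease up to the first
later point where the bound holds.\<close>

lemma bound_propagates_left:
  fixes h :: "real \<Rightarrow> real"
  assumes ab: "a \<le> b" and c: "continuous_on {a..b} h" and b: "h b \<le> \<theta>"
    and D: "\<And>x. a < x \<Longrightarrow> x < b \<Longrightarrow> \<theta> < h x \<Longrightarrow> \<exists>D. (h has_real_derivative D) (at x) \<and> 0 \<le> D"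
  shows "h a \<le> \<theta>"
proof (rule ccontr)
  assume na: "\<not> h a \<le> \<theta>"
  define Z where "Z = {x \<in> {a..b}. h x \<le> \<theta>}"
  have "closed Z" unfolding Z_def
    by (intro continuous_on_closed_Collect_le c continuous_intros)
  then have "compact Z" using compact_Int_closed[of "{a..b}" Z] by (simp add: Z_def Int_def inf.absorb_iff2 conj_ac)
  moreover have "b \<in> Z" using ab b by (simp add: Z_def)
  ultimately obtain y where y: "y \<in> Z" "\<And>x. x \<in> Z \<Longrightarrow> y \<le> x"
    using compact_attains_inf[of Z] by blast
  have "h a \<le> h y"
  proof (rule DERIV_nonneg_imp_increasing_open[where f = h])
    show "a \<le> y" using y by (simp add: Z_def)
    show "continuous_on {a..y} h" by (rule continuous_on_subset[OF c]) (use y in \<open>auto simp: Z_def\<close>)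
    fix x assume x: "a < x" "x < y"
    then have "x \<notin> Z" using y(2)[of x] by auto
    then have "\<theta> < h x" using x y by (auto simp: Z_def)
    then show "\<exists>D. (h has_real_derivative D) (at x) \<and> 0 \<le> D"
      using D x y by (auto simp: Z_def)
  qed
  then show False using na y by (simp add: Z_def)
qed

lemma bound_propagates_right:
  fixes h :: "real \<Rightarrow> real"
  assumes ab: "a \<le> b" and c: "continuous_on {a..b} h" and a: "h a \<le> \<theta>"
    and D: "\<And>x. a < x \<Longrightarrow> x < b \<Longrightarrow> \<theta> < h x \<Longrightarrow> \<exists>D. (h has_real_derivative D) (at x) \<and> D \<le> 0"
  shows "h b \<le> \<theta>"
proof -
  have "h (- (- b)) \<le> \<theta>"
  proof (rule bound_propagates_left[where b = "- a" and h = "\<lambda>x. h (- x)"])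
    show "continuous_on {- b..- a} (\<lambda>x. h (- x))"
      by (rule continuous_on_compose2[OF c]) (auto intro!: continuous_intros)
    fix x assume x: "- b < x" "x < - a" "\<theta> < h (- x)"
    then obtain D where "(h has_real_derivative D) (at (- x))" "D \<le> 0" using D[of "- x"] by auto
    then show "\<exists>D. ((\<lambda>x. h (- x)) has_real_derivative D) (at x) \<and> 0 \<le> D"
      by (intro exI[of _ "- D"]) (simp add: DERIV_mirror)
  qed (use ab a in auto)
  then show ?thesis by simp
qed

text \<open>Clamping the argument extends a positive slope function from an interval to the whole
line with bounds above and below, as the quadrature needs.\<close>

lemma clamp_bounds:
  fixes G :: "real \<Rightarrow> real"
  assumes "a \<le> b" "continuous_on UNIV G" "\<And>v. a \<le> v \<Longrightarrow> v \<le> b \<Longrightarrow> 0 < G v"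
  obtains m m' where "0 < m" "\<And>v. m \<le> G (max a (min b v))" "\<And>v. G (max a (min b v)) \<le> m'"
proof -
  have c: "continuous_on {a..b} G" using assms(2) by (rule continuous_on_subset) auto
  obtain x where x: "x \<in> {a..b}" "\<And>s. s \<in> {a..b} \<Longrightarrow> G x \<le> G s"
    using continuous_attains_inf[of "{a..b}" G] c assms(1) by auto
  obtain y where y: "y \<in> {a..b}" "\<And>s. s \<in> {a..b} \<Longrightarrow> G s \<le> G y"
    using continuous_attains_sup[of "{a..b}" G] c assms(1) by auto
  have "max a (min b v) \<in> {a..b}" for v using assms(1) by auto
  then show ?thesis using that[of "G x" "G y"] x y assms(3)[of x] by auto
qed

text \<open>A smooth version of \<open>max 0 s\<close>. Its derivative is strictly below
\<open>1\<close>, and this gap is what makes the perturbed profile a strict supersolution.\<close>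

definition softplus :: "real \<Rightarrow> real \<Rightarrow> real" where
  "softplus \<kappa> s = (s + sqrt (s\<^sup>2 + \<kappa>\<^sup>2)) / 2"

lemma softplus_properties:
  assumes "0 < \<kappa>"
  shows "0 < softplus \<kappa> s" "s \<le> softplus \<kappa> s" "s \<le> 0 \<Longrightarrow> softplus \<kappa> s \<le> \<kappa> / 2"
    "(softplus \<kappa> has_real_derivative (1 + s / sqrt (s\<^sup>2 + \<kappa>\<^sup>2)) / 2) (at s)"
    "s / sqrt (s\<^sup>2 + \<kappa>\<^sup>2) < 1"
proof -
  have p: "0 < s\<^sup>2 + \<kappa>\<^sup>2" using assms by (simp add: add_nonneg_pos)
  have gt: "\<bar>s\<bar> < sqrt (s\<^sup>2 + \<kappa>\<^sup>2)" using assms by (intro real_less_rsqrt) auto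
  then show "0 < softplus \<kappa> s" "s \<le> softplus \<kappa> s" by (auto simp: softplus_def)
  have "0 < sqrt (s\<^sup>2 + \<kappa>\<^sup>2)" "s < sqrt (s\<^sup>2 + \<kappa>\<^sup>2)" using gt p by auto
  then show "s / sqrt (s\<^sup>2 + \<kappa>\<^sup>2) < 1" by (metis divide_less_eq_1_pos)
  show "softplus \<kappa> s \<le> \<kappa> / 2" if "s \<le> 0"
  proof -
    have "sqrt (s\<^sup>2 + \<kappa>\<^sup>2) \<le> \<kappa> - s"
      using assms that by (intro real_le_lsqrt) (auto simp: power2_diff mult_nonneg_nonpos)
    then show ?thesis by (simp add: softplus_def)
  qed
  show "(softplus \<kappa> has_real_derivative (1 + s / sqrt (s\<^sup>2 + \<kappa>\<^sup>2)) / 2) (at s)"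
    unfolding softplus_def[abs_def] using p by (auto intro!: derivative_eq_intros simp: field_simps)
qed

lemma sqrt_le_sqrt_add:
  assumes "a \<le> b + e" "0 \<le> b" "0 \<le> e"
  shows "sqrt a \<le> sqrt b + sqrt e"
  using sqrt_add_le_add_sqrt[OF assms(2,3)] real_sqrt_le_mono[OF assms(1)] by linarith

text \<open>The first order description of the stationary solution. All assumptions, in particular
the signs of both reactions on both sides of the capacities, are stated so that they are invariant
under the reflection \<open>V x \<mapsto> K1 + K2 - V (- x)\<close>.\<close>

locale front_profile =
  fixes d1 d2 \<sigma> K1 K2 \<delta> :: real and f1 f2 \<Phi>1 \<Phi>2 V :: "real \<Rightarrow> real"
  assumes pos: "0 < d1" "0 < d2" "0 < \<sigma>" and K: "K1 < K2" and delta: "0 < \<delta>"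
    and f1c: "continuous_on UNIV f1" and f2c: "continuous_on UNIV f2"
    and Phi1: "\<And>s. (\<Phi>1 has_real_derivative - f1 s) (at s)" "\<Phi>1 K1 = 0"
    and Phi2: "\<And>s. (\<Phi>2 has_real_derivative - f2 s) (at s)" "\<Phi>2 K2 = 0"
    and f1_neg: "\<And>s. K1 < s \<Longrightarrow> s \<le> K2 + \<delta> \<Longrightarrow> f1 s < 0"
    and f1_pos: "\<And>s. K1 - \<delta> \<le> s \<Longrightarrow> s < K1 \<Longrightarrow> 0 < f1 s"
    and f2_neg: "\<And>s. K2 < s \<Longrightarrow> s \<le> K2 + \<delta> \<Longrightarrow> f2 s < 0"
    and f2_pos: "\<And>s. K1 - \<delta> \<le> s \<Longrightarrow> s < K2 \<Longrightarrow> 0 < f2 s"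
    and Vc: "continuous_on UNIV V" and Vr: "\<And>x. K1 \<le> V x" "\<And>x. V x \<le> K2"
    and V1: "\<And>x. x < 0 \<Longrightarrow> (V has_real_derivative sqrt (2 * \<Phi>1 (V x) / d1)) (at x)"
    and V2: "\<And>x. 0 < x \<Longrightarrow> (V has_real_derivative sqrt (2 * \<Phi>2 (V x) / d2)) (at x)"
    and flux: "d2 * \<Phi>1 (V 0) = \<sigma>\<^sup>2 * d1 * \<Phi>2 (V 0)"
begin

lemma mirror:
  "front_profile d2 d1 (1 / \<sigma>) K1 K2 \<delta> (\<lambda>s. - f2 (K1 + K2 - s)) (\<lambda>s. - f1 (K1 + K2 - s))
     (\<lambda>s. \<Phi>2 (K1 + K2 - s)) (\<lambda>s. \<Phi>1 (K1 + K2 - s)) (\<lambda>x. K1 + K2 - V (- x))"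
proof
  show "continuous_on UNIV (\<lambda>s. - f2 (K1 + K2 - s))" "continuous_on UNIV (\<lambda>s. - f1 (K1 + K2 - s))"
    by (intro continuous_intros continuous_on_compose2[OF f1c] continuous_on_compose2[OF f2c]; simp)+
  show "continuous_on UNIV (\<lambda>x. K1 + K2 - V (- x))"
    by (intro continuous_intros continuous_on_compose2[OF Vc]) simp
  have d: "((\<lambda>s. K1 + K2 - s) has_real_derivative - 1) (at s)" for s
    by (auto intro!: derivative_eq_intros)
  show "((\<lambda>s. \<Phi>2 (K1 + K2 - s)) has_real_derivative - (- f2 (K1 + K2 - s))) (at s)" for s
    using DERIV_chain2[OF Phi2(1) d, of s] by simp
  show "((\<lambda>s. \<Phi>1 (K1 + K2 - s)) has_real_derivative - (- f1 (K1 + K2 - s))) (at s)" for s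
    using DERIV_chain2[OF Phi1(1) d, of s] by simp
  show "((\<lambda>x. K1 + K2 - V (- x)) has_real_derivative sqrt (2 * \<Phi>2 (K1 + K2 - (K1 + K2 - V (- x))) / d2)) (at x)"
    if "x < 0" for x
    using DERIV_diff[OF DERIV_const[of "K1 + K2"] DERIV_chain2[OF V2 DERIV_minus[OF DERIV_ident]], of x] that by simp
  show "((\<lambda>x. K1 + K2 - V (- x)) has_real_derivative sqrt (2 * \<Phi>1 (K1 + K2 - (K1 + K2 - V (- x))) / d1)) (at x)"
    if "0 < x" for x
    using DERIV_diff[OF DERIV_const[of "K1 + K2"] DERIV_chain2[OF V1 DERIV_minus[OF DERIV_ident]], of x] that by simp
  show "d1 * \<Phi>2 (K1 + K2 - (K1 + K2 - V (- 0))) = (1 / \<sigma>)\<^sup>2 * d2 * \<Phi>1 (K1 + K2 - (K1 + K2 - V (- 0)))"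
    using flux pos by (simp add: field_simps)
qed (use pos K delta Phi1 Phi2 f1_neg f1_pos f2_neg f2_pos Vr in auto)

lemma Phi1_less:
  assumes "K1 \<le> a" "a < b" "b \<le> K2 + \<delta>" shows "\<Phi>1 a < \<Phi>1 b"
proof (rule DERIV_pos_imp_increasing_open[where f = \<Phi>1, OF assms(2)])
  show "continuous_on {a..b} \<Phi>1" using Phi1(1) by (meson DERIV_isCont continuous_at_imp_continuous_on)
  show "\<exists>y. (\<Phi>1 has_real_derivative y) (at x) \<and> 0 < y" if "a < x" "x < b" for x
    using Phi1(1)[of x] f1_neg[of x] assms that by (intro exI[of _ "- f1 x"]) auto
qed

lemma Phi2_less:
  assumes "K1 \<le> a" "a < b" "b \<le> K2" shows "\<Phi>2 b < \<Phi>2 a"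
proof (rule DERIV_neg_imp_decreasing_open[where f = \<Phi>2, OF assms(2)])
  show "continuous_on {a..b} \<Phi>2" using Phi2(1) by (meson DERIV_isCont continuous_at_imp_continuous_on)
  show "\<exists>y. (\<Phi>2 has_real_derivative y) (at x) \<and> y < 0" if "a < x" "x < b" for x
    using Phi2(1)[of x] f2_pos[of x] assms that delta by (intro exI[of _ "- f2 x"]) auto
qed

lemma Phi2_less':
  assumes "K2 \<le> a" "a < b" "b \<le> K2 + \<delta>" shows "\<Phi>2 a < \<Phi>2 b"
proof (rule DERIV_pos_imp_increasing_open[where f = \<Phi>2, OF assms(2)])
  show "continuous_on {a..b} \<Phi>2" using Phi2(1) by (meson DERIV_isCont continuous_at_imp_continuous_on)
  show "\<exists>y. (\<Phi>2 has_real_derivative y) (at x) \<and> 0 < y" if "a < x" "x < b" for x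
    using Phi2(1)[of x] f2_neg[of x] assms that by (intro exI[of _ "- f2 x"]) auto
qed

lemma Phi2_nonneg: "K1 \<le> s \<Longrightarrow> s \<le> K2 + \<delta> \<Longrightarrow> 0 \<le> \<Phi>2 s"
  using Phi2_less[of s K2] Phi2_less'[of K2 s] Phi2(2) by (cases s K2 rule: linorder_cases) auto

text \<open>The interface value lies strictly between the capacities, as otherwise one of the two
energies would vanish there and the other one would not, against the flux relation.\<close>

lemma V0: "K1 < V 0" "V 0 < K2"
proof -
  have "V 0 \<noteq> K1"
  proof
    assume "V 0 = K1"
    then have "\<sigma>\<^sup>2 * d1 * \<Phi>2 K1 = 0" using flux Phi1 by simp
    then show False using Phi2_less[of K1 K2] K Phi2 pos by simp
  qed
  moreover have "V 0 \<noteq> K2"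
  proof
    assume "V 0 = K2"
    then have "d2 * \<Phi>1 K2 = 0" using flux Phi2 by simp
    then show False using Phi1_less[of K1 K2] K Phi1 pos delta by simp
  qed
  ultimately show "K1 < V 0" "V 0 < K2" using Vr[of 0] by auto
qed

text \<open>The perturbed energies are \<open>G1 = softplus (\<Phi>1 - \<Phi>1 c')\<close> and
\<open>G2 = \<Phi>2 + e * (B + 1 - w)\<close>. The first one is at least \<open>\<Phi>1 - \<Phi>1
c'\<close> and almost zero between \<open>c\<close> and \<open>c'\<close>, which gives the profile
a plateau just above \<open>K1\<close> that is as long as desired. This plateau has to reach the
place \<open>- R\<close> where the solution is known to be below \<open>c\<close>, and
\<open>R\<close> depends on \<open>c\<close>. The tolerance \<open>\<tau>\<close> is chosen first;
it bounds the loss \<open>\<Phi>1 c'\<close> in the first energy and the gain in the second one,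
so that the flux inequality survives for \<open>w \<ge> v > V 0\<close> and the final profile
exceeds \<open>V\<close> by at most \<open>\<eta>\<close>. The thresholds \<open>B\<close> and
\<open>c'\<close>, then \<open>R\<close>, and finally the parameter \<open>\<kappa>\<close> of the
plateau follow.\<close>

lemma eventually_below:
  assumes u: "two_patch d1 d2 \<sigma> f1 f2 u"
    and high: "\<And>e R. 0 < e \<Longrightarrow> \<forall>\<^sub>F t in at_top. \<forall>x. \<bar>x\<bar> \<le> R \<longrightarrow> u t x < K2 + e"
    and left: "\<And>e. 0 < e \<Longrightarrow> \<exists>R0. \<forall>R\<ge>R0. \<forall>\<^sub>F t in at_top. u t (- R) < K1 + e"
    and X: "0 < X" and eta: "0 < \<eta>"
  shows "\<forall>\<^sub>F t in at_top. \<forall>x. \<bar>x\<bar> \<le> X \<longrightarrow> u t x < V x + \<eta>"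
proof -
  define \<eta>' where "\<eta>' = min (\<eta> / 2) ((K2 - V 0) / 2)"
  define v where "v = V 0 + \<eta>'"
  have e': "0 < \<eta>'" "\<eta>' \<le> \<eta> / 2" "v < K2" "V 0 < v" using eta V0 by (auto simp: \<eta>'_def v_def min_def field_simps)
  define \<Delta> where "\<Delta> = d2 * (\<Phi>1 v - \<Phi>1 (V 0))"
  have Delta: "0 < \<Delta>" using Phi1_less[of "V 0" v] V0 e' delta pos by (simp add: \<Delta>_def)
  define \<tau> where "\<tau> = min (\<Delta> / (2 * (d2 + \<sigma>\<^sup>2 * d1))) (min (d1 * (\<eta> / (2 * X))\<^sup>2 / 2) (d2 * (\<eta> / (2 * X))\<^sup>2 / 2))"
  have den: "0 < d2 + \<sigma>\<^sup>2 * d1" using pos by (simp add: add_pos_nonneg)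
  have "0 < (\<eta> / (2 * X))\<^sup>2" using eta X by simp
  then have tau0: "0 < \<tau>" unfolding \<tau>_def using Delta den pos by simp
  have tauD: "(d2 + \<sigma>\<^sup>2 * d1) * \<tau> < \<Delta>"
  proof -
    have "\<tau> \<le> \<Delta> / (2 * (d2 + \<sigma>\<^sup>2 * d1))" by (simp add: \<tau>_def)
    then have "(d2 + \<sigma>\<^sup>2 * d1) * \<tau> \<le> (d2 + \<sigma>\<^sup>2 * d1) * (\<Delta> / (2 * (d2 + \<sigma>\<^sup>2 * d1)))"
      using den by (intro mult_left_mono) auto
    also have "\<dots> = \<Delta> / 2" using den by (simp add: divide_simps)
    finally show ?thesis using Delta by simp
  qed
  have tau_sqrt: "sqrt (2 * \<tau> / d) * X \<le> \<eta> / 2" if "0 < d" "\<tau> \<le> d * (\<eta> / (2 * X))\<^sup>2 / 2" for d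
  proof -
    have "sqrt (2 * \<tau> / d) \<le> \<eta> / (2 * X)"
      using that eta X by (intro real_le_lsqrt) (auto simp: pos_divide_le_eq mult.commute)
    then have "sqrt (2 * \<tau> / d) * X \<le> \<eta> / (2 * X) * X" using X by (intro mult_right_mono) auto
    then show ?thesis using X by simp
  qed
  define s1 where "s1 = sqrt (2 * \<tau> / d1)"
  define s2 where "s2 = sqrt (2 * \<tau> / d2)"
  have "\<tau> \<le> d1 * (\<eta> / (2 * X))\<^sup>2 / 2" "\<tau> \<le> d2 * (\<eta> / (2 * X))\<^sup>2 / 2" unfolding \<tau>_def by linarith+
  then have s1: "0 \<le> s1" "s1 * X \<le> \<eta> / 2" and s2: "0 \<le> s2" "s2 * X \<le> \<eta> / 2"
    using tau_sqrt[OF pos(1)] tau_sqrt[OF pos(2)] pos tau0 unfolding s1_def s2_def by simp_all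
  have P2v0: "0 < \<Phi>2 (V 0)" using Phi2_less[of "V 0" K2] V0 Phi2 by simp
  have "\<forall>\<^sub>F s in at_right K2. \<Phi>2 s < min (\<tau> / 2) (\<Phi>2 (V 0))"
    by (rule order_tendstoD[where y = "\<Phi>2 K2"])
       (use DERIV_isCont[OF Phi2(1), of K2] tau0 P2v0 Phi2 in \<open>auto simp: isCont_def intro: tendsto_within_subset\<close>)
  then obtain b where b: "K2 < b" "\<And>s. K2 < s \<Longrightarrow> s < b \<Longrightarrow> \<Phi>2 s < min (\<tau> / 2) (\<Phi>2 (V 0))"
    unfolding eventually_at_right_field by auto
  define B where "B = min (K2 + \<delta>) ((K2 + b) / 2)"
  have B: "K2 < B" "B \<le> K2 + \<delta>" "\<Phi>2 B < \<tau> / 2" "\<Phi>2 B < \<Phi>2 (V 0)"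
  proof -
    have B': "K2 < B" "B < b" "B \<le> K2 + \<delta>" using b(1) delta by (auto simp: B_def min_def)
    then show "K2 < B" "B \<le> K2 + \<delta>" "\<Phi>2 B < \<tau> / 2" "\<Phi>2 B < \<Phi>2 (V 0)"
      using b(2)[OF B'(1,2)] by auto
  qed
  define e where "e = \<tau> / 2 / (B + 1 - V 0)"
  have BV: "0 < B + 1 - V 0" using B V0 by simp
  have e0: "0 < e" "e * (B + 1 - V 0) = \<tau> / 2" 
    using tau0 BV unfolding e_def by (simp, metis less_irrefl nonzero_divide_eq_eq)
  have "\<forall>\<^sub>F s in at_right K1. \<Phi>1 s < \<tau>"
    by (rule order_tendstoD[where y = "\<Phi>1 K1"])
       (use DERIV_isCont[OF Phi1(1), of K1] tau0 Phi1 in \<open>auto simp: isCont_def intro: tendsto_within_subset\<close>)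
  then obtain b1 where b1: "K1 < b1" "\<And>s. K1 < s \<Longrightarrow> s < b1 \<Longrightarrow> \<Phi>1 s < \<tau>"
    unfolding eventually_at_right_field by auto
  define c' where "c' = min (V 0) ((K1 + b1) / 2)"
  have c': "K1 < c'" "c' \<le> V 0" "\<Phi>1 c' < \<tau>" 
  proof -
    have c1: "K1 < c'" "c' < b1" "c' \<le> V 0" using b1(1) V0 by (auto simp: c'_def min_def)
    then show "K1 < c'" "c' \<le> V 0" "\<Phi>1 c' < \<tau>" using b1(2)[OF c1(1,2)] by auto
  qed
  define c where "c = (K1 + c') / 2"
  have c: "K1 < c" "c < c'" using c' by (auto simp: c_def)
  obtain R0 where R0: "\<And>R. R \<ge> R0 \<Longrightarrow> \<forall>\<^sub>F t in at_top. u t (- R) < K1 + (c - K1)"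
    using left[of "c - K1"] c by auto
  define R where "R = max X R0"
  have R: "0 < R" "X \<le> R" "\<forall>\<^sub>F t in at_top. u t (- R) < c" using R0[of R] X by (auto simp: R_def)
  \<comment> \<open>this makes the slope on the plateau at most (c' - c) / R\<close>
  define \<kappa> where "\<kappa> = d1 * ((c' - c) / R)\<^sup>2"
  have "0 < ((c' - c) / R)\<^sup>2" using c R by simp
  then have kp: "0 < \<kappa>" using pos by (simp add: \<kappa>_def)
  define G1 where "G1 = (\<lambda>w. softplus \<kappa> (\<Phi>1 w - \<Phi>1 c'))"
  define G2 where "G2 = (\<lambda>w. \<Phi>2 w + e * (B + 1 - w))"
  have P1c: "continuous_on S \<Phi>1" and P2c: "continuous_on S \<Phi>2" for S
    using Phi1(1) Phi2(1) by (meson DERIV_isCont continuous_at_imp_continuous_on)+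
  have G1d: "(G1 has_real_derivative (1 + (\<Phi>1 w - \<Phi>1 c') / sqrt ((\<Phi>1 w - \<Phi>1 c')\<^sup>2 + \<kappa>\<^sup>2)) / 2 * - f1 w) (at w)" for w
  proof -
    have "((\<lambda>w. \<Phi>1 w - \<Phi>1 c') has_real_derivative - f1 w) (at w)"
      using DERIV_diff[OF Phi1(1) DERIV_const] by simp
    then show ?thesis unfolding G1_def by (rule DERIV_chain2[OF softplus_properties(4)[OF kp]])
  qed
  have G2d: "(G2 has_real_derivative - f2 w - e) (at w)" for w
    unfolding G2_def using Phi2(1)[of w] by (auto intro!: derivative_eq_intros)
  have G1c: "continuous_on UNIV G1" and G2c: "continuous_on UNIV G2"
    using G1d G2d by (meson DERIV_isCont continuous_at_imp_continuous_on)+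
  have G1p: "0 < G1 w" for w using softplus_properties(1)[OF kp] by (simp add: G1_def)
  have G2p: "0 < G2 w" if "V 0 \<le> w" "w \<le> B" for w
  proof -
    have "0 \<le> \<Phi>2 w" using Phi2_nonneg[of w] that V0 B by simp
    moreover have "0 < e * (B + 1 - w)" using e0 that by simp
    ultimately show ?thesis by (simp add: G2_def)
  qed
  define q1 where "q1 = (\<lambda>w. sqrt (2 * G1 w / d1))"
  define q2 where "q2 = (\<lambda>w. sqrt (2 * G2 w / d2))"
  have q1c: "continuous_on UNIV q1" and q2c: "continuous_on UNIV q2"
    unfolding q1_def q2_def by (intro continuous_intros G1c G2c; use pos in simp)+
  have q1p: "0 < q1 w" for w using G1p pos by (simp add: q1_def)
  have q2p: "0 < q2 w" if "V 0 \<le> w" "w \<le> B" for w using G2p[OF that] pos by (simp add: q2_def)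
  have cB: "c \<le> B" "V 0 \<le> B" using c c' V0 B by auto
  obtain m1 m1' where m1: "0 < m1" "\<And>w. m1 \<le> q1 (max c (min B w))" "\<And>w. q1 (max c (min B w)) \<le> m1'"
    using clamp_bounds[OF cB(1) q1c q1p] by metis
  obtain m2 m2' where m2: "0 < m2" "\<And>w. m2 \<le> q2 (max (V 0) (min B w))" "\<And>w. q2 (max (V 0) (min B w)) \<le> m2'"
    using clamp_bounds[OF cB(2) q2c q2p] by metis
  define m where "m = min m1 m2"
  define m' where "m' = max m1' m2'"
  define g1 where "g1 = (\<lambda>w. q1 (max c (min B w)))"
  define g2 where "g2 = (\<lambda>w. q2 (max (V 0) (min B w)))"
  have gc: "continuous_on UNIV g1" "continuous_on UNIV g2" unfolding g1_def g2_def
    by (intro continuous_on_compose2[OF q1c] continuous_on_compose2[OF q2c] continuous_intros; simp)+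
  have mm: "0 < m" "\<And>w. m \<le> g1 w \<and> g1 w \<le> m'" "\<And>w. m \<le> g2 w \<and> g2 w \<le> m'"
    using m1 m2 by (auto simp: m_def m'_def g1_def g2_def le_max_iff_disj min_le_iff_disj)
  \<comment> \<open>the amount by which the profile on the left is a strict supersolution\<close>
  define h where "h = (\<lambda>w. - f1 w * (1 - (\<Phi>1 w - \<Phi>1 c') / sqrt ((\<Phi>1 w - \<Phi>1 c')\<^sup>2 + \<kappa>\<^sup>2)) / 2)"
  have "continuous_on {c..B} h"
    unfolding h_def using kp
    by (intro continuous_intros continuous_on_subset[OF f1c] P1c)
       (auto simp: sum_power2_eq_zero_iff)
  moreover have "0 < h w" if "c \<le> w" "w \<le> B" for w
    unfolding h_def using f1_neg[of w] that c B softplus_properties(5)[OF kp, of "\<Phi>1 w - \<Phi>1 c'"] by (simp add: mult_neg_pos)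
  ultimately obtain \<epsilon>1 where eps1: "0 < \<epsilon>1" "\<And>w. c \<le> w \<Longrightarrow> w \<le> B \<Longrightarrow> \<epsilon>1 \<le> h w"
    by (rule positive_on_Icc) auto
  define \<epsilon> where "\<epsilon> = min \<epsilon>1 e"
  have qd: "\<exists>D. (g has_real_derivative D) (at w) \<and> d * (D * g w) = G'"
    if G: "(G has_real_derivative G') (at w)" "0 < G w" "0 < d" and gw: "a < w" "w < B"
      "\<And>y. a < y \<Longrightarrow> y < B \<Longrightarrow> g y = sqrt (2 * G y / d)" for G G' d g w a
  proof -
    have gp: "0 < sqrt (2 * G w / d)" using G by simp
    have "((\<lambda>w. sqrt (2 * G w / d)) has_real_derivative inverse (sqrt (2 * G w / d)) / 2 * (2 * G' / d)) (at w)"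
      by (rule DERIV_chain2[OF DERIV_real_sqrt]) (use G in \<open>auto intro!: derivative_eq_intros\<close>)
    then have "(g has_real_derivative inverse (sqrt (2 * G w / d)) / 2 * (2 * G' / d)) (at w)"
      by (rule has_field_derivative_transform_within_open[where S = "{a<..<B}"]) (use gw in auto)
    moreover have "d * (inverse r / 2 * (2 * G' / d) * r) = G'" if "0 < r" for r
      using that G(3) by simp
    then have "d * (inverse (sqrt (2 * G w / d)) / 2 * (2 * G' / d) * g w) = G'"
      unfolding gw(3)[OF gw(1,2)] using gp by blast
    ultimately show ?thesis by blast
  qed
  have sup1: "\<exists>D. (g1 has_real_derivative D) (at w) \<and> d1 * (D * g1 w) + f1 w \<le> - \<epsilon>" if w: "c < w" "w < B" for w
  proof -
    have "\<exists>D. (g1 has_real_derivative D) (at w) \<and>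
        d1 * (D * g1 w) = (1 + (\<Phi>1 w - \<Phi>1 c') / sqrt ((\<Phi>1 w - \<Phi>1 c')\<^sup>2 + \<kappa>\<^sup>2)) / 2 * - f1 w"
      by (rule qd[OF G1d G1p pos(1) w]) (auto simp: g1_def q1_def)
    then obtain D where D: "(g1 has_real_derivative D) (at w)"
      "d1 * (D * g1 w) = (1 + (\<Phi>1 w - \<Phi>1 c') / sqrt ((\<Phi>1 w - \<Phi>1 c')\<^sup>2 + \<kappa>\<^sup>2)) / 2 * - f1 w" by blast
    have "(1 + q) / 2 * - a + a = - (- a * (1 - q) / 2)" for q a :: real by (simp add: field_simps)
    then have "d1 * (D * g1 w) + f1 w = - h w" unfolding D(2) h_def by blast
    then show ?thesis using eps1(2)[of w] w D(1) by (intro exI[of _ D]) (auto simp: \<epsilon>_def)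
  qed
  have sup2: "\<exists>D. (g2 has_real_derivative D) (at w) \<and> d2 * (D * g2 w) + f2 w \<le> - \<epsilon>" if w: "v \<le> w" "w < B" for w
  proof -
    have "V 0 < w" using w e' by simp
    have "\<exists>D. (g2 has_real_derivative D) (at w) \<and> d2 * (D * g2 w) = - f2 w - e"
      by (rule qd[OF G2d _ pos(2) \<open>V 0 < w\<close> w(2)]) (use G2p[of w] w e' in \<open>auto simp: g2_def q2_def\<close>)
    then show ?thesis by (auto simp: \<epsilon>_def)
  qed
  have kink: "\<sigma> * g2 w < g1 w" if w: "v \<le> w" "w < B" for w
  proof -
    have "\<Phi>2 w \<le> \<Phi>2 (V 0)"
      using Phi2_less[of "V 0" w] Phi2_less'[of w B] w B e' V0 by (cases "w \<le> K2") auto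
    moreover have "e * (B + 1 - w) \<le> e * (B + 1 - V 0)" using e0 w e' by (intro mult_left_mono) auto
    ultimately have "G2 w \<le> \<Phi>2 (V 0) + \<tau> / 2" unfolding G2_def using e0 by linarith
    then have "\<sigma>\<^sup>2 * d1 * G2 w \<le> \<sigma>\<^sup>2 * d1 * (\<Phi>2 (V 0) + \<tau> / 2)" using pos by (intro mult_left_mono) auto
    also have "\<dots> \<le> d2 * \<Phi>1 (V 0) + \<sigma>\<^sup>2 * d1 * \<tau>" using flux tau0 pos by (simp add: distrib_left)
    also have "\<dots> < d2 * \<Phi>1 v - d2 * \<tau>" using tauD by (simp add: \<Delta>_def algebra_simps)
    also have "\<dots> \<le> d2 * (\<Phi>1 w - \<Phi>1 c')"
    proof -
      have "\<Phi>1 v \<le> \<Phi>1 w" using Phi1_less[of v w] w e' V0 B by (cases "v = w") auto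
      then have "\<Phi>1 v - \<tau> \<le> \<Phi>1 w - \<Phi>1 c'" using c' by simp
      then have "d2 * (\<Phi>1 v - \<tau>) \<le> d2 * (\<Phi>1 w - \<Phi>1 c')" using pos by (intro mult_left_mono) auto
      then show ?thesis by (simp add: algebra_simps)
    qed
    also have "\<dots> \<le> d2 * G1 w" using softplus_properties(2)[OF kp] pos by (simp add: G1_def)
    finally have "\<sigma>\<^sup>2 * (2 * G2 w / d2) < 2 * G1 w / d1" using pos by (simp add: field_simps)
    then have "sqrt (\<sigma>\<^sup>2 * (2 * G2 w / d2)) < sqrt (2 * G1 w / d1)" by (rule real_sqrt_less_mono)
    moreover have "sqrt (\<sigma>\<^sup>2 * (2 * G2 w / d2)) = \<sigma> * sqrt (2 * G2 w / d2)"
      using pos(3) by (subst real_sqrt_mult) simp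
    ultimately have "\<sigma> * q2 w < q1 w" by (simp only: q1_def q2_def)
    moreover have "max c (min B w) = w" "max (V 0) (min B w) = w" using w e' c c' by auto
    ultimately show ?thesis by (simp add: g1_def g2_def)
  qed
  \<comment> \<open>below c' the argument of the smoothed positive part is nonpositive\<close>
  have flat: "g1 w \<le> (c' - c) / R" if "c \<le> w" "w \<le> c'" for w
  proof -
    have "\<Phi>1 w - \<Phi>1 c' \<le> 0" using Phi1_less[of w c'] that c c' V0 delta by (cases "w = c'") auto
    then have "G1 w \<le> \<kappa> / 2" unfolding G1_def by (rule softplus_properties(3)[OF kp])
    then have "2 * G1 w / d1 \<le> ((c' - c) / R)\<^sup>2" using pos by (simp add: \<kappa>_def pos_divide_le_eq mult.commute)
    then have "q1 w \<le> (c' - c) / R" unfolding q1_def using c R by (intro real_le_lsqrt) auto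
    moreover have "max c (min B w) = w" using that c' V0 B by auto
    ultimately show ?thesis by (simp add: g1_def)
  qed
  \<comment> \<open>far enough to the right for the profile, whose slope is at least m, to reach B\<close>
  define S where "S = max X ((B - v) / m)"
  have S: "0 < S" "X \<le> S" "B \<le> v + m * S"
  proof -
    have "(B - v) / m \<le> S" by (simp add: S_def)
    then show "B \<le> v + m * S" using mm(1) by (simp add: pos_divide_le_eq mult.commute)
  qed (use X in \<open>auto simp: S_def\<close>)
  have highB: "\<forall>\<^sub>F t in at_top. \<forall>x. - R \<le> x \<and> x \<le> S \<longrightarrow> u t x < B"
    using high[of "B - K2" "max R S"] B(1) by (auto elim!: eventually_mono)
  have val: "c' \<le> v" "v < B" "0 < \<epsilon>" using c' e' B eps1 e0 by (auto simp: \<epsilon>_def)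
  obtain W where W: "continuous_on UNIV W" "W 0 = v"
    "\<forall>x<0. (W has_real_derivative g1 (W x)) (at x)"
    "\<forall>x>0. (W has_real_derivative g2 (W x)) (at x)"
    "\<forall>\<^sub>F t in at_top. \<forall>x. - R \<le> x \<and> x \<le> S \<longrightarrow> u t x < W x"
    by (rule barrier_sweep[OF u pos gc mm c(2) val sup1 sup2 kink R(1) flat S(1,3) R(3) highB])
  have gnn: "0 \<le> g1 w" "0 \<le> g2 w" for w using mm(1) mm(2,3)[of w] by linarith+
  have Wle: "W x \<le> v" if "x \<le> 0" for x
  proof -
    have "W x \<le> W 0"
    proof (rule DERIV_nonneg_imp_increasing_open[where f = W, OF that])
      show "\<exists>D. (W has_real_derivative D) (at y) \<and> 0 \<le> D" if "x < y" "y < 0" for y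
        using W(3) that(2) gnn by blast
    qed (rule continuous_on_subset[OF W(1)], simp)
    then show ?thesis using W(2) by simp
  qed
  have Wge: "v \<le> W x" if "0 \<le> x" for x
  proof -
    have "W 0 \<le> W x"
    proof (rule DERIV_nonneg_imp_increasing_open[where f = W, OF that])
      show "\<exists>D. (W has_real_derivative D) (at y) \<and> 0 \<le> D" if "0 < y" "y < x" for y
        using W(4) that(1) gnn by blast
    qed (rule continuous_on_subset[OF W(1)], simp)
    then show ?thesis using W(2) by simp
  qed
  have close_left: "W x \<le> V x + \<eta>" if x: "- X \<le> x" "x \<le> 0" for x
  proof -
    have "W x - V x + s1 * x \<le> \<eta>'"
    proof (rule bound_propagates_left[where b = 0 and h = "\<lambda>x. W x - V x + s1 * x"])
      show "continuous_on {x..0} (\<lambda>x. W x - V x + s1 * x)"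
        by (intro continuous_intros continuous_on_subset[OF W(1)] continuous_on_subset[OF Vc]) auto
      show "W 0 - V 0 + s1 * 0 \<le> \<eta>'" by (simp add: W(2) v_def)
      fix y assume y: "x < y" "y < 0" "\<eta>' < W y - V y + s1 * y"
      have "s1 * y \<le> 0" using s1 y by (simp add: mult_nonneg_nonpos)
      then have VW: "V y < W y" using y e' by linarith
      have WB: "W y \<le> B" "W y \<le> K2" using Wle[of y] y e' B by auto
      have "sqrt (2 * \<Phi>1 (V y) / d1) \<le> g1 (W y) + s1"
      \<comment> \<open>below c only the sign of the slope of the profile is known, but V then lies
        below c too, and its slope is small\<close>
      proof (cases "c \<le> W y")
        case True
        have "\<Phi>1 (V y) \<le> \<Phi>1 (W y)" using Phi1_less[of "V y" "W y"] VW Vr[of y] WB delta by simp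
        also have "\<dots> \<le> G1 (W y) + \<tau>" using softplus_properties(2)[OF kp, of "\<Phi>1 (W y) - \<Phi>1 c'"] c' by (simp add: G1_def)
        finally have "2 * \<Phi>1 (V y) / d1 \<le> 2 * G1 (W y) / d1 + 2 * \<tau> / d1"
          using pos by (simp add: add_divide_distrib[symmetric] divide_right_mono)
        then have "sqrt (2 * \<Phi>1 (V y) / d1) \<le> q1 (W y) + s1"
          unfolding q1_def s1_def by (rule sqrt_le_sqrt_add) (use G1p[of "W y"] tau0 pos in auto)
        then show ?thesis using True WB by (simp add: g1_def)
      next
        case False
        have "\<Phi>1 (V y) \<le> \<Phi>1 c'" using Phi1_less[of "V y" c'] VW Vr[of y] False c c' V0 delta by simp
        then have "2 * \<Phi>1 (V y) / d1 \<le> 2 * \<tau> / d1" using c' pos by (intro divide_right_mono) auto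
        then have "sqrt (2 * \<Phi>1 (V y) / d1) \<le> s1" unfolding s1_def by simp
        then show ?thesis using mm(1) mm(2)[of "W y"] by linarith
      qed
      then show "\<exists>D. ((\<lambda>x. W x - V x + s1 * x) has_real_derivative D) (at y) \<and> 0 \<le> D"
        using W(3)[rule_format, OF y(2)] V1[OF y(2)]
        by (intro exI[of _ "g1 (W y) - sqrt (2 * \<Phi>1 (V y) / d1) + s1"])
           (auto intro!: derivative_eq_intros)
    qed (use x in auto)
    moreover have "s1 * - x \<le> s1 * X" using x s1 by (intro mult_left_mono) auto
    ultimately show ?thesis using s1 e' by simp
  qed
  have close_right: "W x \<le> V x + \<eta>" if x: "0 \<le> x" "x \<le> X" for x
  proof -
    have "W x - V x - s2 * x \<le> \<eta>'"
    proof (rule bound_propagates_right[where a = 0 and h = "\<lambda>x. W x - V x - s2 * x"])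
      show "continuous_on {0..x} (\<lambda>x. W x - V x - s2 * x)"
        by (intro continuous_intros continuous_on_subset[OF W(1)] continuous_on_subset[OF Vc]) auto
      show "W 0 - V 0 - s2 * 0 \<le> \<eta>'" by (simp add: W(2) v_def)
      fix y assume y: "0 < y" "y < x" "\<eta>' < W y - V y - s2 * y"
      have "0 \<le> s2 * y" using s2 y by simp
      then have VW: "V y < W y" using y e' by linarith
      have Wv: "v \<le> W y" using Wge y by simp
      define r where "r = max (V 0) (min B (W y))"
      have r: "V 0 \<le> r" "r \<le> B" "r \<le> W y" using Wv e' cB by (auto simp: r_def)
      have "e * (B + 1 - r) \<le> e * (B + 1 - V 0)" using e0 r by (intro mult_left_mono) auto
      then have G2r: "G2 r \<le> \<Phi>2 r + \<tau> / 2" using e0 by (simp add: G2_def)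
      have "\<Phi>2 r \<le> \<Phi>2 (V y) + \<tau> / 2"
      proof (cases "r \<le> K2")
        case True
        then have "r = W y" using B Wv e' by (auto simp: r_def min_def max_def split: if_splits)
        then show ?thesis using Phi2_less[of "V y" r] VW Vr[of y] True tau0 by simp
      next
        case False
        then have "\<Phi>2 r \<le> \<Phi>2 B" using Phi2_less'[of r B] r B by (cases "r = B") auto
        then show ?thesis using B Phi2_nonneg[of "V y"] Vr[of y] delta by simp
      qed
      then have "2 * G2 r / d2 \<le> 2 * \<Phi>2 (V y) / d2 + 2 * \<tau> / d2"
        using G2r pos by (simp add: add_divide_distrib[symmetric] divide_right_mono)
      then have "q2 r \<le> sqrt (2 * \<Phi>2 (V y) / d2) + s2"
        unfolding q2_def s2_def
        by (rule sqrt_le_sqrt_add) (use Phi2_nonneg[of "V y"] Vr[of y] delta tau0 pos in auto)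
      then have "g2 (W y) \<le> sqrt (2 * \<Phi>2 (V y) / d2) + s2" by (simp add: g2_def r_def)
      then show "\<exists>D. ((\<lambda>x. W x - V x - s2 * x) has_real_derivative D) (at y) \<and> D \<le> 0"
        using W(4)[rule_format, OF y(1)] V2[OF y(1)]
        by (intro exI[of _ "g2 (W y) - sqrt (2 * \<Phi>2 (V y) / d2) - s2"])
           (auto intro!: derivative_eq_intros)
    qed (use x in auto)
    moreover have "s2 * x \<le> s2 * X" using x s2 by (intro mult_left_mono) auto
    ultimately show ?thesis using s2 e' by simp
  qed
  show ?thesis
    using W(5)
  proof eventually_elim
    case (elim t)
    show ?case
    proof (intro allI impI)
      fix x assume x: "\<bar>x\<bar> \<le> X"
      then have "- R \<le> x" "x \<le> S" using R(2) S(2) by (auto simp: abs_le_iff)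
      then have "u t x < W x" using elim by blast
      also have "\<dots> \<le> V x + \<eta>" using close_left[of x] close_right[of x] x by (cases "x \<le> 0") auto
      finally show "u t x < V x + \<eta>" .
    qed
  qed
qed

text \<open>The bound from above, applied to \<open>K1 + K2 - u t (- x)\<close>.\<close>

lemma eventually_above:
  assumes u: "two_patch d1 d2 \<sigma> f1 f2 u"
    and low: "\<And>e R. 0 < e \<Longrightarrow> \<forall>\<^sub>F t in at_top. \<forall>x. \<bar>x\<bar> \<le> R \<longrightarrow> K1 - e < u t x"
    and right: "\<And>e. 0 < e \<Longrightarrow> \<exists>R0. \<forall>R\<ge>R0. \<forall>\<^sub>F t in at_top. K2 - e < u t R"
    and X: "0 < X" and eta: "0 < \<eta>"
  shows "\<forall>\<^sub>F t in at_top. \<forall>x. \<bar>x\<bar> \<le> X \<longrightarrow> V x - \<eta> < u t x"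
proof -
  define w where "w = (\<lambda>t x. K1 + K2 - u t (- x))"
  have tp: "two_patch d2 d1 (1 / \<sigma>) (\<lambda>s. - f2 (K1 + K2 - s)) (\<lambda>s. - f1 (K1 + K2 - s)) w"
    unfolding w_def by (rule two_patch_reflect_value[OF two_patch_reflect_space[OF u pos(3)]])
  have "\<forall>\<^sub>F t in at_top. \<forall>x. \<bar>x\<bar> \<le> X \<longrightarrow> w t x < K1 + K2 - V (- x) + \<eta>"
  proof (rule front_profile.eventually_below[OF mirror tp _ _ X eta])
    show "\<forall>\<^sub>F t in at_top. \<forall>x. \<bar>x\<bar> \<le> R \<longrightarrow> w t x < K2 + e" if "0 < e" for e R
      using low[OF that, of R]
    proof eventually_elim
      case (elim t)
      show ?case
      proof (intro allI impI)
        fix x assume "\<bar>x\<bar> \<le> R"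
        then show "w t x < K2 + e" using elim[rule_format, of "- x"] by (simp add: w_def)
      qed
    qed
    show "\<exists>R0. \<forall>R\<ge>R0. \<forall>\<^sub>F t in at_top. w t (- R) < K1 + e" if "0 < e" for e
    proof -
      obtain R0 where R0: "\<And>R. R \<ge> R0 \<Longrightarrow> \<forall>\<^sub>F t in at_top. K2 - e < u t R" using right[OF \<open>0 < e\<close>] by auto
      show ?thesis by (intro exI[of _ R0] allI impI eventually_mono[OF R0]) (auto simp: w_def)
    qed
  qed
  then show ?thesis
  proof eventually_elim
    case (elim t)
    show ?case
    proof (intro allI impI)
      fix x assume "\<bar>x\<bar> \<le> X"
      then show "V x - \<eta> < u t x" using elim[rule_format, of "- x"] by (simp add: w_def)
    qed
  qed
qed

end

section \<open>Decay ahead of the spreading cone\<close>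

text \<open>The hypothesis of a uniform bound also supplies the boundedness without which the
supremum of reals would be meaningless.\<close>

lemma sup_tendsto_zero:
  fixes g :: "real \<Rightarrow> real \<Rightarrow> real"
  assumes ne: "\<forall>\<^sub>F t in at_top. S t \<noteq> {} \<and> (\<forall>x\<in>S t. 0 \<le> g t x)"
    and small: "\<And>e. 0 < e \<Longrightarrow> \<forall>\<^sub>F t in at_top. \<forall>x\<in>S t. g t x \<le> e"
  shows "((\<lambda>t. SUP x\<in>S t. g t x) \<longlongrightarrow> 0) at_top"
proof (rule tendstoI)
  fix e :: real assume e: "0 < e"
  show "\<forall>\<^sub>F t in at_top. dist (SUP x\<in>S t. g t x) 0 < e"
    using ne small[OF half_gt_zero[OF e]]
  proof eventually_elim
    case (elim t)
    then obtain x where x: "x \<in> S t" by auto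
    have "0 \<le> g t x" using elim x by auto
    also have "g t x \<le> (SUP x\<in>S t. g t x)"
      by (rule cSUP_upper[OF x]) (use elim in \<open>auto intro!: bdd_aboveI2[where M = "e / 2"]\<close>)
    finally have "0 \<le> (SUP x\<in>S t. g t x)" .
    moreover have "(SUP x\<in>S t. g t x) \<le> e / 2" by (rule cSUP_least) (use elim in auto)
    ultimately show ?case using e by (simp add: dist_real_def)
  qed
qed

text \<open>Since \<open>f2 s \<le> r * s\<close>, exponentials that solve the linear equation are
supersolutions, and \<open>sqrt (r / d2)\<close> is the decay rate with the least speed. A small
multiple of a growing exponential takes care of the unbounded domain. At \<open>x = 0\<close> the
barrier exceeds the bound \<open>M\<close> for all times, so the comparison takes place in the
right patch alone.\<close>

lemma decay_right:
  assumes u: "two_patch d1 d2 \<sigma> f1 f2 u" and pos: "0 < d1" "0 < d2" "0 < \<sigma>" "0 < r"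
    and bnd: "\<And>t x. 0 \<le> t \<Longrightarrow> 0 \<le> u t x \<and> u t x \<le> M"
    and f: "\<And>s. 0 \<le> s \<Longrightarrow> f2 s \<le> r * s"
    and supp: "\<And>x. B \<le> x \<Longrightarrow> u 0 x = 0"
  shows "\<exists>A. \<forall>t\<ge>0. \<forall>x\<ge>0. u t x \<le> A * exp (- sqrt (r / d2) * (x - 2 * sqrt (d2 * r) * t))"
proof -
  define l where "l = sqrt (r / d2)"
  define c where "c = 2 * sqrt (d2 * r)"
  have l: "0 < l" "d2 * l\<^sup>2 = r" using pos by (auto simp: l_def)
  have "sqrt (d2 * r) * sqrt (r / d2) = sqrt (r\<^sup>2)"
    using pos by (simp add: real_sqrt_mult[symmetric] power2_eq_square)
  then have cl: "c * l = 2 * r" using pos by (simp add: c_def l_def)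
  define A where "A = (M + 1) * exp (l * \<bar>B\<bar>)"
  have M: "0 \<le> M" using bnd[of 0 0] by simp
  have "1 \<le> exp (l * \<bar>B\<bar>)" using l by simp
  then have "(M + 1) * 1 \<le> A" unfolding A_def using M by (intro mult_left_mono) auto
  then have A: "M + 1 \<le> A" "0 < A" using M by auto
  have c0: "0 \<le> c" using pos by (simp add: c_def)
  have main: "u t x \<le> A * exp (- l * (x - c * t)) + \<theta> * exp (x + (d2 + r + 1) * t)"
    if t: "0 \<le> t" and x: "0 \<le> x" and th: "0 < \<theta>" for t x \<theta>
  proof -
    define N where "N = x + (M + 1) / \<theta>"
    define a where "a = (\<lambda>t x. A * exp (- l * (x - c * t)))"
    define b where "b = (\<lambda>t x. \<theta> * exp (x + (d2 + r + 1) * t))"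
    have ab: "0 < a t x" "0 < b t x" for t x using A th by (auto simp: a_def b_def)
    have N: "x \<le> N" "(M + 1) / \<theta> \<le> N" "0 \<le> N" using x M th by (auto simp: N_def)
    have jet: "has_jet (\<lambda>t x. a t x + b t x) s y (2 * r * a s y + (d2 + r + 1) * b s y) (l\<^sup>2 * a s y + b s y)" for s y
    proof (rule has_jetI[where S = UNIV and v = "\<lambda>y. - l * a s y + b s y"])
      have "((\<lambda>s. a s y + b s y) has_real_derivative (c * l) * a s y + (d2 + r + 1) * b s y) (at s)"
        unfolding a_def b_def by (auto intro!: derivative_eq_intros simp: algebra_simps)
      then show "((\<lambda>s. a s y + b s y) has_real_derivative 2 * r * a s y + (d2 + r + 1) * b s y) (at s)"
        unfolding cl .
      show "((\<lambda>y. a s y + b s y) has_real_derivative - l * a s z + b s z) (at z)" for z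
        unfolding a_def b_def by (auto intro!: derivative_eq_intros simp: algebra_simps)
      show "((\<lambda>y. - l * a s y + b s y) has_real_derivative l\<^sup>2 * a s y + b s y) (at y)"
        unfolding a_def b_def by (auto intro!: derivative_eq_intros simp: algebra_simps power2_eq_square)
    qed auto
    have "u t x < a t x + b t x"
    proof (rule comparison_super[OF u pos(1-3), where ?T0.0 = 0 and ?T1.0 = t and a = "\<lambda>_. 0" and b = "\<lambda>_. N"
          and w = "\<lambda>t x. a t x + b t x"])
      show "continuous_on ({0..t} \<times> UNIV) (\<lambda>(t, x). a t x + b t x)"
        unfolding a_def b_def case_prod_unfold by (intro continuous_intros)
    next
      fix y assume y: "0 \<le> y" "y \<le> N"
      show "u 0 y < a 0 y + b 0 y"
      proof (cases "B \<le> y")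
        case True
        then show ?thesis using supp[OF True] ab[of 0 y] by simp
      next
        case False
        have "(M + 1) * exp 0 \<le> (M + 1) * exp (l * \<bar>B\<bar> - l * y)"
          using M l False by (intro mult_left_mono) (auto simp: right_diff_distrib[symmetric])
        also have "\<dots> = a 0 y" unfolding a_def A_def by (simp add: exp_diff exp_minus divide_inverse)
        finally show ?thesis using bnd[of 0 y] ab[of 0 y] by auto
      qed
    next
      fix s assume s: "0 \<le> s" "s \<le> t"
      have "A * 1 \<le> a s 0" unfolding a_def using A l c0 s by (intro mult_left_mono) auto
      then show "u s 0 < a s 0 + b s 0" using A bnd[of s 0] ab[of s 0] s by auto
      have "M + 1 = \<theta> * ((M + 1) / \<theta>)" using th by simp
      also have "\<dots> \<le> \<theta> * exp (N + (d2 + r + 1) * s)"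
      proof (rule mult_left_mono)
        have "(M + 1) / \<theta> \<le> exp N" using N exp_ge_add_one_self[of N] by linarith
        also have "\<dots> \<le> exp (N + (d2 + r + 1) * s)" using pos s by simp
        finally show "(M + 1) / \<theta> \<le> exp (N + (d2 + r + 1) * s)" .
      qed (use th in auto)
      finally have "M + 1 \<le> b s N" by (simp add: b_def)
      then show "u s N < a s N + b s N" using bnd[of s N] ab[of s N] s by auto
    next
      fix s y
      have "d2 * (l\<^sup>2 * a s y + b s y) + f2 (a s y + b s y) \<le> d2 * l\<^sup>2 * a s y + d2 * b s y + r * (a s y + b s y)"
        using f[of "a s y + b s y"] ab[of s y] by (simp add: algebra_simps)
      also have "\<dots> < 2 * r * a s y + (d2 + r + 1) * b s y" unfolding l(2) using ab[of s y] by (simp add: algebra_simps)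
      finally show "\<exists>\<alpha> \<beta>. has_jet (\<lambda>t x. a t x + b t x) s y \<alpha> \<beta> \<and> d2 * \<beta> + f2 (a s y + b s y) < \<alpha>"
        using jet by blast
    qed (use t x N in auto)
    then show ?thesis by (simp add: a_def b_def)
  qed
  have "u t x \<le> A * exp (- l * (x - c * t))" if "0 \<le> t" "0 \<le> x" for t x
  proof (rule field_le_epsilon)
    fix e :: real assume e: "0 < e"
    have "0 < e / exp (x + (d2 + r + 1) * t)" using e by simp
    from main[OF that this] show "u t x \<le> A * exp (- l * (x - c * t)) + e" by simp
  qed
  then show ?thesis unfolding l_def c_def by blast
qed

lemma spreading_upper_right:
  assumes u: "two_patch d1 d2 \<sigma> f1 f2 u" and pos: "0 < d1" "0 < d2" "0 < \<sigma>"
    and bnd: "\<And>t x. 0 \<le> t \<Longrightarrow> 0 \<le> u t x \<and> u t x \<le> M"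
    and kpp: "KPP_reaction K f2" "0 < K"
    and supp: "\<And>x. B \<le> x \<Longrightarrow> u 0 x = 0" and eps: "0 < \<epsilon>" and e: "0 < e"
  shows "\<forall>\<^sub>F t in at_top. \<forall>x. (spreading_speed d2 f2 + \<epsilon>) * t \<le> x \<longrightarrow> u t x \<le> e"
proof -
  define l where "l = sqrt (deriv f2 0 / d2)"
  define c where "c = spreading_speed d2 f2"
  have r: "0 < deriv f2 0" using kpp by (rule kpp_rate_pos)
  have l: "0 < l" and c: "0 \<le> c" using r pos by (auto simp: l_def c_def spreading_speed_def)
  obtain A where A: "\<And>t x. 0 \<le> t \<Longrightarrow> 0 \<le> x \<Longrightarrow> u t x \<le> A * exp (- l * (x - c * t))"
    using decay_right[OF u pos r bnd kpp_linear_upper[OF kpp] supp]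
    unfolding l_def c_def spreading_speed_def by metis
  have "((\<lambda>t. \<bar>A\<bar> * exp (- (l * \<epsilon>) * t)) \<longlongrightarrow> \<bar>A\<bar> * 0) at_top"
    by (intro tendsto_intros filterlim_compose[OF exp_at_bot] filterlim_tendsto_neg_mult_at_bot[OF tendsto_const])
       (use l eps in \<open>auto intro: filterlim_ident\<close>)
  then have "\<forall>\<^sub>F t in at_top. \<bar>A\<bar> * exp (- (l * \<epsilon>) * t) < e" using e by (auto dest: order_tendstoD)
  then show ?thesis using eventually_ge_at_top[of 0]
  proof eventually_elim
    case (elim t)
    show ?case
    proof (intro allI impI)
      fix x assume x: "(spreading_speed d2 f2 + \<epsilon>) * t \<le> x"
      have "\<epsilon> * t \<le> x - c * t" using x by (simp add: c_def algebra_simps)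
      then have "l * (\<epsilon> * t) \<le> l * (x - c * t)" using l by (intro mult_left_mono) auto
      moreover have "0 \<le> (c + \<epsilon>) * t" using c eps elim by simp
      then have "0 \<le> x" using x by (simp add: c_def)
      then have "u t x \<le> A * exp (- l * (x - c * t))" using A elim by auto
      moreover have "A * exp (- l * (x - c * t)) \<le> \<bar>A\<bar> * exp (- (l * \<epsilon>) * t)"
        by (rule mult_mono) (use calculation in \<open>auto simp: mult.assoc\<close>)
      ultimately show "u t x \<le> e" using elim by linarith
    qed
  qed
qed

section \<open>The stationary solution\<close>

text \<open>Convexity and the limit at \<open>- \<infinity>\<close> give \<open>p \<ge> 0\<close>.
The energy \<open>d * p\<^sup>2 / 2 - \<Phi> V\<close> is constant; it vanishes because
\<open>p\<close> tends to \<open>0\<close> along the intermediate points of the mean value theorem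
on \<open>{- n - 1..- n}\<close>.\<close>

lemma left_energy:
  fixes V p q f \<Phi> :: "real \<Rightarrow> real"
  assumes d: "0 < d"
    and V: "\<And>x. x \<le> 0 \<Longrightarrow> (V has_real_derivative p x) (at x within {..0})"
    and p: "\<And>x. x \<le> 0 \<Longrightarrow> (p has_real_derivative q x) (at x within {..0})"
    and ode: "\<And>x. x < 0 \<Longrightarrow> d * q x + f (V x) = 0"
    and sgn: "\<And>x. x < 0 \<Longrightarrow> f (V x) \<le> 0"
    and lim: "(V \<longlongrightarrow> K) at_bot"
    and Phi: "\<And>s. (\<Phi> has_real_derivative - f s) (at s)" "\<Phi> K = 0"
    and x: "x \<le> 0"
  shows "p x = sqrt (2 * \<Phi> (V x) / d)"
proof -
  have V': "(V has_real_derivative p x) (at x)" and p': "(p has_real_derivative q x) (at x)" if "x < 0" for x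
  proof -
    have "at x within {..0} = at x" using that by (intro at_within_interior) auto
    then show "(V has_real_derivative p x) (at x)" "(p has_real_derivative q x) (at x)"
      using V[of x] p[of x] that by auto
  qed
  have Vc: "continuous_on {..0} V" and pc: "continuous_on {..0} p"
    using V p by (auto intro!: DERIV_continuous_on)
  have pmono: "p a \<le> p b" if "a \<le> b" "b \<le> 0" for a b
  proof (rule DERIV_nonneg_imp_increasing_open[where f = p, OF that(1)])
    show "continuous_on {a..b} p" by (rule continuous_on_subset[OF pc]) (use that in auto)
    fix y assume y: "a < y" "y < b"
    then have "0 \<le> d * q y" using ode[of y] sgn[of y] that by auto
    then have "0 \<le> q y" using d by (simp add: zero_le_mult_iff)
    then show "\<exists>D. (p has_real_derivative D) (at y) \<and> 0 \<le> D" using p'[of y] y that by auto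
  qed
  have MVT: "\<exists>z. a < z \<and> z < b \<and> V b - V a = (b - a) * p z" if "a < b" "b \<le> 0" for a b
  proof -
    have "\<exists>l z. a < z \<and> z < b \<and> DERIV V z :> l \<and> V b - V a = (b - a) * l"
    proof (rule MVT[OF that(1)])
      show "continuous_on {a..b} V" by (rule continuous_on_subset[OF Vc]) (use that in auto)
      show "V differentiable (at y)" if "a < y" "y < b" for y
        using V'[of y] that \<open>b \<le> 0\<close> unfolding real_differentiable_def by auto
    qed
    then obtain l z where "a < z" "z < b" "DERIV V z :> l" "V b - V a = (b - a) * l" by blast
    then show ?thesis using DERIV_unique[OF _ V'[of z], of l] that by auto
  qed
  have pnn: "0 \<le> p y" if y0: "y \<le> 0" for y
  proof (rule ccontr)
    assume "\<not> 0 \<le> p y"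
    then have py: "p y < 0" by simp
    have "\<forall>\<^sub>F z in at_bot. V z < K + 1" using lim by (rule order_tendstoD) simp
    then obtain z0 where z0: "\<And>z. z \<le> z0 \<Longrightarrow> V z < K + 1" unfolding eventually_at_bot_linorder by auto
    \<comment> \<open>far enough to the left for a negative slope at y to lift V above K + 1\<close>
    define z where "z = min z0 (y - 1 - (\<bar>K + 1 - V y\<bar>) / (- p y))"
    have "0 \<le> (\<bar>K + 1 - V y\<bar>) / (- p y)" using py by (intro divide_nonneg_pos) auto
    moreover have "z \<le> y - 1 - (\<bar>K + 1 - V y\<bar>) / (- p y)" by (simp add: z_def)
    ultimately have z: "z < y" "z \<le> z0" "(\<bar>K + 1 - V y\<bar>) / (- p y) \<le> y - z" by (auto simp: z_def)
    obtain w where w: "z < w" "w < y" "V y - V z = (y - z) * p w" using MVT[OF z(1) y0] by blast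
    have "0 < - p y" using py by simp
    from iffD1[OF pos_divide_le_eq[OF this] z(3)]
    have "\<bar>K + 1 - V y\<bar> \<le> (y - z) * (- p y)" .
    moreover have "(y - z) * p w \<le> (y - z) * p y" using w z pmono[of w y] that by (intro mult_left_mono) auto
    ultimately have "K + 1 \<le> V z" using w(3) by auto
    then show False using z0[OF z(2)] by simp
  qed
  define E where "E = (\<lambda>x. d * (p x)\<^sup>2 / 2 - \<Phi> (V x))"
  have Phic: "continuous_on UNIV \<Phi>" using Phi(1) by (meson DERIV_isCont continuous_at_imp_continuous_on)
  have Ec: "continuous_on {..0} E" unfolding E_def
    by (intro continuous_intros pc continuous_on_compose2[OF Phic Vc]) auto
  have Ed: "(E has_real_derivative 0) (at y)" if "y < 0" for y
  proof -
    have "(E has_real_derivative d * (2 * p y * q y) / 2 - - f (V y) * p y) (at y)"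
      unfolding E_def
      by (intro DERIV_diff DERIV_chain2[OF Phi(1)] V' that DERIV_cdivide DERIV_cmult)
         (auto intro!: derivative_eq_intros p' that simp: power2_eq_square)
    moreover have "d * (2 * p y * q y) / 2 - - f (V y) * p y = p y * (d * q y + f (V y))" by (simp add: algebra_simps)
    ultimately show ?thesis using ode[OF that] by simp
  qed
  have Econst: "E a = E b" if "a < b" "b \<le> 0" for a b
    by (rule DERIV_isconst_end[OF that(1), symmetric]) (use Ed that in \<open>auto intro: continuous_on_subset[OF Ec]\<close>)
  have "\<exists>z. - real (Suc n) < z \<and> z < - real n \<and> V (- real n) - V (- real (Suc n)) = p z" for n
    using MVT[of "- real (Suc n)" "- real n"] by auto
  then obtain z where z: "\<And>n. - real (Suc n) < z n" "\<And>n. z n < - real n"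
    "\<And>n. V (- real n) - V (- real (Suc n)) = p (z n)" by metis
  have n_bot: "filterlim (\<lambda>n. - real n) at_bot sequentially"
    using filterlim_real_sequentially by (simp add: filterlim_uminus_at_bot)
  have zbot: "filterlim z at_bot sequentially"
    unfolding filterlim_at_bot
  proof
    fix Z :: real
    have "\<forall>\<^sub>F n in sequentially. - real n \<le> Z" using n_bot unfolding filterlim_at_bot by blast
    then show "\<forall>\<^sub>F n in sequentially. z n \<le> Z"
    proof eventually_elim
      case (elim n) then show ?case using z(2)[of n] by simp
    qed
  qed
  have "(\<lambda>n. V (- real n)) \<longlonglongrightarrow> K" using lim n_bot by (rule filterlim_compose)
  then have "(\<lambda>n. V (- real n) - V (- real (Suc n))) \<longlonglongrightarrow> K - K"
    by (intro tendsto_diff LIMSEQ_Suc[where f = "\<lambda>n. V (- real n)"])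
  then have pz: "(\<lambda>n. p (z n)) \<longlonglongrightarrow> 0" using z(3) by simp
  have "(\<lambda>n. V (z n)) \<longlonglongrightarrow> K" using lim zbot by (rule filterlim_compose)
  then have "(\<lambda>n. \<Phi> (V (z n))) \<longlonglongrightarrow> \<Phi> K"
    using Phic by (intro isCont_tendsto_compose[of K \<Phi>]) (auto simp: continuous_on_eq_continuous_at)
  with pz have "(\<lambda>n. E (z n)) \<longlonglongrightarrow> d * 0\<^sup>2 / 2 - \<Phi> K"
    unfolding E_def by (intro tendsto_intros) auto
  then have Ez: "(\<lambda>n. E (z n)) \<longlonglongrightarrow> 0" using Phi(2) by simp
  have "E (z n) = E 0" for n using Econst[of "z n" 0] z(2)[of n] by simp
  then have "E 0 = 0" using Ez by (simp add: LIMSEQ_const_iff)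
  then have "E x = 0" using Econst[of x 0] x by (cases "x = 0") auto
  then have "(p x)\<^sup>2 = 2 * \<Phi> (V x) / d" using d by (simp add: E_def field_simps)
  then show ?thesis using pnn[OF x] by (metis real_sqrt_unique)
qed

lemma within_left_imp_at: "x < (0::real) \<Longrightarrow> at x within {..0} = at x"
  by (intro at_within_interior) auto

lemma within_right_imp_at: "0 < (x::real) \<Longrightarrow> at x within {0..} = at x"
  by (intro at_within_interior) auto

text \<open>The equations are stated with \<open>deriv\<close>, so that the derivatives given by the
regularity class have to be identified with it first.\<close>

lemma jet_from_derivatives:
  assumes S: "open S" "x \<in> S"
    and t: "((\<lambda>s. u s x) has_real_derivative a) (at t)"
    and x: "\<And>y. y \<in> S \<Longrightarrow> (u t has_real_derivative v y) (at y)" "(v has_real_derivative b) (at x)"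
    and eq: "deriv (\<lambda>s. u s x) t = d * deriv (deriv (u t)) x + f (u t x)"
  shows "has_jet u t x (d * b + f (u t x)) b"
proof -
  have "deriv (u t) y = v y" if "y \<in> S" for y using x(1)[OF that] by (rule DERIV_imp_deriv)
  then have "(deriv (u t) has_real_derivative b) (at x)"
    using has_field_derivative_transform_within_open[OF x(2) S] by metis
  then have "deriv (deriv (u t)) x = b" by (rule DERIV_imp_deriv)
  moreover have "deriv (\<lambda>s. u s x) t = a" using t by (rule DERIV_imp_deriv)
  ultimately show ?thesis using eq has_jetI[OF t S x] by simp
qed

lemma C12_on_jet:
  assumes C: "C12_on S u" and I: "open I" "x \<in> I" "I \<subseteq> S" and t: "0 < t"
    and eq: "deriv (\<lambda>s. u s x) t = d * deriv (deriv (u t)) x + f (u t x)"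
  shows "\<exists>b. has_jet u t x (d * b + f (u t x)) b"
proof -
  obtain ut ux uxx where *: "\<forall>t>0. \<forall>x\<in>S. ((\<lambda>s. u s x) has_real_derivative ut t x) (at t) \<and>
     (u t has_real_derivative ux t x) (at x within S) \<and> (ux t has_real_derivative uxx t x) (at x within S)"
    using C unfolding C12_on_def by blast
  have at: "at y within S = at y" if "y \<in> I" for y
    using that I by (meson at_within_interior interior_maximal subsetD)
  have d: "((\<lambda>s. u s y) has_real_derivative ut t y) (at t)" "(u t has_real_derivative ux t y) (at y)"
    "(ux t has_real_derivative uxx t y) (at y)" if "y \<in> I" for y
    using *[rule_format, OF t, of y] that I at[OF that] by auto
  have "has_jet u t x (d * uxx t x + f (u t x)) (uxx t x)"
    by (rule jet_from_derivatives[where u = u and t = t and x = x and d = d and f = f and v = "ux t" and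
        a = "ut t x" and S = I]) (use d I eq in auto)
  then show ?thesis ..
qed

lemma classical_solution_two_patch:
  assumes "classical_solution d1 d2 \<sigma> f1 f2 u0 u"
  shows "two_patch d1 d2 \<sigma> f1 f2 u"
proof -
  note sol = assms[unfolded classical_solution_def]
  have "\<exists>b. has_jet u t x (d1 * b + f1 (u t x)) b" if "0 < t" "x < 0" for t x
    by (rule C12_on_jet[where S = "{..0}" and I = "{..<0}"]) (use sol that in auto)
  moreover have "\<exists>b. has_jet u t x (d2 * b + f2 (u t x)) b" if "0 < t" "0 < x" for t x
    by (rule C12_on_jet[where S = "{0..}" and I = "{0<..}"]) (use sol that in auto)
  ultimately show ?thesis unfolding two_patch_def using sol by simp
qed

lemma C2_on_classical_ode:
  assumes V: "\<And>x. x \<in> S \<Longrightarrow> (V has_real_derivative p x) (at x within S)"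
    "\<And>x. x \<in> S \<Longrightarrow> (p has_real_derivative q x) (at x within S)"
    and I: "open I" "x \<in> I" "I \<subseteq> S"
    and ode: "d * deriv (deriv V) x + f (V x) = 0"
  shows "has_jet (\<lambda>t. V) t x (d * q x + f (V x)) (q x)" "d * q x + f (V x) = 0"
proof -
  have at: "at y within S = at y" if "y \<in> I" for y
    using that I by (meson at_within_interior interior_maximal subsetD)
  have V': "(V has_real_derivative p y) (at y)" "(p has_real_derivative q y) (at y)" if "y \<in> I" for y
    using V[of y] at[OF that] that I by auto
  have "deriv V y = p y" if "y \<in> I" for y using V'(1)[OF that] by (rule DERIV_imp_deriv)
  then have "(deriv V has_real_derivative q x) (at x)"
    using has_field_derivative_transform_within_open[OF V'(2)[OF I(2)] I(1,2)] by metis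
  then have "deriv (deriv V) x = q x" by (rule DERIV_imp_deriv)
  then show *: "d * q x + f (V x) = 0" using ode by simp
  show "has_jet (\<lambda>t. V) t x (d * q x + f (V x)) (q x)" unfolding *
    by (rule has_jetI[OF _ I(1,2)]) (use V' I in auto)
qed

text \<open>A stationary solution is a solution of the parabolic problem that does not depend on
time, so bounds valid for large times hold for it outright. This gives its range and its limits,
which are the hypotheses of the energy lemma on the left and, after reflection, on the
right.\<close>

lemma stationary_front:
  assumes pos: "0 < d1" "0 < d2" "0 < \<sigma>" and K: "0 < K1" "K1 \<le> K2"
    and kpp1: "KPP_reaction K1 f1" and kpp2: "KPP_reaction K2 f2"
    and V: "positive_bounded_stationary_solution d1 d2 \<sigma> f1 f2 V"
  shows "\<And>x. K1 \<le> V x" "\<And>x. V x \<le> K2" "(V \<longlongrightarrow> K1) at_bot" "(V \<longlongrightarrow> K2) at_top"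
    and "K1 < K2 \<Longrightarrow> \<exists>\<Phi>1 \<Phi>2. front_profile d1 d2 \<sigma> K1 K2 (K1 / 2) f1 f2 \<Phi>1 \<Phi>2 V"
proof -
  note Vs = V[unfolded positive_bounded_stationary_solution_def classical_stationary_solution_def]
  obtain p q where p: "\<And>x. x \<in> {..0} \<Longrightarrow> (V has_real_derivative p x) (at x within {..0})"
    "\<And>x. x \<in> {..0} \<Longrightarrow> (p has_real_derivative q x) (at x within {..0})"
    using Vs unfolding C2_on_def by meson
  obtain p' q' where p': "\<And>x. x \<in> {0..} \<Longrightarrow> (V has_real_derivative p' x) (at x within {0..})"
    "\<And>x. x \<in> {0..} \<Longrightarrow> (p' has_real_derivative q' x) (at x within {0..})"
    using Vs unfolding C2_on_def by meson
  have left: "has_jet (\<lambda>t. V) t x (d1 * q x + f1 (V x)) (q x)" "d1 * q x + f1 (V x) = 0" if "x < 0" for t x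
    using C2_on_classical_ode[OF p, where I = "{..<0}" and x = x and d = d1 and f = f1] that Vs
    by (auto simp: lessThan_subset_iff subset_iff)
  have right: "has_jet (\<lambda>t. V) t x (d2 * q' x + f2 (V x)) (q' x)" "d2 * q' x + f2 (V x) = 0" if "0 < x" for t x
    using C2_on_classical_ode[OF p', where I = "{0<..}" and x = x and d = d2 and f = f2] that Vs
    by (auto simp: subset_iff)
  have Vc: "continuous_on UNIV V" using Vs by blast
  have tp: "two_patch d1 d2 \<sigma> f1 f2 (\<lambda>t. V)"
    unfolding two_patch_def
  proof (intro conjI allI impI)
    show "continuous_on ({0..} \<times> UNIV) (\<lambda>(t::real, x). V x)"
      unfolding case_prod_unfold by (intro continuous_on_compose2[OF Vc] continuous_intros) auto
  qed (use left right Vs in blast)+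
  obtain M where M: "\<And>x. \<bar>V x\<bar> \<le> M" using Vs unfolding bounded_iff by auto
  interpret S: kpp_solution d1 d2 \<sigma> K1 K2 f1 f2 "\<lambda>t. V" M 0
  proof
    show "0 \<le> V x \<and> V x \<le> M" for x using M[of x] Vs by (simp add: less_imp_le)
    show "V 0 \<noteq> 0" using Vs by (metis less_irrefl)
  qed (use pos K kpp1 kpp2 tp in auto)
  have low: "\<exists>R. \<forall>x. K1 - e < V x \<and> (R \<le> x \<longrightarrow> K2 - e < V x)" if e: "0 < e" for e
  proof -
    obtain R where "\<And>X. \<forall>\<^sub>F t in at_top :: real filter. \<forall>x. \<bar>x\<bar> \<le> X \<longrightarrow>
        K1 - e < V x \<and> (R \<le> x \<longrightarrow> K2 - e < V x)"
      using S.eventually_lower[OF e] by blast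
    then have *: "\<bar>x\<bar> \<le> X \<Longrightarrow> K1 - e < V x \<and> (R \<le> x \<longrightarrow> K2 - e < V x)" for X x by simp
    show ?thesis by (intro exI[of _ R] allI *[OF order_refl])
  qed
  show V1: "K1 \<le> V x" for x
  proof (rule field_le_epsilon)
    fix e :: real assume "0 < e"
    from low[OF this] have "K1 - e < V x" by blast
    then show "K1 \<le> V x + e" by simp
  qed
  show V2: "V x \<le> K2" for x
  proof (rule field_le_epsilon)
    fix e :: real assume "0 < e"
    from S.eventually_upper[OF this] have "V x < K2 + e" by simp
    then show "V x \<le> K2 + e" by simp
  qed
  show limbot: "(V \<longlongrightarrow> K1) at_bot"
  proof (rule tendstoI)
    fix e :: real assume e: "0 < e"
    obtain R where R: "\<And>x. x \<le> - R \<Longrightarrow> V x < K1 + e" using S.eventually_upper_left[OF e] by auto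
    show "\<forall>\<^sub>F x in at_bot. dist (V x) K1 < e"
      unfolding eventually_at_bot_linorder
      by (intro exI[of _ "- R"]) (use R V1 in \<open>force simp: dist_real_def\<close>)
  qed
  show limtop: "(V \<longlongrightarrow> K2) at_top"
  proof (rule tendstoI)
    fix e :: real assume e: "0 < e"
    then obtain R where R: "\<And>x. R \<le> x \<Longrightarrow> K2 - e < V x" using low[of e] by auto
    show "\<forall>\<^sub>F x in at_top. dist (V x) K2 < e"
      unfolding eventually_at_top_linorder
      by (intro exI[of _ R]) (use R V2 in \<open>force simp: dist_real_def\<close>)
  qed
  assume K12: "K1 < K2"
  obtain F1 where F1: "\<And>s. (F1 has_real_derivative - f1 s) (at s)"
    by (rule ex_antiderivative[of "\<lambda>s. - f1 s"]) (use kpp_continuous[OF kpp1] in \<open>auto intro: continuous_intros\<close>)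
  obtain F2 where F2: "\<And>s. (F2 has_real_derivative - f2 s) (at s)"
    by (rule ex_antiderivative[of "\<lambda>s. - f2 s"]) (use kpp_continuous[OF kpp2] in \<open>auto intro: continuous_intros\<close>)
  define \<Phi>1 where "\<Phi>1 = (\<lambda>s. F1 s - F1 K1)"
  define \<Phi>2 where "\<Phi>2 = (\<lambda>s. F2 s - F2 K2)"
  have Phi1: "(\<Phi>1 has_real_derivative - f1 s) (at s)" and Phi2: "(\<Phi>2 has_real_derivative - f2 s) (at s)" for s
    unfolding \<Phi>1_def \<Phi>2_def using DERIV_diff[OF F1 DERIV_const] DERIV_diff[OF F2 DERIV_const] by simp_all
  have zero: "\<Phi>1 K1 = 0" "\<Phi>2 K2 = 0" by (auto simp: \<Phi>1_def \<Phi>2_def)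
  have E1: "p x = sqrt (2 * \<Phi>1 (V x) / d1)" if "x \<le> 0" for x
  proof (rule left_energy[OF pos(1) p left(2) _ limbot Phi1 zero(1) that])
    show "f1 (V y) \<le> 0" for y
      using kpp_neg[OF kpp1, of "V y"] kpp_zero[OF kpp1] V1[of y] by (cases "V y = K1") auto
  qed auto
  \<comment> \<open>energy on the right, by reflection in space and value\<close>
  have E2: "p' x = sqrt (2 * \<Phi>2 (V x) / d2)" if x: "0 \<le> x" for x
  proof -
    define C where "C = K1 + K2"
    have refl: "((\<lambda>x. g (- x)) has_real_derivative - D) (at y within {..0})"
      if "(g has_real_derivative D) (at (- y) within {0..})" for g :: "real \<Rightarrow> real" and D y
    proof -
      have "((g \<circ> uminus) has_real_derivative D * (- 1)) (at y within {..0})"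
        by (rule DERIV_image_chain) (use that in \<open>auto intro!: derivative_eq_intros\<close>)
      then show ?thesis by (simp add: o_def)
    qed
    have "p' (- (- x)) = sqrt (2 * \<Phi>2 (C - (C - V (- (- x)))) / d2)"
    proof (rule left_energy[where V = "\<lambda>x. C - V (- x)" and p = "\<lambda>x. p' (- x)" and q = "\<lambda>x. - q' (- x)"
          and f = "\<lambda>s. - f2 (C - s)" and \<Phi> = "\<lambda>s. \<Phi>2 (C - s)" and K = K1 and x = "- x" and d = d2])
      show "((\<lambda>x. C - V (- x)) has_real_derivative p' (- y)) (at y within {..0})" if "y \<le> 0" for y
        using DERIV_diff[OF DERIV_const[of C] refl[OF p'(1)[of "- y"]]] that by simp
      show "((\<lambda>x. p' (- x)) has_real_derivative - q' (- y)) (at y within {..0})" if "y \<le> 0" for y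
        using refl[OF p'(2)[of "- y"]] that by simp
      show "d2 * - q' (- y) + - f2 (C - (C - V (- y))) = 0" if "y < 0" for y
        using right(2)[of "- y"] that by simp
      show "- f2 (C - (C - V (- y))) \<le> 0" for y
        using kpp_pos[OF kpp2, of "V (- y)"] kpp_zero[OF kpp2] V1[of "- y"] V2[of "- y"] K by (cases "V (- y) = K2") auto
      have "((\<lambda>x. V (- x)) \<longlongrightarrow> K2) at_bot"
        by (rule filterlim_compose[OF limtop filterlim_uminus_at_top_at_bot])
      then have "((\<lambda>x. C - V (- x)) \<longlongrightarrow> C - K2) at_bot" by (intro tendsto_intros)
      then show "((\<lambda>x. C - V (- x)) \<longlongrightarrow> K1) at_bot" by (simp add: C_def)
      have d: "((\<lambda>s. C - s) has_real_derivative - 1) (at s)" for s by (auto intro!: derivative_eq_intros)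
      show "((\<lambda>s. \<Phi>2 (C - s)) has_real_derivative - (- f2 (C - s))) (at s)" for s
        using DERIV_chain2[OF Phi2 d, of s] by simp
      show "\<Phi>2 (C - K1) = 0" using zero by (simp add: C_def)
    qed (use pos x in auto)
    then show ?thesis by simp
  qed
  have flux: "p 0 = \<sigma> * p' 0"
  proof -
    obtain D where D: "(V has_real_derivative \<sigma> * D) (at_left 0)" "(V has_real_derivative D) (at_right 0)"
      using Vs unfolding flux_condition_def by blast
    have "(V has_real_derivative p 0) (at_left 0)" "(V has_real_derivative p' 0) (at_right 0)"
      using p(1)[of 0] p'(1)[of 0] by (auto elim: has_field_derivative_subset)
    then have "p 0 = \<sigma> * D" "p' 0 = D"
      using D unfolding has_field_derivative_iff by (auto intro: tendsto_unique[rotated])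
    then show ?thesis by simp
  qed
  have nn: "0 \<le> \<Phi>1 (V 0)" "0 \<le> \<Phi>2 (V 0)"
  proof -
    show "0 \<le> \<Phi>1 (V 0)"
    proof (cases "V 0 = K1")
      case False
      then have "K1 < V 0" using V1[of 0] by simp
      have "\<Phi>1 K1 \<le> \<Phi>1 (V 0)"
      proof (rule DERIV_nonneg_imp_nondecreasing[OF V1])
        show "\<exists>y. (\<Phi>1 has_real_derivative y) (at s) \<and> 0 \<le> y" if "K1 \<le> s" "s \<le> V 0" for s
          using Phi1[of s] kpp_neg[OF kpp1, of s] kpp_zero[OF kpp1] that by (cases "s = K1") (auto intro!: exI[of _ "- f1 s"])
      qed
      then show ?thesis using zero by simp
    qed (use zero in simp)
    have "\<Phi>2 K2 \<le> \<Phi>2 (V 0)"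
    proof (rule DERIV_nonpos_imp_nonincreasing[OF V2])
      show "\<exists>y. (\<Phi>2 has_real_derivative y) (at s) \<and> y \<le> 0" if "V 0 \<le> s" "s \<le> K2" for s
        using Phi2[of s] kpp_pos[OF kpp2, of s] kpp_zero[OF kpp2] that V1[of 0] K
        by (cases "s = K2") (auto intro!: exI[of _ "- f2 s"])
    qed
    then show "0 \<le> \<Phi>2 (V 0)" using zero by simp
  qed
  have "front_profile d1 d2 \<sigma> K1 K2 (K1 / 2) f1 f2 \<Phi>1 \<Phi>2 V"
  proof
    show "(V has_real_derivative sqrt (2 * \<Phi>1 (V x) / d1)) (at x)" if "x < 0" for x
      using p(1)[of x] E1[of x] that by (simp add: within_left_imp_at)
    show "(V has_real_derivative sqrt (2 * \<Phi>2 (V x) / d2)) (at x)" if "0 < x" for x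
      using p'(1)[of x] E2[of x] that by (simp add: within_right_imp_at)
    have "(sqrt (2 * \<Phi>1 (V 0) / d1))\<^sup>2 = (\<sigma> * sqrt (2 * \<Phi>2 (V 0) / d2))\<^sup>2"
      using flux E1[of 0] E2[of 0] by simp
    then have "2 * \<Phi>1 (V 0) / d1 = \<sigma>\<^sup>2 * (2 * \<Phi>2 (V 0) / d2)"
      using nn pos by (simp add: power_mult_distrib)
    then show "d2 * \<Phi>1 (V 0) = \<sigma>\<^sup>2 * d1 * \<Phi>2 (V 0)" using pos by (simp add: field_simps)
  qed (use pos K K12 Phi1 Phi2 zero Vc V1 V2 kpp_neg[OF kpp1] kpp_neg[OF kpp2] kpp_pos[OF kpp1] kpp_pos[OF kpp2]
      kpp_continuous[OF kpp1] kpp_continuous[OF kpp2] in auto)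
  then show "\<exists>\<Phi>1 \<Phi>2. front_profile d1 d2 \<sigma> K1 K2 (K1 / 2) f1 f2 \<Phi>1 \<Phi>2 V" by blast
qed

section \<open>Convergence\<close>

context kpp_solution
begin

lemma local_convergence:
  assumes V: "positive_bounded_stationary_solution d1 d2 \<sigma> f1 f2 V" and X: "0 < X" and eta: "0 < \<eta>"
  shows "\<forall>\<^sub>F t in at_top. \<forall>x. \<bar>x\<bar> \<le> X \<longrightarrow> \<bar>u t x - V x\<bar> < \<eta>"
proof -
  note front = stationary_front[OF pos K kpp1 kpp2 V]
  have "(\<forall>\<^sub>F t in at_top. \<forall>x. \<bar>x\<bar> \<le> X \<longrightarrow> u t x < V x + \<eta>) \<and>
        (\<forall>\<^sub>F t in at_top. \<forall>x. \<bar>x\<bar> \<le> X \<longrightarrow> V x - \<eta> < u t x)"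
  proof (cases "K1 = K2")
    case True
    then have VK: "V x = K1" for x using front(1,2)[of x] by simp
    obtain R0 where "\<forall>\<^sub>F t in at_top. \<forall>x. \<bar>x\<bar> \<le> X \<longrightarrow> K1 - \<eta> < u t x \<and> (R0 \<le> x \<longrightarrow> K2 - \<eta> < u t x)"
      using eventually_lower[OF eta] by blast
    then show ?thesis using eventually_upper[OF eta] unfolding VK True[symmetric]
      by (auto elim: eventually_mono)
  next
    case False
    then have "K1 < K2" using K by simp
    then obtain \<Phi>1 \<Phi>2 where "front_profile d1 d2 \<sigma> K1 K2 (K1 / 2) f1 f2 \<Phi>1 \<Phi>2 V" using front(5) by blast
    then interpret F: front_profile d1 d2 \<sigma> K1 K2 "K1 / 2" f1 f2 \<Phi>1 \<Phi>2 V .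
    show ?thesis
    proof
      show "\<forall>\<^sub>F t in at_top. \<forall>x. \<bar>x\<bar> \<le> X \<longrightarrow> u t x < V x + \<eta>"
      proof (rule F.eventually_below[OF u _ _ X eta])
        show "\<forall>\<^sub>F t in at_top. \<forall>x. \<bar>x\<bar> \<le> R \<longrightarrow> u t x < K2 + e" if "0 < e" for e R
          using eventually_upper[OF that] by (rule eventually_mono) auto
        show "\<exists>R0. \<forall>R\<ge>R0. \<forall>\<^sub>F t in at_top. u t (- R) < K1 + e" if e: "0 < e" for e
        proof -
          obtain R0 where "\<forall>\<^sub>F t in at_top. \<forall>x\<le>-R0. u t x < K1 + e" using eventually_upper_left[OF e] by blast
          then have "\<forall>\<^sub>F t in at_top. u t (- R) < K1 + e" if "R0 \<le> R" for R
            by (rule eventually_mono) (use that in auto)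
          then show ?thesis by blast
        qed
      qed
      show "\<forall>\<^sub>F t in at_top. \<forall>x. \<bar>x\<bar> \<le> X \<longrightarrow> V x - \<eta> < u t x"
      proof (rule F.eventually_above[OF u _ _ X eta])
        show "\<forall>\<^sub>F t in at_top. \<forall>x. \<bar>x\<bar> \<le> R \<longrightarrow> K1 - e < u t x" if e: "0 < e" for e R
        proof -
          obtain R0 where "\<forall>\<^sub>F t in at_top. \<forall>x. \<bar>x\<bar> \<le> R \<longrightarrow> K1 - e < u t x \<and> (R0 \<le> x \<longrightarrow> K2 - e < u t x)"
            using eventually_lower[OF e] by blast
          then show ?thesis by (rule eventually_mono) auto
        qed
        show "\<exists>R0. \<forall>R\<ge>R0. \<forall>\<^sub>F t in at_top. K2 - e < u t R" if e: "0 < e" for e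
        proof -
          obtain R0 where R0: "\<And>X. \<forall>\<^sub>F t in at_top. \<forall>x. \<bar>x\<bar> \<le> X \<longrightarrow> K1 - e < u t x \<and> (R0 \<le> x \<longrightarrow> K2 - e < u t x)"
            using eventually_lower[OF e] by blast
          have "\<forall>\<^sub>F t in at_top. K2 - e < u t R" if "R0 \<le> R" for R
            using R0[of "\<bar>R\<bar>"] by (rule eventually_mono) (use that in auto)
          then show ?thesis by blast
        qed
      qed
    qed
  qed
  then have "\<forall>\<^sub>F t in at_top. \<forall>x. \<bar>x\<bar> \<le> X \<longrightarrow> u t x < V x + \<eta>"
    "\<forall>\<^sub>F t in at_top. \<forall>x. \<bar>x\<bar> \<le> X \<longrightarrow> V x - \<eta> < u t x" by auto
  then show ?thesis
  proof eventually_elim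
    case (elim t)
    show ?case
    proof (intro allI impI)
      fix x assume "\<bar>x\<bar> \<le> X"
      then have "u t x < V x + \<eta>" "V x - \<eta> < u t x" using elim by auto
      then show "\<bar>u t x - V x\<bar> < \<eta>" by linarith
    qed
  qed
qed

text \<open>Far from the interface both \<open>u\<close> and \<open>V\<close> are close to the
capacity of the patch; the rest is a compact interval.\<close>

lemma cone_convergence:
  assumes V: "positive_bounded_stationary_solution d1 d2 \<sigma> f1 f2 V"
    and b: "0 < b1" "b1 < spreading_speed d1 f1" "0 < b2" "b2 < spreading_speed d2 f2" and eta: "0 < \<eta>"
  shows "\<forall>\<^sub>F t in at_top. \<forall>x. - b1 * t \<le> x \<and> x \<le> b2 * t \<longrightarrow> \<bar>u t x - V x\<bar> < \<eta>"
proof -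
  note front = stationary_front[OF pos K kpp1 kpp2 V]
  define e where "e = \<eta> / 4"
  have e: "0 < e" "e + e < \<eta>" using eta by (auto simp: e_def)
  obtain R1 T where R1: "R1 > 0" "\<And>t x. t \<ge> T \<Longrightarrow> - b1 * t \<le> x \<and> x \<le> b2 * t \<Longrightarrow>
      K1 - e \<le> u t x \<and> (R1 \<le> x \<longrightarrow> K2 - e \<le> u t x)"
    using u_lower[OF b e(1)] by metis
  obtain R2 where R2: "\<forall>\<^sub>F t in at_top. \<forall>x\<le>-R2. u t x < K1 + e" using eventually_upper_left[OF e(1)] by blast
  obtain R3 where R3: "\<And>x. x \<le> R3 \<Longrightarrow> dist (V x) K1 < e"
    using tendstoD[OF front(3) e(1)] unfolding eventually_at_bot_linorder by blast
  obtain R4 where R4: "\<And>x. R4 \<le> x \<Longrightarrow> dist (V x) K2 < e"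
    using tendstoD[OF front(4) e(1)] unfolding eventually_at_top_linorder by blast
  define X where "X = max R1 (max R2 (max (- R3) R4))"
  have X: "R1 \<le> X" "R2 \<le> X" "- X \<le> R3" "R4 \<le> X" by (auto simp: X_def)
  have X0: "0 < X" using X R1 by linarith
  show ?thesis
    using local_convergence[OF V X0 eta] R2 eventually_upper[OF e(1)] eventually_ge_at_top[of T]
  proof eventually_elim
    case (elim t)
    show ?case
    proof (intro allI impI)
      fix x assume x: "- b1 * t \<le> x \<and> x \<le> b2 * t"
      have l: "K1 - e \<le> u t x" "R1 \<le> x \<Longrightarrow> K2 - e \<le> u t x" using R1(2)[OF elim(4) x] by auto
      consider "x \<le> - X" | "\<bar>x\<bar> \<le> X" | "X \<le> x" by linarith
      then show "\<bar>u t x - V x\<bar> < \<eta>"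
      proof cases
        case 1
        then have "u t x < K1 + e" "\<bar>V x - K1\<bar> < e" using elim(2) R3[of x] X by (auto simp: dist_real_def)
        then show ?thesis using l(1) front(1)[of x] e by linarith
      next
        case 2
        then show ?thesis using elim(1) by blast
      next
        case 3
        then have "K2 - e \<le> u t x" "\<bar>V x - K2\<bar> < e" using l(2) R4[of x] X by (auto simp: dist_real_def)
        then show ?thesis using elim(3)[rule_format, of x] front(2)[of x] e by linarith
      qed
    qed
  qed
qed

end

theorem theorem2p6:
  fixes d1 d2 \<sigma> K1 K2 :: real
    and f1 f2 u0 V :: "real \<Rightarrow> real"
    and u :: "real \<Rightarrow> real \<Rightarrow> real"
  assumes "0 < d1" and "0 < d2" and "0 < \<sigma>"
    and "0 < K1" and "K1 \<le> K2"
    and "KPP_reaction K1 f1" and "KPP_reaction K2 f2"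
    and "positive_bounded_stationary_solution d1 d2 \<sigma> f1 f2 V"
    and "continuous_on UNIV u0" and "bounded (range u0)"
    and "\<forall>x. 0 \<le> u0 x" and "\<exists>x. u0 x \<noteq> 0"
    and "nonneg_bounded_classical_solution d1 d2 \<sigma> f1 f2 u0 u"
  defines "c1 \<equiv> spreading_speed d1 f1" and "c2 \<equiv> spreading_speed d2 f2"
  shows "(\<forall>A. compact A \<longrightarrow> uniform_limit A u V at_top) \<and>
    (compact (closure {x. u0 x \<noteq> 0}) \<longrightarrow>
      0 < c1 \<and> 0 < c2 \<and>
      (\<forall>\<epsilon>>0. ((\<lambda>t. SUP x\<in>{..- (c1 + \<epsilon>) * t}. u t x) \<longlongrightarrow> 0) at_top \<and>
               ((\<lambda>t. SUP x\<in>{(c2 + \<epsilon>) * t..}. u t x) \<longlongrightarrow> 0) at_top) \<and>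
      (\<forall>\<epsilon>. 0 < \<epsilon> \<and> \<epsilon> \<le> min c1 c2 \<longrightarrow>
        ((\<lambda>t. SUP x\<in>{(- c1 + \<epsilon>) * t..(c2 - \<epsilon>) * t}. \<bar>u t x - V x\<bar>) \<longlongrightarrow> 0) at_top))"
proof -
  note pos = assms(1-3) and K = assms(4,5) and kpp = assms(6,7) and V = assms(8)
  have sol: "classical_solution d1 d2 \<sigma> f1 f2 u0 u" and nn: "\<And>t x. 0 \<le> t \<Longrightarrow> 0 \<le> u t x"
    and bd: "bounded {u t x | t x. 0 \<le> t}"
    using assms(13) unfolding nonneg_bounded_classical_solution_def by auto
  have u0: "u 0 x = u0 x" for x using sol unfolding classical_solution_def by blast
  obtain M where M: "\<And>y. y \<in> {u t x | t x. 0 \<le> t} \<Longrightarrow> norm y \<le> M" using bd unfolding bounded_iff by blast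
  have uM: "u t x \<le> M" if "0 \<le> t" for t x
  proof -
    have "norm (u t x) \<le> M" by (rule M) (use that in blast)
    then show ?thesis by simp
  qed
  obtain x0 where x0: "u0 x0 \<noteq> 0" using assms(12) by blast
  have tp: "two_patch d1 d2 \<sigma> f1 f2 u" using sol by (rule classical_solution_two_patch)
  interpret S: kpp_solution d1 d2 \<sigma> K1 K2 f1 f2 u M x0
    by unfold_locales (use pos K kpp tp nn uM x0 u0 in auto)
  have speeds: "0 < c1" "0 < c2" using S.speeds_pos by (auto simp: c1_def c2_def)
  have local: "uniform_limit A u V at_top" if "compact A" for A
  proof (rule uniform_limitI)
    fix \<eta> :: real assume eta: "0 < \<eta>"
    obtain X where X: "\<And>x. x \<in> A \<Longrightarrow> \<bar>x\<bar> \<le> X"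
      using compact_imp_bounded[OF \<open>compact A\<close>] unfolding bounded_iff by auto
    have "0 < \<bar>X\<bar> + 1" by simp
    from S.local_convergence[OF V this eta]
    show "\<forall>\<^sub>F t in at_top. \<forall>x\<in>A. dist (u t x) (V x) < \<eta>"
    proof eventually_elim
      case (elim t)
      then show ?case using X by (force simp: dist_real_def)
    qed
  qed
  have outer: "((\<lambda>t. SUP x\<in>{..- (c1 + \<epsilon>) * t}. u t x) \<longlongrightarrow> 0) at_top"
    "((\<lambda>t. SUP x\<in>{(c2 + \<epsilon>) * t..}. u t x) \<longlongrightarrow> 0) at_top"
    if supp: "compact (closure {x. u0 x \<noteq> 0})" and eps: "0 < \<epsilon>" for \<epsilon>
  proof -
    obtain B where B: "\<And>x. x \<in> closure {x. u0 x \<noteq> 0} \<Longrightarrow> \<bar>x\<bar> \<le> B"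
      using compact_imp_bounded[OF supp] unfolding bounded_iff by auto
    have zero: "u 0 x = 0" if "B + 1 \<le> \<bar>x\<bar>" for x
      using B[of x] that closure_subset[of "{x. u0 x \<noteq> 0}"] unfolding u0 by force
    show "((\<lambda>t. SUP x\<in>{(c2 + \<epsilon>) * t..}. u t x) \<longlongrightarrow> 0) at_top"
    proof (rule sup_tendsto_zero)
      show "\<forall>\<^sub>F t in at_top. {(c2 + \<epsilon>) * t..} \<noteq> {} \<and> (\<forall>x\<in>{(c2 + \<epsilon>) * t..}. 0 \<le> u t x)"
        using eventually_ge_at_top[of 0] by eventually_elim (use nn in auto)
      show "\<forall>\<^sub>F t in at_top. \<forall>x\<in>{(c2 + \<epsilon>) * t..}. u t x \<le> e" if e: "0 < e" for e
        using spreading_upper_right[OF tp pos S.bnd kpp(2) S.K2_pos _ eps e, of "B + 1"] zero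
        by (auto simp: c2_def elim!: eventually_mono)
    qed
    show "((\<lambda>t. SUP x\<in>{..- (c1 + \<epsilon>) * t}. u t x) \<longlongrightarrow> 0) at_top"
    proof (rule sup_tendsto_zero)
      show "\<forall>\<^sub>F t in at_top. {..- (c1 + \<epsilon>) * t} \<noteq> {} \<and> (\<forall>x\<in>{..- (c1 + \<epsilon>) * t}. 0 \<le> u t x)"
        using eventually_ge_at_top[of 0] by eventually_elim (use nn in auto)
      fix e :: real assume e: "0 < e"
      have "\<forall>\<^sub>F t in at_top. \<forall>x. (spreading_speed d1 f1 + \<epsilon>) * t \<le> x \<longrightarrow> u t (- x) \<le> e"
        by (rule spreading_upper_right[OF two_patch_reflect_space[OF tp pos(3)] pos(2,1) _ _ kpp(1) K(1) _ eps e,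
              of M "B + 1"]) (use S.bnd zero pos in auto)
      then show "\<forall>\<^sub>F t in at_top. \<forall>x\<in>{..- (c1 + \<epsilon>) * t}. u t x \<le> e"
      proof eventually_elim
        case (elim t)
        show ?case
        proof
          fix x assume "x \<in> {..- (c1 + \<epsilon>) * t}"
          then show "u t x \<le> e" using elim[rule_format, of "- x"] by (simp add: c1_def algebra_simps)
        qed
      qed
    qed
  qed
  have inner: "((\<lambda>t. SUP x\<in>{(- c1 + \<epsilon>) * t..(c2 - \<epsilon>) * t}. \<bar>u t x - V x\<bar>) \<longlongrightarrow> 0) at_top"
    if eps: "0 < \<epsilon>" "\<epsilon> \<le> min c1 c2" for \<epsilon>
  proof (rule sup_tendsto_zero)
    show "\<forall>\<^sub>F t in at_top. {(- c1 + \<epsilon>) * t..(c2 - \<epsilon>) * t} \<noteq> {} \<and>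
        (\<forall>x\<in>{(- c1 + \<epsilon>) * t..(c2 - \<epsilon>) * t}. 0 \<le> \<bar>u t x - V x\<bar>)"
      using eventually_ge_at_top[of 0]
    proof eventually_elim
      case (elim t)
      have "(- c1 + \<epsilon>) * t \<le> (c2 - \<epsilon>) * t" using eps elim by (intro mult_right_mono) auto
      then show ?case by auto
    qed
    fix e :: real assume e: "0 < e"
    \<comment> \<open>a slightly larger cone, so that both speeds are positive even when one of the
      given speeds is zero\<close>
    have b: "0 < c1 - \<epsilon> / 2" "c1 - \<epsilon> / 2 < spreading_speed d1 f1" "0 < c2 - \<epsilon> / 2" "c2 - \<epsilon> / 2 < spreading_speed d2 f2"
      using eps by (auto simp: c1_def c2_def)
    show "\<forall>\<^sub>F t in at_top. \<forall>x\<in>{(- c1 + \<epsilon>) * t..(c2 - \<epsilon>) * t}. \<bar>u t x - V x\<bar> \<le> e"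
      using S.cone_convergence[OF V b e] eventually_ge_at_top[of 0]
    proof eventually_elim
      case (elim t)
      have sub: "- (c1 - \<epsilon> / 2) * t \<le> (- c1 + \<epsilon>) * t" "(c2 - \<epsilon>) * t \<le> (c2 - \<epsilon> / 2) * t"
        using eps elim(2) by (auto intro!: mult_right_mono)
      show ?case
      proof
        fix x assume "x \<in> {(- c1 + \<epsilon>) * t..(c2 - \<epsilon>) * t}"
        then have "- (c1 - \<epsilon> / 2) * t \<le> x" "x \<le> (c2 - \<epsilon> / 2) * t" using sub by auto
        then have "\<bar>u t x - V x\<bar> < e" using elim(1) by simp
        then show "\<bar>u t x - V x\<bar> \<le> e" by simp
      qed
    qed
  qed
  show ?thesis using local outer inner speeds by blast
qed

end
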